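(* Let $\mathbb{K}$, $\mathbf{p}$, $R$, $N$ be as in the context, and let $f:\mathbb{K}^2\to\mathbb{C}$ be Schwartz–Bruhat with Fourier support in $\mathcal{N}_{R^{-1}}(\mathbb{P}^1)$. Then for every $\alpha>0$, \[ \alpha^4\mu\big(\{x\in\mathbb{K}^2:|f(x)|>\alpha\}\big)\leq 13\,\mathbf{p}^{12}(\log R)^{10}\sum_{\substack{s\in\mathbf{p}^{\mathbb{Z}}\\ R^{-1/2}\leq s\leq 1}}\ \sum_{\substack{\tau\\ \mathrm{diam}(\tau)=s}}\ \sum_{U\in\mathcal{G}_\tau}\mu(U)\Big(\frac{1}{\mu(U)}\int_U\sum_{\theta\prec\tau}|f_\theta|^2\Big)^2 . \]
   Context: $\mathbb{K}$ is a non-Archimedean local field with $\mathrm{char}(\mathbb{K})\neq2$, absolute value $|\cdot|$ normalized to be the modular function, $\mathcal{O}=\{|x|\leq1\}$, $\varpi$ a uniformizer; $\eta$ is the least positive integer with $\mathbf{p}:=|\varpi|^{-\eta}\geq|2|^{-1}$. $R\in\mathbf{p}^{2\mathbb{N}}$, $N=\frac12\log_{\mathbf{p}}R$; $\log$ is natural log. $\mu$ is Haar measure on $\mathbb{K}^2$; $|x|=\max(|x_1|,|x_2|)$ on $\mathbb{K}^2$. Fourier transform $\hat f(\xi)=\int e(x\cdot\xi)f(x)d\mu(x)$ with $e$ an additive character trivial on $\mathcal{O}$, nontrivial on $\varpi^{-1}\mathcal{O}$; Schwartz–Bruhat = finite linear combination of indicators of balls; $f_A$ is the Fourier projection of $f$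 onto $A$. $\mathcal{N}_{R^{-1}}(\mathbb{P}^1)=\{(x,y):|x|\leq1,|y-x^2|\leq R^{-1}\}$. For a closed ball $I\subseteq\mathcal{O}$ of radius $s$, the cap above $I$ is $\tau_I=\{(x,y):x\in I,\ |y-x^2|\leq s^2\}$, of diameter $s$; caps of diameter $R^{-1/2}$ are denoted $\theta$; $\theta\prec\tau$ means $\theta=\tau_J,\tau=\tau_I$ with $J\subseteq I$. For a cap $\tau$ of diameter $s$, $\#\tau$ denotes the number of caps of diameter $s$ with $f_\tau\not\equiv0$. For such $\tau$, pick $c$ with $(c,c^2)\in\tau$ and let $U_\tau^0=\{(x_1,x_2)\in\mathbb{K}^2:|x_1+2cx_2|\leq sR,\ |x_2|\leq R\}$ (a rectangle of dimensions $R\times sR$ centered at $0$ whose long side points along the normal direction to $\mathbb{P}^1$ at $(c,c^2)$); the tiles are the translates of $U_\tau^0$. $\mathcal{G}_\tau$ is the set of such tiles $U$ satisfying $\frac{e^2}{2}\frac{(\log R)^2}{(\log\mathbf{p})^2}\frac{1}{\mu(U)}\int_U\sum_{\theta\prec\tau}|f_\theta|^2\geq\frac{\alpha^2}{(\#\tau)^2}$. *)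

theory Defs
  imports "HOL-Analysis.Analysis"
begin

text \<open>Abstract non-Archimedean local field: a field with a discrete,
non-trivial ultrametric absolute value, complete, with finite residue field,
normalized as the modulus (absolute value of a uniformizer = 1/q).\<close>

definition residue_classes :: "('a::field \<Rightarrow> real) \<Rightarrow> 'a set set" where
  "residue_classes av = (\<lambda>x. {y. av (y - x) < 1}) ` {x. av x \<le> 1}"

definition nonarch_local_field :: "('a::field \<Rightarrow> real) \<Rightarrow> 'a \<Rightarrow> bool" where
  "nonarch_local_field av \<pi> \<longleftrightarrow>
     (\<forall>x. 0 \<le> av x) \<and> (\<forall>x. av x = 0 \<longleftrightarrow> x = 0) \<and>
     (\<forall>x y. av (x * y) = av x * av y) \<and>
     (\<forall>x y. av (x + y) \<le> max (av x) (av y)) \<and>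
     0 < av \<pi> \<and> av \<pi> < 1 \<and>
     (\<forall>x. x \<noteq> 0 \<longrightarrow> (\<exists>k::int. av x = av \<pi> powi k)) \<and>
     finite (residue_classes av) \<and>
     av \<pi> = 1 / real (card (residue_classes av)) \<and>
     (\<forall>X::nat \<Rightarrow> 'a. (\<forall>\<epsilon>>0. \<exists>M. \<forall>m\<ge>M. \<forall>n\<ge>M. av (X m - X n) < \<epsilon>) \<longrightarrow>
        (\<exists>L. \<forall>\<epsilon>>0. \<exists>M. \<forall>n\<ge>M. av (X n - L) < \<epsilon>)) \<and>
     (2::'a) \<noteq> 0"

definition additive_char :: "('a::field \<Rightarrow> real) \<Rightarrow> 'a \<Rightarrow> ('a \<Rightarrow> complex) \<Rightarrow> bool" where
  "additive_char av \<pi> e \<longleftrightarrow>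
     (\<forall>x y. e (x + y) = e x * e y) \<and> (\<forall>x. cmod (e x) = 1) \<and>
     (\<forall>x. av x \<le> 1 \<longrightarrow> e x = 1) \<and>
     (\<exists>x. av x \<le> 1 / av \<pi> \<and> e x \<noteq> 1)"

definition nrm2 :: "('a::field \<Rightarrow> real) \<Rightarrow> 'a \<times> 'a \<Rightarrow> real" where
  "nrm2 av z = max (av (fst z)) (av (snd z))"

definition ball2 :: "('a::field \<Rightarrow> real) \<Rightarrow> 'a \<times> 'a \<Rightarrow> real \<Rightarrow> ('a \<times> 'a) set" where
  "ball2 av a r = {z. nrm2 av (fst z - fst a, snd z - snd a) \<le> r}"

definition transl2 :: "'a::field \<times> 'a \<Rightarrow> ('a \<times> 'a) set \<Rightarrow> ('a \<times> 'a) set" where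
  "transl2 a A = (\<lambda>z. (fst a + fst z, snd a + snd z)) ` A"

text \<open>Haar measure on K^2 (Borel sets = sigma algebra generated by balls),
normalized so that O^2 has measure 1.\<close>
definition haar2 :: "('a::field \<Rightarrow> real) \<Rightarrow> ('a \<times> 'a) measure \<Rightarrow> bool" where
  "haar2 av mu \<longleftrightarrow>
     space mu = UNIV \<and>
     sets mu = sigma_sets UNIV {ball2 av a r | a r. 0 < r} \<and>
     (\<forall>A\<in>sets mu. \<forall>a. emeasure mu (transl2 a A) = emeasure mu A) \<and>
     emeasure mu (ball2 av (0, 0) 1) = 1"

definition schwartz_bruhat :: "('a::field \<Rightarrow> real) \<Rightarrow> ('a \<times> 'a \<Rightarrow> complex) \<Rightarrow> bool" where
  "schwartz_bruhat av f \<longleftrightarrow>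
     (\<exists>n (c::nat \<Rightarrow> complex) a r. (\<forall>i<n. 0 < r i) \<and>
        f = (\<lambda>x. \<Sum>i<n. c i * indicator (ball2 av (a i) (r i)) x))"

definition dot2 :: "'a::field \<times> 'a \<Rightarrow> 'a \<times> 'a \<Rightarrow> 'a" where
  "dot2 x \<xi> = fst x * fst \<xi> + snd x * snd \<xi>"

definition fourier :: "('a::field \<times> 'a) measure \<Rightarrow> ('a \<Rightarrow> complex) \<Rightarrow> ('a \<times> 'a \<Rightarrow> complex) \<Rightarrow> 'a \<times> 'a \<Rightarrow> complex" where
  "fourier mu e f \<xi> = integral\<^sup>L mu (\<lambda>x. e (dot2 x \<xi>) * f x)"

definition fproj :: "('a::field \<times> 'a) measure \<Rightarrow> ('a \<Rightarrow> complex) \<Rightarrow> ('a \<times> 'a \<Rightarrow> complex) \<Rightarrow> ('a \<times> 'a) set \<Rightarrow> 'a \<times> 'a \<Rightarrow> complex" where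
  "fproj mu e f A x = integral\<^sup>L mu (\<lambda>\<xi>. e (- dot2 x \<xi>) * indicator A \<xi> * fourier mu e f \<xi>)"

definition nbhdP :: "('a::field \<Rightarrow> real) \<Rightarrow> real \<Rightarrow> ('a \<times> 'a) set" where
  "nbhdP av R = {(x, y). av x \<le> 1 \<and> av (y - x ^ 2) \<le> 1 / R}"

definition cap :: "('a::field \<Rightarrow> real) \<Rightarrow> 'a \<Rightarrow> real \<Rightarrow> ('a \<times> 'a) set" where
  "cap av c s = {(x, y). av (x - c) \<le> s \<and> av (y - x ^ 2) \<le> s ^ 2}"

definition caps :: "('a::field \<Rightarrow> real) \<Rightarrow> real \<Rightarrow> ('a \<times> 'a) set set" where
  "caps av s = {cap av c s | c. av c \<le> 1}"

definition prec :: "('a::field \<Rightarrow> real) \<Rightarrow> real \<Rightarrow> real \<Rightarrow> ('a \<times> 'a) set \<Rightarrow> ('a \<times> 'a) set \<Rightarrow> bool" where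
  "prec av r s \<theta> \<tau> \<longleftrightarrow> (\<exists>c d. av c \<le> 1 \<and> av d \<le> 1 \<and> \<theta> = cap av d r \<and> \<tau> = cap av c s \<and>
       {x. av (x - d) \<le> r} \<subseteq> {x. av (x - c) \<le> s})"

definition numcaps :: "('a::field \<Rightarrow> real) \<Rightarrow> ('a \<times> 'a) measure \<Rightarrow> ('a \<Rightarrow> complex) \<Rightarrow> ('a \<times> 'a \<Rightarrow> complex) \<Rightarrow> real \<Rightarrow> nat" where
  "numcaps av mu e f s = card {\<tau> \<in> caps av s. \<exists>x. fproj mu e f \<tau> x \<noteq> 0}"

definition tile0 :: "('a::field \<Rightarrow> real) \<Rightarrow> 'a \<Rightarrow> real \<Rightarrow> real \<Rightarrow> ('a \<times> 'a) set" where
  "tile0 av c s R = {(x1, x2). av (x1 + 2 * c * x2) \<le> s * R \<and> av x2 \<le> R}"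

definition tiles :: "('a::field \<Rightarrow> real) \<Rightarrow> real \<Rightarrow> real \<Rightarrow> ('a \<times> 'a) set \<Rightarrow> ('a \<times> 'a) set set" where
  "tiles av s R \<tau> = {U. \<exists>c a. (c, c ^ 2) \<in> \<tau> \<and> U = transl2 a (tile0 av c s R)}"

definition sqfun :: "('a::field \<Rightarrow> real) \<Rightarrow> ('a \<times> 'a) measure \<Rightarrow> ('a \<Rightarrow> complex) \<Rightarrow> ('a \<times> 'a \<Rightarrow> complex) \<Rightarrow> real \<Rightarrow> real \<Rightarrow> ('a \<times> 'a) set \<Rightarrow> 'a \<times> 'a \<Rightarrow> real" where
  "sqfun av mu e f R s \<tau> x =
     (\<Sum>\<theta>\<in>{\<theta> \<in> caps av (1 / sqrt R). prec av (1 / sqrt R) s \<theta> \<tau>}. (cmod (fproj mu e f \<theta> x))\<^sup>2)"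

definition avgsq :: "('a::field \<Rightarrow> real) \<Rightarrow> ('a \<times> 'a) measure \<Rightarrow> ('a \<Rightarrow> complex) \<Rightarrow> ('a \<times> 'a \<Rightarrow> complex) \<Rightarrow> real \<Rightarrow> real \<Rightarrow> ('a \<times> 'a) set \<Rightarrow> ('a \<times> 'a) set \<Rightarrow> real" where
  "avgsq av mu e f R s \<tau> U = (1 / measure mu U) * (LINT x:U|mu. sqfun av mu e f R s \<tau> x)"

definition eta :: "('a::field \<Rightarrow> real) \<Rightarrow> 'a \<Rightarrow> nat" where
  "eta av \<pi> = (LEAST n::nat. 0 < n \<and> (1 / av \<pi>) ^ n \<ge> 1 / av 2)"

definition bfp :: "('a::field \<Rightarrow> real) \<Rightarrow> 'a \<Rightarrow> real" where
  "bfp av \<pi> = (1 / av \<pi>) ^ eta av \<pi>"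

definition good :: "('a::field \<Rightarrow> real) \<Rightarrow> 'a \<Rightarrow> ('a \<times> 'a) measure \<Rightarrow> ('a \<Rightarrow> complex) \<Rightarrow> ('a \<times> 'a \<Rightarrow> complex) \<Rightarrow> real \<Rightarrow> real \<Rightarrow> real \<Rightarrow> ('a \<times> 'a) set \<Rightarrow> ('a \<times> 'a) set set" where
  "good av \<pi> mu e f R \<alpha> s \<tau> =
     {U \<in> tiles av s R \<tau>.
        (exp 1)\<^sup>2 / 2 * (ln R)\<^sup>2 / (ln (bfp av \<pi>))\<^sup>2 * avgsq av mu e f R s \<tau> U
          \<ge> \<alpha>\<^sup>2 / (real (numcaps av mu e f s))\<^sup>2}"

end

theory Submission
  imports Defs
begin

text \<open>Every tile test is made on the uncut family, so the pieces are defined in one pass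
  instead of by pruning scale after scale. This works because a test at level \<open>j\<close> is
  constant on translates of \<open>T j c\<close>, which contains the small tile
  \<open>T N c\<close>: multiplying by its indicator leaves the characters exactly as they were, and
  the indicator passes through the averaging at its own level. For functions invariant under a small
  tile, averaging over a larger tile of the same direction only adds horizontal translations. It is
  therefore encoded (\<open>E j\<close>) as one finite mean of horizontal shifts, the same for all
  directions. Differentiating the parabola produces factors 2, possibly of small absolute value;
  since \<open>1 / P \<le> av 2\<close>, each is paid for by one step of the scale. The value
  \<alpha> is split as 1/9 for the good part, 5/8 shared equally by the parts bad at a level below
  \<open>N\<close>, and 19/72 for the part bad at level \<open>N\<close>, which is small
  everywhere.\<close>

text \<open>
  Let \<open>P\<close> be the paper's \<open>\<^bold>p\<close>, so \<open>R = P ^ (2 N)\<close>. All objects are locally constant with bounded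
  support, and "Fourier support in a cap" is used only through its physical-side form: translating
  \<open>f\<^sub>\<theta>\<close> by an element of the dual tile multiplies it by a character. Two functions that are multiplied
  by different characters under a common translation are orthogonal.

  Each \<open>f\<^sub>\<theta>\<close> is cut according to which of the tiles \<open>U\<^sub>\<tau>\<close>, \<open>\<theta> \<prec> \<tau>\<close>, around a point are good: the part
  where all are good, and for each level \<open>k\<close> the part where the tile at level \<open>k\<close> is bad and the tiles
  at all finer levels are good. Cutting preserves the characters. For the good part, biorthogonality
  of the parabola bounds the fourth moment by the square function, and the square of the square
  function by averages over tiles, which vanish on bad tiles. For the part that is bad at level
  \<open>k\<close>, the average of the square function over level-\<open>k\<close> tiles is too small to explain the value
  \<open>\<alpha>\<close>, so the square function at scale \<open>k\<close> is dominated by its high frequencies, whose second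
  moment involves tiles at finer levels only. A broad/narrow decomposition and a bilinear estimate on
  the boxes on which this domination is constant turn it into a bound on the superlevel set.
\<close>

subsection \<open>Non-Archimedean local fields\<close>

locale local_field =
  fixes av :: "'a::field \<Rightarrow> real" and \<pi> :: 'a
  assumes nonarch: "nonarch_local_field av \<pi>"
begin

lemma av_nonneg [simp]: "0 \<le> av x"
  and av_eq_0_iff [simp]: "av x = 0 \<longleftrightarrow> x = 0"
  and av_mult: "av (x * y) = av x * av y"
  and av_add_le: "av (x + y) \<le> max (av x) (av y)"
  and av_pi_pos: "0 < av \<pi>" and av_pi_less_1: "av \<pi> < 1"
  and av_discrete: "x \<noteq> 0 \<Longrightarrow> \<exists>k::int. av x = av \<pi> powi k"
  and finite_residue_classes: "finite (residue_classes av)"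
  and av_pi_eq: "av \<pi> = 1 / real (card (residue_classes av))"
  and two_nonzero: "(2::'a) \<noteq> 0"
  using nonarch unfolding nonarch_local_field_def by blast+

lemma av_0 [simp]: "av 0 = 0"
  by simp

lemma av_pos_iff: "0 < av x \<longleftrightarrow> x \<noteq> 0"
  using av_nonneg[of x] av_eq_0_iff[of x] by linarith

lemma av_1 [simp]: "av 1 = 1"
proof -
  have "av 1 * av 1 = av 1" using av_mult[of 1 1] by simp
  moreover have "av 1 \<noteq> 0" by simp
  ultimately show ?thesis by (metis mult_cancel_left1)
qed

lemma av_minus [simp]: "av (- x) = av x"
proof -
  have "(av (-1))\<^sup>2 = 1" using av_mult[of "-1" "-1"] by (simp add: power2_eq_square)
  then have "av (-1) = 1" by (metis av_nonneg abs_of_nonneg real_sqrt_abs real_sqrt_one)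
  then show ?thesis using av_mult[of "-1" x] by simp
qed

lemma av_diff_le: "av (x - y) \<le> max (av x) (av y)"
  using av_add_le[of x "-y"] by simp

lemma av_add_leI: "av x \<le> r \<Longrightarrow> av y \<le> r \<Longrightarrow> av (x + y) \<le> r"
  using av_add_le[of x y] by simp

lemma av_diff_leI: "av x \<le> r \<Longrightarrow> av y \<le> r \<Longrightarrow> av (x - y) \<le> r"
  using av_diff_le[of x y] by simp

lemma av_commute: "av (x - y) = av (y - x)"
  using av_minus[of "x - y"] by simp

lemma av_diff_trans: "av (x - y) \<le> r \<Longrightarrow> av (y - z) \<le> r \<Longrightarrow> av (x - z) \<le> r"
  using av_add_leI[of "x - y" r "y - z"] by simp

lemma av_add_eq: assumes "av y < av x" shows "av (x + y) = av x"
proof (rule antisym)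
  show "av (x + y) \<le> av x" using av_add_le[of x y] assms by simp
  have "av x \<le> max (av (x + y)) (av y)" using av_diff_le[of "x + y" y] by simp
  then show "av x \<le> av (x + y)" using assms by linarith
qed

lemma av_inverse: "av (inverse x) = inverse (av x)"
proof (cases "x = 0")
  case False
  have "av x * av (inverse x) = 1" using False av_mult[of x "inverse x"] by simp
  then show ?thesis by (metis inverse_unique)
qed simp

lemma av_divide: "av (x / y) = av x / av y"
  by (simp add: divide_inverse av_mult av_inverse)

lemma av_power: "av (x ^ n) = av x ^ n"
  by (induction n) (simp_all add: av_mult)

text \<open>The values of \<open>av\<close> are powers of \<open>av \<pi>\<close>, so a strict
  inequality gains a full factor \<open>av \<pi>\<close>. This factor later pays for the character
  being nontrivial only on the ball of radius \<open>1 / av \<pi>\<close>.\<close>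

lemma av_gap: assumes "z \<noteq> 0" "av z < av x" shows "av z \<le> av x * av \<pi>"
proof -
  have x: "x \<noteq> 0" using assms(2) av_nonneg[of z] by (auto simp: not_le[symmetric])
  then obtain k where k: "av (x / z) = av \<pi> powi k"
    using av_discrete[of "x / z"] assms by auto
  have "1 < av (x / z)" using assms by (simp add: av_divide av_pos_iff)
  then have "k < 0"
    using k av_pi_pos av_pi_less_1 power_int_le_one[of "av \<pi>" k] by force
  then have "av \<pi> powi (-1) \<le> av \<pi> powi k"
    using av_pi_pos av_pi_less_1 by (intro power_int_decreasing) auto
  then have "1 / av \<pi> \<le> av x / av z"
    using k by (simp add: av_divide power_int_minus field_simps)
  then show ?thesis using assms av_pi_pos by (simp add: field_simps av_pos_iff)
qed

text \<open>A ball of any real radius equals a ball whose radius is an attained value;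
  \<open>k\<close> below is the least exponent with \<open>av \<pi> powi k \<le> r\<close>. The last
  conclusion is what the volume formulas for balls need.\<close>

lemma ex_av_radius: assumes "0 < r"
  obtains z where "z \<noteq> 0" "\<And>x. av x \<le> r \<longleftrightarrow> av x \<le> av z"
    "\<exists>n. z = \<pi> ^ n \<or> z = inverse (\<pi> ^ n)"
proof -
  have pi0: "\<pi> \<noteq> 0" using av_pi_pos by auto
  define k where "k = \<lceil>ln r / ln (av \<pi>)\<rceil>"
  have lnp: "ln (av \<pi>) < 0" using av_pi_pos av_pi_less_1 by simp
  have ln_powi: "ln (av \<pi> powi j) = of_int j * ln (av \<pi>)" for j :: int
  proof -
    have "av \<pi> powi j = av \<pi> powr (of_int j)" using pi0 by (simp add: powr_real_of_int')
    then show ?thesis using av_pi_pos by (simp add: ln_powr)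
  qed
  have *: "av \<pi> powi j \<le> t \<longleftrightarrow> ln t / ln (av \<pi>) \<le> of_int j" if "0 < t" for t and j :: int
  proof -
    have "av \<pi> powi j \<le> t \<longleftrightarrow> ln (av \<pi> powi j) \<le> ln t"
      using that av_pi_pos by simp
    also have "ln (av \<pi> powi j) = of_int j * ln (av \<pi>)"
      by (rule ln_powi)
    finally show ?thesis using lnp by (simp add: field_simps)
  qed
  define z where "z = \<pi> powi k"
  have avz: "av z = av \<pi> powi k"
    unfolding z_def by (cases "0 \<le> k") (auto simp: power_int_def av_power av_inverse)
  have "av x \<le> r \<longleftrightarrow> av x \<le> av z" for x
  proof (cases "x = 0")
    case False
    then obtain j where j: "av x = av \<pi> powi j" using av_discrete by blast
    have z: "0 < av \<pi> powi k" using av_pi_pos by simp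
    have "ln (av \<pi> powi k) / ln (av \<pi>) = of_int k"
      using lnp by (simp add: ln_powi)
    then show ?thesis using *[OF assms, of j] *[OF z, of j] unfolding j avz k_def
      by (simp add: ceiling_le_iff)
  qed (use assms in simp)
  moreover have "z \<noteq> 0" using pi0 by (simp add: z_def)
  moreover have "\<exists>n. z = \<pi> ^ n \<or> z = inverse (\<pi> ^ n)"
    unfolding z_def power_int_def by (auto simp: power_inverse)
  ultimately show ?thesis using that by blast
qed

section \<open>Systems of representatives for small balls\<close>

definition residue_card :: nat where
  "residue_card = card (residue_classes av)"

lemma av_pi_residue_card: "av \<pi> * real residue_card = 1" "residue_card > 0"
  using av_pi_eq av_pi_pos unfolding residue_card_def by (auto simp: card_gt_0_iff)

definition transversal :: "'a set \<Rightarrow> real \<Rightarrow> bool" where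
  "transversal A r \<longleftrightarrow> finite A \<and> (\<forall>a\<in>A. av a \<le> 1) \<and>
     (\<forall>x. av x \<le> 1 \<longrightarrow> (\<exists>a\<in>A. av (x - a) \<le> r)) \<and>
     (\<forall>a\<in>A. \<forall>b\<in>A. av (a - b) \<le> r \<longrightarrow> a = b)"

lemma residue_transversal: "\<exists>A. transversal A (av \<pi>) \<and> card A = residue_card"
proof -
  let ?cl = "\<lambda>x. {y. av (y - x) < 1}"
  have pi0: "\<pi> \<noteq> 0" using av_pi_pos by auto
  have lt1: "av x < 1 \<longleftrightarrow> av x \<le> av \<pi>" for x
  proof (cases "x = 0")
    case False
    show ?thesis using av_gap[OF False, of 1] av_pi_less_1 by auto
  qed (simp add: av_pi_pos less_imp_le)
  have cl_eq: "?cl x = ?cl y \<longleftrightarrow> av (x - y) < 1" for x y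
  proof
    assume "?cl x = ?cl y" then show "av (x - y) < 1" by auto
  next
    assume a: "av (x - y) < 1"
    have "av (z - x) < 1 \<longleftrightarrow> av (z - y) < 1" for z
      using a av_diff_trans[of z x "av \<pi>" y] av_diff_trans[of z y "av \<pi>" x] av_commute[of x y]
      unfolding lt1 by metis
    then show "?cl x = ?cl y" by blast
  qed
  obtain A where A: "A \<subseteq> {x. av x \<le> 1}" "inj_on ?cl A" "?cl ` {x. av x \<le> 1} = ?cl ` A"
    using subset_image_inj[of "?cl ` {x. av x \<le> 1}" ?cl "{x. av x \<le> 1}"] by auto
  have "card A = residue_card" "finite A"
    using A finite_residue_classes unfolding residue_card_def residue_classes_def
    by (auto simp: card_image dest: finite_imageD)
  moreover have "\<exists>a\<in>A. av (x - a) \<le> av \<pi>" if "av x \<le> 1" for x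
  proof -
    have "?cl x \<in> ?cl ` A" using that A(3) by blast
    then obtain a where "a \<in> A" "?cl x = ?cl a" by auto
    then show ?thesis using cl_eq[of x a] lt1 by auto
  qed
  moreover have "a = b" if "a \<in> A" "b \<in> A" "av (a - b) \<le> av \<pi>" for a b
    using that A(2) cl_eq[of a b] lt1 by (auto dest: inj_onD)
  ultimately show ?thesis using A(1) unfolding transversal_def by (intro exI[of _ A]) auto
qed

text \<open>Digit expansion: a representative at the next level is \<open>a + \<pi> ^ n * b\<close>
  with \<open>a\<close> a representative at level \<open>n\<close> and \<open>b\<close> a residue
  digit.\<close>

lemma ex_transversal: "\<exists>A. transversal A (av \<pi> ^ n) \<and> card A = residue_card ^ n"
proof (induction n)
  case 0
  show ?case by (rule exI[of _ "{0}"]) (auto simp: transversal_def)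
next
  case (Suc n)
  then obtain A where A: "transversal A (av \<pi> ^ n)" "card A = residue_card ^ n" by blast
  obtain B where B: "transversal B (av \<pi>)" "card B = residue_card"
    using residue_transversal by blast
  have pi0: "\<pi> \<noteq> 0" using av_pi_pos by auto
  let ?f = "\<lambda>(a, b). a + \<pi> ^ n * b"
  have le1: "av \<pi> ^ n \<le> 1" using av_pi_pos av_pi_less_1 by (simp add: power_le_one)
  have inj: "p = q" if p: "p \<in> A \<times> B" and q: "q \<in> A \<times> B"
    and le: "av (?f p - ?f q) \<le> av \<pi> ^ Suc n" for p q
  proof -
    obtain a b c d where pq: "p = (a, b)" "q = (c, d)" by fastforce
    have ab: "a \<in> A" "b \<in> B" "c \<in> A" "d \<in> B" using p q pq by auto
    have bd: "av (\<pi> ^ n * (b - d)) \<le> av \<pi> ^ n"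
      using av_diff_leI[of b 1 d] ab B mult_left_le[of "av (b - d)" "av \<pi> ^ n"]
      by (auto simp: av_mult av_power transversal_def)
    have le': "av \<pi> ^ Suc n \<le> av \<pi> ^ n" using av_pi_pos av_pi_less_1 by (simp add: mult_le_cancel_right2)
    have "av ((?f p - ?f q) - \<pi> ^ n * (b - d)) \<le> av \<pi> ^ n"
      by (rule av_diff_leI) (use le le' bd in linarith)+
    moreover have "(?f p - ?f q) - \<pi> ^ n * (b - d) = a - c"
      by (simp add: pq algebra_simps)
    ultimately have "a = c" using A ab unfolding transversal_def by metis
    then have "av (\<pi> ^ n * (b - d)) \<le> av \<pi> ^ Suc n"
      using le by (simp add: pq algebra_simps)
    then have "av (b - d) \<le> av \<pi>" using av_pi_pos by (simp add: av_mult av_power mult.commute)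
    then have "b = d" using B ab unfolding transversal_def by metis
    then show ?thesis using \<open>a = c\<close> pq by simp
  qed
  have "inj_on ?f (A \<times> B)"
    by (rule inj_onI) (rule inj, auto simp: av_pi_pos less_imp_le)
  then have "card (?f ` (A \<times> B)) = residue_card ^ Suc n"
    using A B by (simp add: card_image card_cartesian_product)
  moreover have "\<exists>a\<in>?f ` (A \<times> B). av (x - a) \<le> av \<pi> ^ Suc n" if x: "av x \<le> 1" for x
  proof -
    obtain a where a: "a \<in> A" "av (x - a) \<le> av \<pi> ^ n" using A x unfolding transversal_def by blast
    then have "av ((x - a) / \<pi> ^ n) \<le> 1" using av_pi_pos by (simp add: av_divide av_power)
    then obtain b where b: "b \<in> B" "av ((x - a) / \<pi> ^ n - b) \<le> av \<pi>"
      using B unfolding transversal_def by blast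
    have "x - (a + \<pi> ^ n * b) = \<pi> ^ n * ((x - a) / \<pi> ^ n - b)" using pi0 by (simp add: field_simps)
    then have "av (x - (a + \<pi> ^ n * b)) \<le> av \<pi> ^ Suc n"
      using b av_pi_pos by (simp add: av_mult av_power mult.commute)
    then show ?thesis using a b by force
  qed
  moreover have "av (?f p) \<le> 1" if "p \<in> A \<times> B" for p
    using that A B le1 unfolding transversal_def
    by (auto intro!: av_add_leI simp: av_mult av_power mult_le_one)
  moreover have "x = y" if xy: "x \<in> ?f ` (A \<times> B)" "y \<in> ?f ` (A \<times> B)" "av (x - y) \<le> av \<pi> ^ Suc n" for x y
  proof -
    obtain p q where pq: "p \<in> A \<times> B" "q \<in> A \<times> B" "x = ?f p" "y = ?f q" using xy(1,2) by blast
    then have "p = q" using inj xy(3) by blast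
    then show ?thesis using pq by simp
  qed
  moreover have "finite (?f ` (A \<times> B))" using A B unfolding transversal_def by simp
  ultimately show ?case unfolding transversal_def
    by (intro exI[of _ "?f ` (A \<times> B)"]) blast
qed

text \<open>Packing bound: after rescaling by \<open>z\<close>, each point goes to the
  representative of its ball, and separation makes this map injective. All neighbour counts in the
  orthogonality arguments come from here.\<close>

lemma card_separated_le:
  assumes "z \<noteq> 0" and "\<And>x. x \<in> X \<Longrightarrow> av (x - c) \<le> av z"
    and "\<And>x y. x \<in> X \<Longrightarrow> y \<in> X \<Longrightarrow> av (x - y) \<le> av z * av \<pi> ^ n \<Longrightarrow> x = y"
  shows "finite X" "card X \<le> residue_card ^ n"
proof -
  obtain A where A: "transversal A (av \<pi> ^ n)" "card A = residue_card ^ n"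
    using ex_transversal by blast
  have "\<exists>a. \<forall>x\<in>X. a x \<in> A \<and> av ((x - c) / z - a x) \<le> av \<pi> ^ n"
  proof (rule bchoice, rule ballI)
    fix x assume "x \<in> X"
    then have "av ((x - c) / z) \<le> 1" using assms by (simp add: av_divide av_pos_iff)
    then show "\<exists>a. a \<in> A \<and> av ((x - c) / z - a) \<le> av \<pi> ^ n" using A unfolding transversal_def by blast
  qed
  then obtain a where a: "\<And>x. x \<in> X \<Longrightarrow> a x \<in> A" "\<And>x. x \<in> X \<Longrightarrow> av ((x - c) / z - a x) \<le> av \<pi> ^ n"
    by blast
  have inj: "inj_on a X"
  proof (rule inj_onI)
    fix x y assume xy: "x \<in> X" "y \<in> X" "a x = a y"
    have "av ((x - c) / z - (y - c) / z) \<le> av \<pi> ^ n"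
      using a[OF xy(1)] a[OF xy(2)] xy(3) av_diff_trans av_commute by metis
    moreover have "(x - c) / z - (y - c) / z = (x - y) / z" by (simp add: diff_divide_distrib)
    ultimately have "av (x - y) \<le> av z * av \<pi> ^ n"
      using assms(1) by (simp add: av_divide av_pos_iff field_simps)
    then show "x = y" using assms(3) xy by blast
  qed
  have img: "a ` X \<subseteq> A" "finite A" using a A unfolding transversal_def by auto
  show "finite X" using inj img finite_subset finite_imageD by blast
  show "card X \<le> residue_card ^ n" using card_inj_on_le[OF inj img] A by simp
qed

section \<open>The scale \<open>P\<close>\<close>

abbreviation P :: real where "P \<equiv> bfp av \<pi>"

definition varpi :: 'a where "varpi = \<pi> ^ eta av \<pi>"

lemma av_2_le_1: "av 2 \<le> 1"
  using av_add_le[of 1 1] by simp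

lemma eta_pos: "0 < eta av \<pi>" and P_ge_inverse_av_2: "1 / av 2 \<le> P"
proof -
  have "1 < 1 / av \<pi>" using av_pi_pos av_pi_less_1 by simp
  then obtain n where n: "1 / av 2 < (1 / av \<pi>) ^ n" using real_arch_pow by blast
  also have "(1 / av \<pi>) ^ n \<le> (1 / av \<pi>) ^ Suc n"
    using \<open>1 < 1 / av \<pi>\<close> by (intro power_increasing) auto
  finally have "\<exists>n. 0 < n \<and> 1 / av 2 \<le> (1 / av \<pi>) ^ n" by (intro exI[of _ "Suc n"]) auto
  from LeastI_ex[OF this] show "0 < eta av \<pi>" "1 / av 2 \<le> P"
    unfolding eta_def bfp_def by auto
qed

lemma P_eq: "P = real residue_card ^ eta av \<pi>"
proof -
  have "1 / av \<pi> = real residue_card" 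
    by (metis av_pi_residue_card(1) av_pi_pos less_irrefl nonzero_mult_div_cancel_left)
  then show ?thesis by (simp add: bfp_def)
qed

lemma av_varpi: "av varpi = 1 / P"
  by (simp add: varpi_def bfp_def av_power power_divide)

lemma P_ge_2: "2 \<le> P"
proof -
  have "1 < real residue_card"
    using av_pi_residue_card av_pi_less_1 av_pi_pos
    by (metis mult.right_neutral mult_less_cancel_left_pos)
  then have "2 \<le> real residue_card" by simp
  also have "\<dots> \<le> real residue_card ^ eta av \<pi>"
    using eta_pos \<open>1 < real residue_card\<close> by (metis less_imp_le self_le_power)
  finally show ?thesis using P_eq by simp
qed

lemma P_pos [simp]: "0 < P" and P_nonneg [simp]: "0 \<le> P" and P_nonzero [simp]: "P \<noteq> 0"
  and P_ge_1: "1 \<le> P"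
  using P_ge_2 by auto

lemma varpi_nonzero [simp]: "varpi \<noteq> 0"
  using av_varpi by (metis P_nonzero av_0 divide_eq_0_iff zero_neq_one)

text \<open>This is what the choice of \<open>eta\<close> buys: division by 2 costs at most one step
  of the scale \<open>P\<close>.\<close>

lemma av_2_ge: "1 / P \<le> av 2"
  using P_ge_inverse_av_2 two_nonzero by (simp add: field_simps av_pos_iff)

lemma av_varpi_power: "av (varpi ^ n) = 1 / P ^ n"
  by (simp add: av_power av_varpi power_divide)

lemma ex_transversal_P: "\<exists>A. transversal A (1 / P ^ k)"
  using ex_transversal[of "eta av \<pi> * k"] av_varpi_power[of k]
  by (metis varpi_def av_power power_mult)

lemma card_transversal_near_le:
  assumes "transversal A (1 / P ^ k)" "B \<subseteq> A" "\<And>b. b \<in> B \<Longrightarrow> av (b - a) \<le> P ^ m / P ^ k"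
  shows "real (card B) \<le> P ^ m"
proof -
  have sep: "\<And>x y. x \<in> A \<Longrightarrow> y \<in> A \<Longrightarrow> av (x - y) \<le> 1 / P ^ k \<Longrightarrow> x = y"
    using assms(1) unfolding transversal_def by blast
  have av: "av (varpi ^ k / varpi ^ m) = P ^ m / P ^ k" by (simp add: av_divide av_varpi_power)
  have "av (varpi ^ k / varpi ^ m) * av \<pi> ^ (eta av \<pi> * m) = 1 / P ^ k"
  proof -
    have "av \<pi> ^ (eta av \<pi> * m) = 1 / P ^ m"
      by (metis varpi_def av_power av_varpi_power power_mult)
    then show ?thesis unfolding av by simp
  qed
  then have "card B \<le> residue_card ^ (eta av \<pi> * m)"
    using assms(2,3) by (intro card_separated_le(2)[of "varpi ^ k / varpi ^ m" _ a])
      (simp_all add: av, blast intro: sep)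
  then have "real (card B) \<le> real (residue_card ^ (eta av \<pi> * m))" by linarith
  also have "\<dots> = P ^ m" by (simp add: P_eq power_mult)
  finally show ?thesis .
qed

lemma pi_nonzero [simp]: "\<pi> \<noteq> 0"
  using av_pi_pos by auto

lemma av_not_neg [simp]: "\<not> av x < 0"
  by (simp add: not_less)

end

subsection \<open>Haar measure and locally constant functions\<close>

locale haar_local_field = local_field av \<pi>
  for av :: "'a::field \<Rightarrow> real" and \<pi> :: 'a +
  fixes e :: "'a \<Rightarrow> complex" and mu :: "('a \<times> 'a) measure"
  assumes char: "additive_char av \<pi> e" and haar: "haar2 av mu"
begin

lemma e_add: "e (x + y) = e x * e y" and cmod_e [simp]: "cmod (e x) = 1"
  and e_integral: "av x \<le> 1 \<Longrightarrow> e x = 1" and e_nontrivial: "\<exists>x. av x \<le> 1 / av \<pi> \<and> e x \<noteq> 1"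
  using char unfolding additive_char_def by blast+

lemma e_0 [simp]: "e 0 = 1"
  by (simp add: e_integral)

lemma e_nonzero [simp]: "e x \<noteq> 0"
  using cmod_e[of x] by (metis norm_zero zero_neq_one)

lemma e_minus: "e (- x) = cnj (e x)"
proof -
  have "e x * e (- x) = 1" using e_add[of x "- x"] by simp
  moreover have "e x * cnj (e x) = 1" by (simp add: complex_norm_square[symmetric])
  ultimately show ?thesis using e_nonzero[of x] by (metis mult_cancel_left)
qed

lemma e_nontrivial_scaled:
  assumes "1 < av y * av z"
  obtains t where "av t \<le> av z" "e (t * y) \<noteq> 1"
proof -
  have nz: "y \<noteq> 0" "z \<noteq> 0" using assms by auto
  obtain x where x: "av x \<le> 1 / av \<pi>" "e x \<noteq> 1" using e_nontrivial by blast
  have "av (inverse z) < av y" 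
    unfolding av_inverse using assms nz by (simp add: field_simps av_pos_iff)
  then have "av (inverse z) \<le> av y * av \<pi>" using nz by (intro av_gap) auto
  then have "1 \<le> av y * av \<pi> * av z" unfolding av_inverse using nz by (simp add: field_simps av_pos_iff)
  then have "1 / av \<pi> \<le> av z * av y" using av_pi_pos by (simp add: field_simps)
  then have "av x \<le> av z * av y" using x by linarith
  then have "av (x / y) \<le> av z" using nz by (simp add: av_divide av_pos_iff divide_le_eq)
  then show ?thesis using that[of "x / y"] x nz by simp
qed

abbreviation nm :: "'a \<times> 'a \<Rightarrow> real" where "nm \<equiv> nrm2 av"

lemma nm_le_iff: "nm x \<le> r \<longleftrightarrow> av (fst x) \<le> r \<and> av (snd x) \<le> r"
  by (simp add: nrm2_def)

lemma nm_nonneg [simp]: "0 \<le> nm x" and nm_zero [simp]: "nm 0 = 0"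
  by (simp_all add: nrm2_def le_max_iff_disj)

lemma nm_minus [simp]: "nm (- x) = nm x"
  by (simp add: nrm2_def)

lemma nm_add_leI: "nm x \<le> r \<Longrightarrow> nm y \<le> r \<Longrightarrow> nm (x + y) \<le> r"
  by (simp add: nm_le_iff av_add_leI)

lemma nm_diff_leI: "nm x \<le> r \<Longrightarrow> nm y \<le> r \<Longrightarrow> nm (x - y) \<le> r"
  by (simp add: nm_le_iff av_diff_leI)

lemma nm_diff_commute: "nm (x - y) = nm (y - x)"
  using nm_minus[of "x - y"] by simp

lemma mem_ball2_iff: "z \<in> ball2 av a r \<longleftrightarrow> nm (z - a) \<le> r"
  by (simp add: ball2_def nrm2_def)

lemma transl2_eq: "transl2 a A = (+) a ` A"
  by (auto simp: transl2_def image_def prod_eq_iff)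

lemma mem_transl2_iff: "x \<in> transl2 a A \<longleftrightarrow> x - a \<in> A"
proof
  assume "x - a \<in> A"
  then have "a + (x - a) \<in> (+) a ` A" by (rule imageI)
  then show "x \<in> transl2 a A" by (simp add: transl2_eq)
qed (auto simp: transl2_eq)

lemma space_mu [simp]: "space mu = UNIV"
  and sets_mu: "sets mu = sigma_sets UNIV {ball2 av a r | a r. 0 < r}"
  and emeasure_transl2: "A \<in> sets mu \<Longrightarrow> emeasure mu (transl2 a A) = emeasure mu A"
  and emeasure_unit_ball: "emeasure mu (ball2 av 0 1) = 1"
  using haar unfolding haar2_def zero_prod_def by blast+

lemma ball2_in_sets [measurable]: "0 < r \<Longrightarrow> ball2 av a r \<in> sets mu"
  unfolding sets_mu by (rule sigma_sets.Basic) blast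

lemma measurable_shift [measurable]: "(\<lambda>x. x + t) \<in> measurable mu mu"
proof (rule measurable_sigma_sets[OF sets_mu])
  fix B assume "B \<in> {ball2 av a r |a r. 0 < r}"
  then obtain a r where B: "B = ball2 av a r" "0 < r" by blast
  then have "(\<lambda>x. x + t) -` B \<inter> space mu = ball2 av (a - t) r"
    by (intro set_eqI) (simp add: mem_ball2_iff diff_diff_eq2)
  then show "(\<lambda>x. x + t) -` B \<inter> space mu \<in> sets mu" using B by (simp add: ball2_in_sets)
qed auto

lemma distr_shift: "distr mu mu (\<lambda>x. x + t) = mu"
proof (rule measure_eqI)
  fix A assume "A \<in> sets (distr mu mu (\<lambda>x. x + t))"
  then have A: "A \<in> sets mu" by simp
  have "(\<lambda>x. x + t) -` A \<inter> space mu = transl2 (- t) A"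
    by (simp add: mem_transl2_iff set_eq_iff)
  then show "emeasure (distr mu mu (\<lambda>x. x + t)) A = emeasure mu A"
    using A by (simp add: emeasure_distr emeasure_transl2)
qed simp

lemma integral_shift:
  fixes g :: "'a \<times> 'a \<Rightarrow> 'b::{banach, second_countable_topology}"
  assumes "g \<in> borel_measurable mu"
  shows "(\<integral>x. g (x + t) \<partial>mu) = (\<integral>x. g x \<partial>mu)"
  using integral_distr[OF measurable_shift assms, of t] by (simp add: distr_shift)

text \<open>Products of scaled one-dimensional transversals cut a ball into equal disjoint smaller
  balls. This computes volumes, expands locally constant functions, and shows later that there are
  finitely many good tiles.\<close>

lemma ball2_cover:
  assumes "z \<noteq> 0"
  obtains X where "finite X" "card X = residue_card ^ (2 * n)"
    "\<And>x. nm x \<le> av z \<longleftrightarrow> (\<exists>a\<in>X. nm (x - a) \<le> av z * av \<pi> ^ n)"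
    "\<And>x a b. a \<in> X \<Longrightarrow> b \<in> X \<Longrightarrow> nm (x - a) \<le> av z * av \<pi> ^ n \<Longrightarrow> nm (x - b) \<le> av z * av \<pi> ^ n \<Longrightarrow> a = b"
proof -
  obtain A where A: "transversal A (av \<pi> ^ n)" and cA: "card A = residue_card ^ n"
    using ex_transversal by blast
  have fA: "finite A" and A1: "\<And>a. a \<in> A \<Longrightarrow> av a \<le> 1"
    and Aex: "\<And>x. av x \<le> 1 \<Longrightarrow> \<exists>a\<in>A. av (x - a) \<le> av \<pi> ^ n"
    and Aun: "\<And>a b. a \<in> A \<Longrightarrow> b \<in> A \<Longrightarrow> av (a - b) \<le> av \<pi> ^ n \<Longrightarrow> a = b"
    using A unfolding transversal_def by blast+
  let ?r = "av z * av \<pi> ^ n"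
  let ?s = "\<lambda>p. (z * fst p, z * snd p)"
  define X where "X = ?s ` (A \<times> A)"
  have le: "?r \<le> av z" using assms av_pi_pos av_pi_less_1
    by (simp add: mult_left_le power_le_one)
  have scale: "av (z * x - z * y) \<le> ?r \<longleftrightarrow> av (x - y) \<le> av \<pi> ^ n" for x y
    using assms av_mult[of z "x - y"] by (simp add: av_pos_iff right_diff_distrib)
  have inj: "inj_on ?s (A \<times> A)" using assms by (auto intro!: inj_onI)
  have "finite X" "card X = residue_card ^ (2 * n)"
    unfolding X_def using fA cA card_image[OF inj]
    by (simp_all add: card_cartesian_product power_mult power2_eq_square power_mult_distrib mult.commute)
  moreover have "nm x \<le> av z \<longleftrightarrow> (\<exists>a\<in>X. nm (x - a) \<le> ?r)" for x
  proof
    assume x: "nm x \<le> av z"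
    have "\<exists>a\<in>A. av (y - z * a) \<le> ?r" if y: "av y \<le> av z" for y
    proof -
      have "av (y / z) \<le> 1" using y assms by (simp add: av_divide av_pos_iff)
      then obtain a where "a \<in> A" "av (y / z - a) \<le> av \<pi> ^ n" using Aex by blast
      then show ?thesis using scale[of "y / z" a] assms by auto
    qed
    then obtain a b where "a \<in> A" "av (fst x - z * a) \<le> ?r" "b \<in> A" "av (snd x - z * b) \<le> ?r"
      using x by (meson nm_le_iff)
    then show "\<exists>a\<in>X. nm (x - a) \<le> ?r"
      unfolding X_def by (auto simp: nm_le_iff intro!: bexI[of _ "(a, b)"])
  next
    assume "\<exists>a\<in>X. nm (x - a) \<le> ?r"
    then obtain a where a: "a \<in> X" "nm (x - a) \<le> ?r" by blast
    have "nm a \<le> av z" using a(1) A1 unfolding X_def by (auto simp: nm_le_iff av_mult mult_left_le)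
    then show "nm x \<le> av z" using nm_add_leI[of "x - a" "av z" a] a le by simp
  qed
  moreover have "a = b" if ab: "a \<in> X" "b \<in> X" "nm (x - a) \<le> ?r" "nm (x - b) \<le> ?r" for x a b
  proof -
    have "nm (a - b) \<le> ?r" using nm_diff_leI[OF ab(4,3)] by simp
    moreover obtain p q where pq: "p \<in> A \<times> A" "q \<in> A \<times> A" "a = ?s p" "b = ?s q"
      using ab(1,2) unfolding X_def by blast
    ultimately have "av (fst p - fst q) \<le> av \<pi> ^ n" "av (snd p - snd q) \<le> av \<pi> ^ n"
      by (simp_all add: nm_le_iff scale)
    then have "fst p = fst q" "snd p = snd q" using pq(1,2) by (auto intro!: Aun simp: mem_Times_iff)
    then have "p = q" by (simp add: prod_eq_iff)
    then show ?thesis using pq by simp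
  qed
  ultimately show ?thesis by (rule that)
qed

lemma emeasure_ball2_shift: "0 < r \<Longrightarrow> emeasure mu (ball2 av a r) = emeasure mu (ball2 av 0 r)"
proof -
  assume r: "0 < r"
  have "ball2 av a r = transl2 a (ball2 av 0 r)"
    by (simp add: mem_transl2_iff set_eq_iff mem_ball2_iff)
  then show ?thesis using r emeasure_transl2 ball2_in_sets by simp
qed

lemma emeasure_ball2_scale:
  assumes "z \<noteq> 0"
  shows "emeasure mu (ball2 av 0 (av z)) =
    of_nat (residue_card ^ (2 * n)) * emeasure mu (ball2 av 0 (av z * av \<pi> ^ n))"
proof -
  obtain X where X: "finite X" "card X = residue_card ^ (2 * n)"
    "\<And>x. nm x \<le> av z \<longleftrightarrow> (\<exists>a\<in>X. nm (x - a) \<le> av z * av \<pi> ^ n)"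
    "\<And>x a b. a \<in> X \<Longrightarrow> b \<in> X \<Longrightarrow> nm (x - a) \<le> av z * av \<pi> ^ n \<Longrightarrow> nm (x - b) \<le> av z * av \<pi> ^ n \<Longrightarrow> a = b"
    using ball2_cover[OF assms, of n] by metis
  have r: "0 < av z * av \<pi> ^ n" using assms av_pi_pos by (simp add: av_pos_iff)
  have "ball2 av 0 (av z) = (\<Union>a\<in>X. ball2 av a (av z * av \<pi> ^ n))"
    by (intro set_eqI) (simp add: mem_ball2_iff X(3))
  moreover have "disjoint_family_on (\<lambda>a. ball2 av a (av z * av \<pi> ^ n)) X"
    using X(4) unfolding disjoint_family_on_def by (auto simp: mem_ball2_iff)
  ultimately have "emeasure mu (ball2 av 0 (av z)) = (\<Sum>a\<in>X. emeasure mu (ball2 av a (av z * av \<pi> ^ n)))"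
    using sum_emeasure[of "\<lambda>a. ball2 av a (av z * av \<pi> ^ n)" X mu] X(1) ball2_in_sets r
    by (simp add: image_subset_iff)
  also have "\<dots> = (\<Sum>a\<in>X. emeasure mu (ball2 av 0 (av z * av \<pi> ^ n)))"
    by (intro sum.cong refl emeasure_ball2_shift r)
  finally show ?thesis using X(2) by simp
qed

lemma emeasure_ball2_power:
  "emeasure mu (ball2 av 0 (av (inverse (\<pi> ^ n)))) = of_nat (residue_card ^ (2 * n))"
  "of_nat (residue_card ^ (2 * n)) * emeasure mu (ball2 av 0 (av (\<pi> ^ n))) = 1"
proof -
  have pi0: "\<pi> \<noteq> 0" using av_pi_pos by auto
  have "av (inverse (\<pi> ^ n)) * av \<pi> ^ n = 1" using pi0 by (simp add: av_inverse av_power)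
  then show "emeasure mu (ball2 av 0 (av (inverse (\<pi> ^ n)))) = of_nat (residue_card ^ (2 * n))"
    using emeasure_ball2_scale[of "inverse (\<pi> ^ n)" n] pi0 by (simp add: emeasure_unit_ball)
  show "of_nat (residue_card ^ (2 * n)) * emeasure mu (ball2 av 0 (av (\<pi> ^ n))) = 1"
    using emeasure_ball2_scale[of 1 n] by (simp add: emeasure_unit_ball av_power)
qed

lemma emeasure_ball2_finite: assumes "0 < r" shows "emeasure mu (ball2 av a r) < \<infinity>"
proof -
  obtain n where n: "r * av \<pi> ^ n \<le> 1"
  proof -
    have "1 < 1 / av \<pi>" using av_pi_pos av_pi_less_1 by simp
    then obtain n where "r < (1 / av \<pi>) ^ n" using real_arch_pow by blast
    then have "r * av \<pi> ^ n \<le> 1" using av_pi_pos by (simp add: power_divide field_simps)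
    then show ?thesis using that by blast
  qed
  have "r \<le> av (inverse (\<pi> ^ n))"
    unfolding av_inverse av_power using n av_pi_pos by (simp add: field_simps)
  then have "ball2 av 0 r \<subseteq> ball2 av 0 (av (inverse (\<pi> ^ n)))" by (auto simp: mem_ball2_iff)
  then have "emeasure mu (ball2 av 0 r) \<le> of_nat (residue_card ^ (2 * n))"
    using emeasure_ball2_power(1)[of n] emeasure_mono[of _ _ mu] av_pi_pos
    by (metis ball2_in_sets av_pos_iff inverse_nonzero_iff_nonzero less_irrefl power_not_zero av_0)
  also have "\<dots> < \<infinity>" unfolding infinity_ennreal_def by (rule of_nat_less_top)
  finally show ?thesis by (subst emeasure_ball2_shift[OF assms])
qed

text \<open>Self-duality of the measure: a ball and its dual ball have reciprocal volumes. This is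
  why Fourier inversion holds without a constant.\<close>

lemma measure_ball2_inverse:
  assumes "z \<noteq> 0"
  shows "measure mu (ball2 av 0 (av z)) * measure mu (ball2 av 0 (1 / av z)) = 1"
proof -
  have pi0: "\<pi> \<noteq> 0" using av_pi_pos by auto
  obtain w n where w: "w \<noteq> 0" "\<And>x. av x \<le> av z \<longleftrightarrow> av x \<le> av w" "w = \<pi> ^ n \<or> w = inverse (\<pi> ^ n)"
    using ex_av_radius[of "av z"] assms av_pos_iff by metis
  have "av z = av w" using w(2) by (metis order_antisym order_refl)
  have a: "measure mu (ball2 av 0 (av (inverse (\<pi> ^ n)))) = real (residue_card ^ (2 * n))"
    unfolding measure_def emeasure_ball2_power(1)
    by (metis ennreal_of_nat_eq_real_of_nat enn2real_ennreal of_nat_0_le_iff)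
  have "enn2real (of_nat (residue_card ^ (2 * n)) * emeasure mu (ball2 av 0 (av (\<pi> ^ n)))) = 1"
    using emeasure_ball2_power(2)[of n] by simp
  then have b: "real (residue_card ^ (2 * n)) * measure mu (ball2 av 0 (av (\<pi> ^ n))) = 1"
    unfolding measure_def enn2real_mult
    by (metis ennreal_of_nat_eq_real_of_nat enn2real_ennreal of_nat_0_le_iff)
  have "1 / av (\<pi> ^ n) = av (inverse (\<pi> ^ n))" "1 / av (inverse (\<pi> ^ n)) = av (\<pi> ^ n)"
    unfolding av_inverse by (simp_all add: inverse_eq_divide)
  then show ?thesis using w(3) a b unfolding \<open>av z = av w\<close> by (metis mult.commute)
qed

text \<open>One radius \<delta> must work at all points. The value type is arbitrary, so that
  predicates used as cutoffs are covered too; for complex values, \<open>nice\<close> describes the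
  Schwartz-Bruhat functions.\<close>

definition lconst :: "('a \<times> 'a \<Rightarrow> 'b) \<Rightarrow> bool" where
  "lconst g \<longleftrightarrow> (\<exists>\<delta>>0. \<forall>x t. nm t \<le> \<delta> \<longrightarrow> g (x + t) = g x)"

definition bsupp :: "('a \<times> 'a \<Rightarrow> 'b::zero) \<Rightarrow> bool" where
  "bsupp g \<longleftrightarrow> (\<exists>A. \<forall>x. g x \<noteq> 0 \<longrightarrow> nm x \<le> A)"

definition nice :: "('a \<times> 'a \<Rightarrow> 'b::zero) \<Rightarrow> bool" where
  "nice g \<longleftrightarrow> lconst g \<and> bsupp g"

lemma lconst_const [simp]: "lconst (\<lambda>x. c)"
  unfolding lconst_def by (auto intro!: exI[of _ 1])

lemma lconst_comp: "lconst f \<Longrightarrow> lconst (\<lambda>x. \<phi> (f x))"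
  unfolding lconst_def by metis

lemma lconst_comp2: assumes "lconst f" "lconst g" shows "lconst (\<lambda>x. \<phi> (f x) (g x))"
proof -
  obtain d d' where d: "0 < d" "\<forall>x t. nm t \<le> d \<longrightarrow> f (x + t) = f x"
    "0 < d'" "\<forall>x t. nm t \<le> d' \<longrightarrow> g (x + t) = g x"
    using assms unfolding lconst_def by blast
  then show ?thesis unfolding lconst_def by (intro exI[of _ "min d d'"]) auto
qed

lemma lconst_ball: 
  assumes "finite I" "\<And>i. i \<in> I \<Longrightarrow> lconst (f i)"
  shows "lconst (\<lambda>x. \<forall>i\<in>I. f i x)"
  using assms by (induction I rule: finite_induct) (auto intro: lconst_comp2[of _ _ "(\<and>)"])

lemma lconst_shift: "lconst f \<Longrightarrow> lconst (\<lambda>x. f (x + t))"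
  unfolding lconst_def by (metis add.assoc add.commute)

lemma bsupp_mono: "bsupp f \<Longrightarrow> (\<And>x. g x \<noteq> 0 \<Longrightarrow> f x \<noteq> 0) \<Longrightarrow> bsupp g"
  unfolding bsupp_def by metis

lemma bsupp_shift: assumes "bsupp f" shows "bsupp (\<lambda>x. f (x + t))"
proof -
  obtain A where A: "\<And>x. f x \<noteq> 0 \<Longrightarrow> nm x \<le> A" using assms unfolding bsupp_def by blast
  have "nm x \<le> max A (nm t)" if "f (x + t) \<noteq> 0" for x
    using nm_diff_leI[of "x + t" "max A (nm t)" t] A[OF that] by simp
  then show ?thesis unfolding bsupp_def by blast
qed

lemma bsupp_add: 
  fixes f g :: "'a \<times> 'a \<Rightarrow> 'b::comm_monoid_add"
  assumes "bsupp f" "bsupp g" shows "bsupp (\<lambda>x. f x + g x)"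
proof -
  obtain A B where AB: "\<And>x. f x \<noteq> 0 \<Longrightarrow> nm x \<le> A" "\<And>x. g x \<noteq> 0 \<Longrightarrow> nm x \<le> B"
    using assms unfolding bsupp_def by blast
  have "nm x \<le> max A B" if "f x + g x \<noteq> 0" for x
    using that AB[of x] by (cases "f x = 0") auto
  then show ?thesis unfolding bsupp_def by blast
qed

lemma bsupp_zero [simp]: "bsupp (\<lambda>x. 0)"
  unfolding bsupp_def by simp

lemma nice_zero [simp]: "nice (\<lambda>x. 0)"
  unfolding nice_def by simp

lemma nice_add: 
  fixes f g :: "'a \<times> 'a \<Rightarrow> 'b::comm_monoid_add"
  shows "nice f \<Longrightarrow> nice g \<Longrightarrow> nice (\<lambda>x. f x + g x)"
  unfolding nice_def by (simp add: bsupp_add lconst_comp2)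

lemma nice_sum:
  fixes f :: "'i \<Rightarrow> 'a \<times> 'a \<Rightarrow> 'b::comm_monoid_add"
  shows "(\<And>i. i \<in> I \<Longrightarrow> nice (f i)) \<Longrightarrow> nice (\<lambda>x. \<Sum>i\<in>I. f i x)"
  by (induction I rule: infinite_finite_induct) (auto intro: nice_add)

lemma nice_shift: "nice f \<Longrightarrow> nice (\<lambda>x. f (x + t))"
  unfolding nice_def by (simp add: bsupp_shift lconst_shift)

lemma nice_comp: "nice f \<Longrightarrow> \<phi> 0 = 0 \<Longrightarrow> nice (\<lambda>x. \<phi> (f x))"
  unfolding nice_def by (auto intro: lconst_comp bsupp_mono)

lemma nice_comp2: "nice f \<Longrightarrow> lconst g \<Longrightarrow> (\<And>y. \<phi> 0 y = 0) \<Longrightarrow> nice (\<lambda>x. \<phi> (f x) (g x))"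
  unfolding nice_def by (metis (mono_tags, lifting) lconst_comp2 bsupp_mono)

lemma nice_lconst: "nice f \<Longrightarrow> lconst f"
  by (simp add: nice_def)

lemma nice_mult:
  fixes f g :: "'a \<times> 'a \<Rightarrow> 'b::mult_zero"
  shows "nice f \<Longrightarrow> lconst g \<Longrightarrow> nice (\<lambda>x. f x * g x)"
  by (rule nice_comp2) auto

lemma nice_cmult:
  fixes f :: "'a \<times> 'a \<Rightarrow> 'b::mult_zero"
  shows "nice f \<Longrightarrow> nice (\<lambda>x. c * f x)"
  by (rule nice_comp[where \<phi> = "\<lambda>y. c * y"]) auto

lemma nice_diff:
  fixes f g :: "'a \<times> 'a \<Rightarrow> 'b::ab_group_add"
  shows "nice f \<Longrightarrow> nice g \<Longrightarrow> nice (\<lambda>x. f x - g x)"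
  using nice_add[of f "\<lambda>x. - g x"] nice_comp[of g uminus] by simp

lemma nice_if:
  shows "nice f \<Longrightarrow> lconst Q \<Longrightarrow> nice (\<lambda>x. if Q x then f x else 0)"
  using nice_comp2[of f Q "\<lambda>y q. if q then y else 0"] by simp

lemma nice_power2:
  fixes f :: "'a \<times> 'a \<Rightarrow> 'b::semiring_1"
  shows "nice f \<Longrightarrow> nice (\<lambda>x. (f x)\<^sup>2)"
  by (rule nice_comp) auto

text \<open>A ball containing the support is cut into cells on which \<open>g\<close> is constant.
  Integrability and Fourier inversion are thereby reduced to indicators of balls.\<close>

lemma nice_expand:
  fixes g :: "'a \<times> 'a \<Rightarrow> 'b::real_vector"
  assumes "nice g"
  obtains X z where "finite X" "z \<noteq> 0" "g = (\<lambda>x. \<Sum>a\<in>X. indicator (ball2 av a (av z)) x *\<^sub>R g a)"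
proof -
  obtain d where d: "0 < d" "\<And>x t. nm t \<le> d \<Longrightarrow> g (x + t) = g x"
    using assms unfolding nice_def lconst_def by blast
  obtain A where A: "\<And>x. g x \<noteq> 0 \<Longrightarrow> nm x \<le> A" using assms unfolding nice_def bsupp_def by blast
  have pi0: "\<pi> \<noteq> 0" using av_pi_pos by auto
  have gt1: "1 < 1 / av \<pi>" using av_pi_pos av_pi_less_1 by simp
  obtain m where "A < (1 / av \<pi>) ^ m" using real_arch_pow[OF gt1] by blast
  define z where "z = inverse (\<pi> ^ m)"
  have z: "A \<le> av z" "z \<noteq> 0" using \<open>A < _\<close> pi0
    unfolding z_def av_inverse av_power by (simp_all add: power_divide inverse_eq_divide)
  obtain n where "av z * (1 / d) < (1 / av \<pi>) ^ n" using real_arch_pow[OF gt1] by blast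
  then have r: "av z * av \<pi> ^ n \<le> d" using av_pi_pos d(1) by (simp add: power_divide field_simps)
  obtain X where X: "finite X"
    "\<And>x. nm x \<le> av z \<longleftrightarrow> (\<exists>a\<in>X. nm (x - a) \<le> av z * av \<pi> ^ n)"
    "\<And>x a b. a \<in> X \<Longrightarrow> b \<in> X \<Longrightarrow> nm (x - a) \<le> av z * av \<pi> ^ n \<Longrightarrow> nm (x - b) \<le> av z * av \<pi> ^ n \<Longrightarrow> a = b"
    using ball2_cover[OF z(2), of n] by metis
  let ?w = "z * \<pi> ^ n"
  have w: "av ?w = av z * av \<pi> ^ n" by (simp add: av_mult av_power)
  have "g x = (\<Sum>a\<in>X. indicator (ball2 av a (av ?w)) x *\<^sub>R g a)" for x
  proof (cases "nm x \<le> av z")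
    case True
    then obtain a where a: "a \<in> X" "nm (x - a) \<le> av ?w" using X(2)[of x] unfolding w by blast
    have "(\<Sum>b\<in>X. indicator (ball2 av b (av ?w)) x *\<^sub>R g b) = (\<Sum>b\<in>X. if b = a then g b else 0)"
    proof (rule sum.cong[OF refl])
      fix b assume b: "b \<in> X"
      show "indicator (ball2 av b (av ?w)) x *\<^sub>R g b = (if b = a then g b else 0)"
      proof (cases "b = a")
        case True then show ?thesis using a(2) by (simp add: mem_ball2_iff)
      next
        case False
        then have "\<not> nm (x - b) \<le> av ?w" using X(3)[OF b a(1), of x] a(2) unfolding w by blast
        then show ?thesis using False by (simp add: mem_ball2_iff)
      qed
    qed
    also have "\<dots> = g a" using X(1) a(1) by simp
    also have "\<dots> = g x" using d(2)[of "x - a" a] a(2) r w by simp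
    finally show ?thesis ..
  next
    case False
    then have "g x = 0" using A[of x] z(1) by (cases "g x = 0") auto
    moreover have "\<not> nm (x - b) \<le> av ?w" if "b \<in> X" for b
      using False X(2)[of x] that unfolding w by blast
    ultimately show ?thesis by (simp add: mem_ball2_iff)
  qed
  moreover have "?w \<noteq> 0" using z pi0 by simp
  ultimately show ?thesis by (intro that[OF X(1), of ?w] ext)
qed

lemma nice_integrable:
  fixes g :: "'a \<times> 'a \<Rightarrow> 'b::{banach, second_countable_topology}"
  assumes "nice g" shows "integrable mu g"
proof -
  obtain X z where X: "finite X" "z \<noteq> 0" "g = (\<lambda>x. \<Sum>a\<in>X. indicator (ball2 av a (av z)) x *\<^sub>R g a)"
    using nice_expand[OF assms] by blast
  have "integrable mu (\<lambda>x. \<Sum>a\<in>X. indicator (ball2 av a (av z)) x *\<^sub>R g a)"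
    using X(2) emeasure_ball2_finite[of "av z"] ball2_in_sets[of "av z"]
    by (intro Bochner_Integration.integrable_sum integrable_scaleR_left integrable_real_indicator)
      (auto simp: av_pos_iff)
  then show ?thesis using X(3) by simp
qed

lemma nice_integral_shift:
  fixes g :: "'a \<times> 'a \<Rightarrow> 'b::{banach, second_countable_topology}"
  shows "nice g \<Longrightarrow> (\<integral>x. g (x + t) \<partial>mu) = (\<integral>x. g x \<partial>mu)"
  by (intro integral_shift borel_measurable_integrable nice_integrable)

text \<open>By translation invariance the integral equals \<open>z\<close> times itself. Every
  vanishing of an oscillatory integral below rests on this.\<close>

lemma integral_eq_0_if_twisted:
  fixes g :: "'a \<times> 'a \<Rightarrow> complex"
  assumes "nice g" "\<And>x. g (x + t) = z * g x" "z \<noteq> 1"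
  shows "(\<integral>x. g x \<partial>mu) = 0"
proof -
  have "(\<integral>x. g x \<partial>mu) = z * (\<integral>x. g x \<partial>mu)"
    using nice_integral_shift[OF assms(1), of t] assms(2) by simp
  then show ?thesis using assms(3) by (metis mult_cancel_right1)
qed

lemma nice_superlevel:
  assumes "nice f" "lconst Q" "\<And>x. Q x \<Longrightarrow> f x \<noteq> 0"
  shows "{x. Q x} \<in> sets mu" "emeasure mu {x. Q x} < \<infinity>"
    "measure mu {x. Q x} = (\<integral>x. (if Q x then 1 else 0) \<partial>mu)"
proof -
  have "bsupp f" using assms(1) by (simp add: nice_def)
  then have n: "nice (\<lambda>x. if Q x then 1 else (0::real))"
    unfolding nice_def
    using assms lconst_comp[of Q "\<lambda>q. if q then 1 else (0::real)"]
    by (auto intro!: bsupp_mono[of f "\<lambda>x. if Q x then 1 else (0::real)"] split: if_splits)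
  have i: "(\<lambda>x. if Q x then 1 else (0::real)) = indicator {x. Q x}" by (auto simp: indicator_def)
  have int: "integrable mu (indicator {x. Q x} :: _ \<Rightarrow> real)" using nice_integrable[OF n] i by simp
  then show s: "{x. Q x} \<in> sets mu" "emeasure mu {x. Q x} < \<infinity>"
    by (simp_all add: integrable_indicator_iff)
  then show "measure mu {x. Q x} = (\<integral>x. (if Q x then 1 else 0) \<partial>mu)"
    unfolding i by simp
qed

subsection \<open>Fourier projections\<close>

lemma dot2_add_left: "dot2 (x + t) \<xi> = dot2 x \<xi> + dot2 t \<xi>"
  and dot2_add_right: "dot2 x (\<xi> + \<zeta>) = dot2 x \<xi> + dot2 x \<zeta>"
  and dot2_commute: "dot2 x \<xi> = dot2 \<xi> x"
  and dot2_minus_right: "dot2 x (- \<xi>) = - dot2 x \<xi>"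
  by (simp_all add: dot2_def algebra_simps)

lemma av_dot2_le: "av (dot2 t \<xi>) \<le> nm t * nm \<xi>"
  unfolding dot2_def
  by (rule av_add_leI) (auto simp: av_mult nrm2_def le_max_iff_disj intro!: mult_mono)

lemma e_dot2_eq_1: "nm t * nm \<xi> \<le> 1 \<Longrightarrow> e (dot2 t \<xi>) = 1"
  using av_dot2_le[of t \<xi>] by (intro e_integral) linarith

lemma e_dot2_nontrivial:
  assumes "1 < nm \<xi> * av z"
  obtains t where "nm t \<le> av z" "e (dot2 t \<xi>) \<noteq> 1"
proof (cases "1 < av (fst \<xi>) * av z")
  case True
  then obtain t where "av t \<le> av z" "e (t * fst \<xi>) \<noteq> 1" by (rule e_nontrivial_scaled)
  then show ?thesis using that[of "(t, 0)"] by (simp add: nm_le_iff dot2_def)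
next
  case False
  then have "1 < av (snd \<xi>) * av z" using assms by (auto simp: nrm2_def max_def split: if_splits)
  then obtain t where "av t \<le> av z" "e (t * snd \<xi>) \<noteq> 1" by (rule e_nontrivial_scaled)
  then show ?thesis using that[of "(0, t)"] by (simp add: nm_le_iff dot2_def)
qed

lemma lconst_e_dot2: "lconst (\<lambda>x. e (dot2 x \<xi>))"
proof -
  have "e (dot2 (x + t) \<xi>) = e (dot2 x \<xi>)" if t: "nm t \<le> 1 / max 1 (nm \<xi>)" for x t
  proof -
    have "nm t * nm \<xi> \<le> nm t * max 1 (nm \<xi>)" by (intro mult_left_mono) auto
    also have "\<dots> \<le> 1" using t by (simp add: pos_le_divide_eq)
    finally show ?thesis by (simp add: dot2_add_left e_add e_dot2_eq_1)
  qed
  then show ?thesis unfolding lconst_def by (intro exI[of _ "1 / max 1 (nm \<xi>)"]) auto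
qed

lemma nice_fourier_integrand: "nice f \<Longrightarrow> nice (\<lambda>x. e (dot2 x \<xi>) * f x)"
  using nice_mult[of f "\<lambda>x. e (dot2 x \<xi>)"] lconst_e_dot2 by (simp add: mult.commute)

text \<open>Support and constancy are exchanged: bounded support of \<open>f\<close> makes the
  transform constant at the reciprocal scale, and constancy of \<open>f\<close> at scale
  \<open>d\<close> kills the transform beyond \<open>1 / d\<close>, since some small shift
  multiplies the integrand by a nontrivial constant.\<close>

lemma nice_fourier: assumes "nice f" shows "nice (fourier mu e f)"
proof -
  obtain d where d: "0 < d" "\<And>x t. nm t \<le> d \<Longrightarrow> f (x + t) = f x"
    using assms unfolding nice_def lconst_def by blast
  obtain A where A: "\<And>x. f x \<noteq> 0 \<Longrightarrow> nm x \<le> A" using assms unfolding nice_def bsupp_def by blast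
  have "fourier mu e f (\<xi> + h) = fourier mu e f \<xi>" if h: "nm h \<le> 1 / max 1 A" for \<xi> h
  proof -
    have "e (dot2 x (\<xi> + h)) * f x = e (dot2 x \<xi>) * f x" for x
    proof (cases "f x = 0")
      case False
      have "nm x * nm h \<le> max 1 A * nm h" using A[OF False] by (intro mult_right_mono) auto
      also have "\<dots> \<le> 1" using h by (simp add: pos_le_divide_eq mult.commute)
      finally show ?thesis by (simp add: dot2_add_right e_add e_dot2_eq_1)
    qed simp
    then show ?thesis unfolding fourier_def by presburger
  qed
  then have 1: "lconst (fourier mu e f)"
    unfolding lconst_def by (intro exI[of _ "1 / max 1 A"]) auto
  obtain z where z: "z \<noteq> 0" "\<And>x. av x \<le> d \<longleftrightarrow> av x \<le> av z" using ex_av_radius[OF d(1)] by metis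
  have "nm \<xi> \<le> 1 / av z" if nz: "fourier mu e f \<xi> \<noteq> 0" for \<xi>
  proof (rule ccontr)
    assume "\<not> nm \<xi> \<le> 1 / av z"
    then have "1 < nm \<xi> * av z" using z(1) by (simp add: field_simps av_pos_iff)
    then obtain t where t: "nm t \<le> av z" "e (dot2 t \<xi>) \<noteq> 1" by (rule e_dot2_nontrivial)
    have "nm t \<le> d" using t(1) z(2) unfolding nm_le_iff by blast
    then have "e (dot2 (x + t) \<xi>) * f (x + t) = e (dot2 t \<xi>) * (e (dot2 x \<xi>) * f x)" for x
      by (simp add: d(2) dot2_add_left e_add)
    then have "fourier mu e f \<xi> = 0" unfolding fourier_def
      by (rule integral_eq_0_if_twisted[OF nice_fourier_integrand[OF assms] _ t(2)])
    then show False using nz by simp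
  qed
  then have "bsupp (fourier mu e f)" unfolding bsupp_def by blast
  then show ?thesis using 1 by (simp add: nice_def)
qed

lemma nice_reflect: assumes "nice g" shows "nice (\<lambda>x. g (- x))"
proof -
  obtain d A where d: "0 < d" "\<And>x t. nm t \<le> d \<Longrightarrow> g (x + t) = g x" and A: "\<And>x. g x \<noteq> 0 \<Longrightarrow> nm x \<le> A"
    using assms unfolding nice_def lconst_def bsupp_def by blast
  have "g (- (x + t)) = g (- x)" if "nm t \<le> d" for x t
    using d(2)[of "- t" "- x"] that by simp
  then have "lconst (\<lambda>x. g (- x))" unfolding lconst_def using d(1) by blast
  moreover have "nm x \<le> A" if "g (- x) \<noteq> 0" for x using A[OF that] by simp
  then have "bsupp (\<lambda>x. g (- x))" unfolding bsupp_def by blast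
  ultimately show ?thesis by (simp add: nice_def)
qed

lemma fproj_eq_fourier:
  "fproj mu e f A x = fourier mu e (\<lambda>\<xi>. indicator A \<xi> * fourier mu e f \<xi>) (- x)"
  unfolding fproj_def fourier_def[of mu e "\<lambda>\<xi>. indicator A \<xi> * fourier mu e f \<xi>"]
  by (simp add: dot2_minus_right dot2_commute[of _ x] mult.assoc)

lemma nice_fproj_weight:
  "nice f \<Longrightarrow> lconst (indicator A :: _ \<Rightarrow> complex) \<Longrightarrow> nice (\<lambda>\<xi>. indicator A \<xi> * fourier mu e f \<xi>)"
  using nice_mult[OF nice_fourier, of f "indicator A"] by (simp add: mult.commute)

lemma nice_fproj:
  assumes "nice f" "lconst (indicator A :: _ \<Rightarrow> complex)"
  shows "nice (fproj mu e f A)"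
  using nice_reflect[OF nice_fourier[OF nice_fproj_weight[OF assms]]]
  by (simp add: fproj_eq_fourier[abs_def])

lemma ball2_shift_iff:
  assumes "nm t \<le> r" shows "x + t \<in> ball2 av a r \<longleftrightarrow> x \<in> ball2 av a r"
proof -
  have eq: "x + t - a = (x - a) + t" by (simp add: prod_eq_iff)
  have "nm ((x - a) + t) \<le> r \<longleftrightarrow> nm (x - a) \<le> r"
    using nm_add_leI[OF _ assms, of "x - a"] nm_diff_leI[OF _ assms, of "(x - a) + t"]
    by (metis add_diff_cancel)
  then show ?thesis unfolding mem_ball2_iff eq .
qed

lemma lconst_indicator_ball2: "0 < r \<Longrightarrow> lconst (\<lambda>x. x \<in> ball2 av a r)"
  unfolding lconst_def
proof (intro exI[of _ r] conjI allI impI)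
  fix x t assume t: "nm t \<le> r"
  then show "(x + t \<in> ball2 av a r) = (x \<in> ball2 av a r)" by (simp add: ball2_shift_iff)
qed

lemma nice_indicator_ball2:
  assumes "0 < r" shows "nice (indicator (ball2 av a r) :: _ \<Rightarrow> 'b::zero_neq_one)"
proof -
  have "nm x \<le> max r (nm a)" if "x \<in> ball2 av a r" for x
    using nm_add_leI[of "x - a" "max r (nm a)" a] that by (simp add: mem_ball2_iff)
  then have "bsupp (indicator (ball2 av a r) :: _ \<Rightarrow> 'b)"
    unfolding bsupp_def indicator_def by (intro exI[of _ "max r (nm a)"]) auto
  then show ?thesis unfolding nice_def indicator_def
    using lconst_comp[OF lconst_indicator_ball2[OF assms], of "of_bool :: _ \<Rightarrow> 'b"] by simp
qed

lemma measure_ball2_shift: "0 < r \<Longrightarrow> measure mu (ball2 av a r) = measure mu (ball2 av 0 r)"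
  unfolding measure_def by (subst emeasure_ball2_shift) auto

lemma fourier_indicator_ball2:
  assumes "z \<noteq> 0"
  shows "fourier mu e (indicator (ball2 av a (av z))) \<xi> =
    (if nm \<xi> \<le> 1 / av z then e (dot2 a \<xi>) * measure mu (ball2 av 0 (av z)) else 0)"
proof (cases "nm \<xi> \<le> 1 / av z")
  case True
  have "e (dot2 x \<xi>) * (indicator (ball2 av a (av z)) x :: complex) = e (dot2 a \<xi>) * indicator (ball2 av a (av z)) x" for x
  proof (cases "x \<in> ball2 av a (av z)")
    case x: True
    then have "nm (x - a) * nm \<xi> \<le> av z * (1 / av z)"
      using True by (intro mult_mono) (auto simp: mem_ball2_iff)
    also have "\<dots> = 1" using assms by simp
    finally have "e (dot2 (a + (x - a)) \<xi>) = e (dot2 a \<xi>)"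
      unfolding dot2_add_left[of a "x - a"] e_add by (simp add: e_dot2_eq_1)
    then show ?thesis by simp
  qed simp
  moreover have "(\<integral>x. indicator (ball2 av a (av z)) x \<partial>mu) = complex_of_real (measure mu (ball2 av 0 (av z)))"
    using integral_complex_of_real[of mu "indicator (ball2 av a (av z))"] measure_ball2_shift[of "av z" a] assms
    by (simp add: of_real_indicator av_pos_iff)
  ultimately show ?thesis using True assms unfolding fourier_def
    by (simp only: integral_mult_right_zero if_True)
next
  case False
  have zp: "0 < av z" using assms by (simp add: av_pos_iff)
  have "1 < nm \<xi> * av z" using False zp by (simp add: field_simps)
  then obtain t where t: "nm t \<le> av z" "e (dot2 t \<xi>) \<noteq> 1" by (rule e_dot2_nontrivial)
  have "e (dot2 (x + t) \<xi>) * indicator (ball2 av a (av z)) (x + t)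
      = e (dot2 t \<xi>) * (e (dot2 x \<xi>) * indicator (ball2 av a (av z)) x)" for x
    using ball2_shift_iff[OF t(1), of x a] by (simp add: indicator_def dot2_add_left e_add)
  then have "fourier mu e (indicator (ball2 av a (av z))) \<xi> = 0" unfolding fourier_def
    by (rule integral_eq_0_if_twisted[OF nice_fourier_integrand[OF nice_indicator_ball2[OF zp]] _ t(2)])
  then show ?thesis using False by simp
qed

lemma fourier_sum:
  assumes "\<And>i. i \<in> I \<Longrightarrow> nice (f i)"
  shows "fourier mu e (\<lambda>x. \<Sum>i\<in>I. f i x) \<xi> = (\<Sum>i\<in>I. fourier mu e (f i) \<xi>)"
  unfolding fourier_def sum_distrib_left
  using assms by (intro Bochner_Integration.integral_sum nice_integrable nice_fourier_integrand)

lemma fourier_cmult: "fourier mu e (\<lambda>x. c * f x) \<xi> = c * fourier mu e f \<xi>"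
  unfolding fourier_def by (simp add: mult.left_commute)

text \<open>By linearity it suffices to treat the indicator of one ball. Its transform is a
  modulated multiple of the indicator of the dual ball, and transforming again leaves the product of
  the two volumes, which is 1.\<close>

lemma fourier_inversion:
  assumes "nice f" shows "fourier mu e (fourier mu e f) (- x) = f x"
proof -
  obtain X z where X: "finite X" "z \<noteq> 0" "f = (\<lambda>x. \<Sum>a\<in>X. indicator (ball2 av a (av z)) x *\<^sub>R f a)"
    using nice_expand[OF assms] by blast
  have f: "f = (\<lambda>x. \<Sum>a\<in>X. f a * indicator (ball2 av a (av z)) x)"
    by (subst X(3)) (simp add: scaleR_conv_of_real mult.commute of_real_indicator)
  have zp: "0 < av z" using X(2) by (simp add: av_pos_iff)
  have iv: "av (inverse z) = 1 / av z" 
    by (simp only: av_inverse) (simp add: inverse_eq_divide)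
  let ?m = "complex_of_real (measure mu (ball2 av 0 (av z)))"
  define g where "g a = (\<lambda>\<xi>. if nm \<xi> \<le> 1 / av z then e (dot2 a \<xi>) * ?m else 0)" for a
  have g: "g a = (\<lambda>\<xi>. fourier mu e (indicator (ball2 av a (av z))) \<xi>)" for a
    unfolding g_def fourier_indicator_ball2[OF X(2)] ..
  have fh: "fourier mu e f = (\<lambda>\<xi>. \<Sum>a\<in>X. f a * g a \<xi>)"
    by (subst f, rule ext) (simp add: fourier_sum fourier_cmult nice_cmult nice_indicator_ball2 zp g)
  have inv: "fourier mu e (g a) (- x) = indicator (ball2 av a (av z)) x" for a
  proof -
    have "e (dot2 \<xi> (- x)) * g a \<xi> = ?m * (e (dot2 \<xi> (a - x)) * indicator (ball2 av 0 (av (inverse z))) \<xi>)" for \<xi>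
    proof -
      have "\<xi> \<in> ball2 av 0 (av (inverse z)) \<longleftrightarrow> nm \<xi> \<le> 1 / av z"
        unfolding mem_ball2_iff iv by simp
      moreover have "e (dot2 \<xi> (a - x)) = e (dot2 \<xi> (- x)) * e (dot2 a \<xi>)"
        using dot2_add_right[of \<xi> "- x" a] by (simp add: e_add dot2_commute)
      ultimately show ?thesis unfolding g_def indicator_def by simp
    qed
    then have "fourier mu e (g a) (- x) = ?m * fourier mu e (indicator (ball2 av 0 (av (inverse z)))) (a - x)"
      unfolding fourier_def by simp
    also have "\<dots> = (if nm (a - x) \<le> av z then ?m * measure mu (ball2 av 0 (1 / av z)) else 0)"
      using X(2) fourier_indicator_ball2[of "inverse z" 0 "a - x"] by (simp add: iv dot2_def)
    also have "\<dots> = (if nm (a - x) \<le> av z then 1 else 0)"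
      using measure_ball2_inverse[OF X(2)] by (simp flip: of_real_mult)
    also have "\<dots> = indicator (ball2 av a (av z)) x"
      by (simp add: indicator_def mem_ball2_iff nm_diff_commute)
    finally show ?thesis .
  qed
  have "nice (g a)" for a unfolding g by (intro nice_fourier nice_indicator_ball2 zp)
  then have "fourier mu e (fourier mu e f) (- x) = (\<Sum>a\<in>X. f a * indicator (ball2 av a (av z)) x)"
    unfolding fh by (simp add: fourier_sum fourier_cmult nice_cmult inv)
  then show ?thesis by (subst f)
qed

lemma fproj_UNIV: "nice f \<Longrightarrow> fproj mu e f UNIV x = f x"
  by (simp add: fproj_eq_fourier fourier_inversion)

lemma fproj_sum:
  assumes "nice f" "\<And>c. c \<in> C \<Longrightarrow> lconst (indicator (A c) :: _ \<Rightarrow> complex)"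
    and "\<And>\<xi>. fourier mu e f \<xi> \<noteq> 0 \<Longrightarrow> (indicator B \<xi> :: complex) = (\<Sum>c\<in>C. indicator (A c) \<xi>)"
  shows "fproj mu e f B x = (\<Sum>c\<in>C. fproj mu e f (A c) x)"
proof -
  have "indicator B \<xi> * fourier mu e f \<xi> = (\<Sum>c\<in>C. indicator (A c) \<xi> * fourier mu e f \<xi>)" for \<xi>
    using assms(3)[of \<xi>] by (cases "fourier mu e f \<xi> = 0") (auto simp: sum_distrib_right)
  then show ?thesis unfolding fproj_eq_fourier
    using assms by (simp add: fourier_sum nice_fproj_weight)
qed

lemma fproj_shift:
  assumes "\<And>\<xi>. \<xi> \<in> A \<Longrightarrow> e (- dot2 t \<xi>) = w"
  shows "fproj mu e f A (x + t) = w * fproj mu e f A x"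
proof -
  have "e (- dot2 (x + t) \<xi>) * indicator A \<xi> * fourier mu e f \<xi>
      = w * (e (- dot2 x \<xi>) * indicator A \<xi> * fourier mu e f \<xi>)" for \<xi>
    using assms[of \<xi>] e_add[of "- dot2 x \<xi>" "- dot2 t \<xi>"] by (auto simp: indicator_def dot2_add_left)
  then show ?thesis unfolding fproj_def by (simp only: integral_mult_right_zero)
qed

lemma schwartz_bruhat_nice: assumes "schwartz_bruhat av f" shows "nice f"
proof -
  from assms obtain n and c :: "nat \<Rightarrow> complex" and a r where r: "\<forall>i<n. 0 < r i"
    and f: "f = (\<lambda>x. \<Sum>i<n. c i * indicator (ball2 av (a i) (r i)) x)"
    unfolding schwartz_bruhat_def by (elim exE conjE)
  show ?thesis unfolding f
    by (intro nice_sum nice_cmult nice_indicator_ball2) (use r in simp)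
qed

section \<open>Caps and the characters that are constant on them\<close>

lemma cap_shift:
  assumes "av c \<le> 1" "0 < s" "s \<le> 1" "\<xi> \<in> cap av c s" "nm h \<le> s\<^sup>2"
  shows "\<xi> + h \<in> cap av c s"
proof -
  obtain x y h1 h2 where xy: "\<xi> = (x, y)" "h = (h1, h2)" by fastforce
  have le: "s\<^sup>2 \<le> s" "s\<^sup>2 \<le> 1" using assms by (auto simp: power2_eq_square mult_le_one)
  have h: "av h1 \<le> s\<^sup>2" "av h2 \<le> s\<^sup>2" using assms(5) by (auto simp: xy nm_le_iff)
  have x: "av (x - c) \<le> s" "av (y - x\<^sup>2) \<le> s\<^sup>2" using assms(4) by (auto simp: cap_def xy)
  have "av x \<le> 1" using av_add_leI[of "x - c" 1 c] x assms by simp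
  have 1: "av (x + h1 - c) \<le> s"
    using av_add_leI[of "x - c" s h1] x h le by (simp add: algebra_simps)
  \<comment> \<open>Moving \<open>x\<close> by \<open>h1\<close> changes \<open>x\<^sup>2\<close> by
    \<open>h1 * (2 * x + h1)\<close>, whose second factor is integral, so a cap is stable under
    shifts of size \<open>s\<^sup>2\<close>.\<close>
  have "av (2 * x + h1) \<le> 1"
    using \<open>av x \<le> 1\<close> av_2_le_1 h le by (intro av_add_leI) (auto simp: av_mult intro: mult_le_one)
  then have "av (h1 * (2 * x + h1)) \<le> s\<^sup>2"
    unfolding av_mult using mult_mono[OF h(1), of "av (2 * x + h1)" 1] by simp
  then have "av ((y - x\<^sup>2) + (h2 - h1 * (2 * x + h1))) \<le> s\<^sup>2"
    by (rule av_add_leI[OF x(2) av_diff_leI[OF h(2)]])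
  also have "(y - x\<^sup>2) + (h2 - h1 * (2 * x + h1)) = y + h2 - (x + h1)\<^sup>2"
    by (simp add: power2_eq_square algebra_simps)
  finally show ?thesis using 1 by (simp add: cap_def xy)
qed

lemma lconst_indicator_cap:
  assumes "av c \<le> 1" "0 < s" "s \<le> 1"
  shows "lconst (indicator (cap av c s) :: _ \<Rightarrow> complex)"
  unfolding lconst_def
proof (intro exI[of _ "s\<^sup>2"] conjI allI impI)
  show "0 < s\<^sup>2" using assms by simp
  fix x h assume h: "nm h \<le> s\<^sup>2"
  have "x + h \<in> cap av c s \<longleftrightarrow> x \<in> cap av c s"
    using cap_shift[OF assms _ h, of x] cap_shift[OF assms, of "x + h" "- h"] h by auto
  then show "indicator (cap av c s) (x + h) = (indicator (cap av c s) x :: complex)"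
    by (simp add: indicator_def)
qed

text \<open>Taylor expansion at \<open>(c, c\<^sup>2)\<close>: up to sign, the phase differs from
  the phase at the centre by \<open>(fst t + 2 * c * snd t) * (x - c) + snd t * (y - x\<^sup>2) +
  snd t * (x - c)\<^sup>2\<close>. The hypotheses, which put \<open>t\<close> in the rectangle dual
  to the cap, make each term integral.\<close>

lemma e_dot2_cap:
  assumes "\<xi> \<in> cap av c s" "0 < s" "av (fst t + 2 * c * snd t) * s \<le> 1" "av (snd t) * s\<^sup>2 \<le> 1"
  shows "e (- dot2 t \<xi>) = e (- (fst t * c + snd t * c\<^sup>2))"
proof -
  obtain x y where xy: "\<xi> = (x, y)" by fastforce
  have x: "av (x - c) \<le> s" "av (y - x\<^sup>2) \<le> s\<^sup>2" using assms(1) by (auto simp: cap_def xy)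
  have "av ((fst t + 2 * c * snd t) * (x - c)) \<le> 1"
    unfolding av_mult[of "fst t + 2 * c * snd t"]
    using assms(3) mult_left_mono[OF x(1), of "av (fst t + 2 * c * snd t)"] by simp
  moreover have "av (snd t * (y - x\<^sup>2)) \<le> 1"
    unfolding av_mult using assms(4) mult_left_mono[OF x(2), of "av (snd t)"] by simp
  moreover have "av (snd t * (x - c)\<^sup>2) \<le> 1"
    unfolding av_mult av_power using assms(4) mult_left_mono[OF power_mono[OF x(1)], of "av (snd t)" 2] by simp
  ultimately have "av (- ((fst t + 2 * c * snd t) * (x - c) + snd t * (y - x\<^sup>2) + snd t * (x - c)\<^sup>2)) \<le> 1"
    unfolding av_minus by (intro av_add_leI)
  then have "e (- (fst t * c + snd t * c\<^sup>2)
      + - ((fst t + 2 * c * snd t) * (x - c) + snd t * (y - x\<^sup>2) + snd t * (x - c)\<^sup>2))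
      = e (- (fst t * c + snd t * c\<^sup>2))"
    unfolding e_add[of "- (fst t * c + snd t * c\<^sup>2)"] by (simp add: e_integral)
  also have "- (fst t * c + snd t * c\<^sup>2)
      + - ((fst t + 2 * c * snd t) * (x - c) + snd t * (y - x\<^sup>2) + snd t * (x - c)\<^sup>2) = - dot2 t \<xi>"
    by (simp add: dot2_def xy power2_eq_square algebra_simps)
  finally show ?thesis .
qed

subsection \<open>Almost orthogonality\<close>

lemma nice_mult_nice:
  fixes f g :: "'a \<times> 'a \<Rightarrow> 'b::mult_zero"
  shows "nice f \<Longrightarrow> nice g \<Longrightarrow> nice (\<lambda>x. f x * g x)"
  by (intro nice_mult nice_lconst)

lemma nice_cnj: "nice f \<Longrightarrow> nice (\<lambda>x. cnj (f x))"
  by (rule nice_comp) auto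

lemma nice_cmod_power2: "nice f \<Longrightarrow> nice (\<lambda>x. (cmod (f x))\<^sup>2)"
  by (rule nice_comp[where \<phi> = "\<lambda>y. (cmod y)\<^sup>2"]) auto

lemma nice_integral_mono:
  fixes f g :: "'a \<times> 'a \<Rightarrow> real"
  shows "nice f \<Longrightarrow> nice g \<Longrightarrow> (\<And>x. f x \<le> g x) \<Longrightarrow> (\<integral>x. f x \<partial>mu) \<le> (\<integral>x. g x \<partial>mu)"
  by (intro integral_mono nice_integrable)

lemma nice_integral_sum:
  fixes f :: "'i \<Rightarrow> 'a \<times> 'a \<Rightarrow> 'b::{banach, second_countable_topology}"
  assumes "\<And>i. i \<in> I \<Longrightarrow> nice (f i)"
  shows "(\<integral>x. (\<Sum>i\<in>I. f i x) \<partial>mu) = (\<Sum>i\<in>I. \<integral>x. f i x \<partial>mu)"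
  using assms by (intro Bochner_Integration.integral_sum nice_integrable)

lemma nice_integral_add:
  fixes f g :: "'a \<times> 'a \<Rightarrow> 'b::{banach, second_countable_topology}"
  shows "nice f \<Longrightarrow> nice g \<Longrightarrow> (\<integral>x. f x + g x \<partial>mu) = (\<integral>x. f x \<partial>mu) + (\<integral>x. g x \<partial>mu)"
  by (intro Bochner_Integration.integral_add nice_integrable)

lemma nice_integral_diff:
  fixes f g :: "'a \<times> 'a \<Rightarrow> 'b::{banach, second_countable_topology}"
  shows "nice f \<Longrightarrow> nice g \<Longrightarrow> (\<integral>x. f x - g x \<partial>mu) = (\<integral>x. f x \<partial>mu) - (\<integral>x. g x \<partial>mu)"
  by (intro Bochner_Integration.integral_diff nice_integrable)

lemma nice_sum_mult_sum_integral:
  fixes f :: "'i \<Rightarrow> 'a \<times> 'a \<Rightarrow> 'b::{real_normed_algebra, banach, second_countable_topology}"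
  assumes "\<And>i. i \<in> I \<Longrightarrow> nice (f i)" "\<And>j. j \<in> J \<Longrightarrow> nice (g j)"
  shows "(\<integral>x. (\<Sum>i\<in>I. f i x) * (\<Sum>j\<in>J. g j x) \<partial>mu) = (\<Sum>i\<in>I. \<Sum>j\<in>J. \<integral>x. f i x * g j x \<partial>mu)"
proof -
  have "(\<integral>x. (\<Sum>i\<in>I. f i x) * (\<Sum>j\<in>J. g j x) \<partial>mu) = (\<integral>x. (\<Sum>i\<in>I. \<Sum>j\<in>J. f i x * g j x) \<partial>mu)"
    by (simp only: sum_product)
  also have "\<dots> = (\<Sum>i\<in>I. \<integral>x. (\<Sum>j\<in>J. f i x * g j x) \<partial>mu)"
    by (rule nice_integral_sum) (intro nice_sum nice_mult_nice assms)
  also have "\<dots> = (\<Sum>i\<in>I. \<Sum>j\<in>J. \<integral>x. f i x * g j x \<partial>mu)"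
    by (intro sum.cong refl nice_integral_sum nice_mult_nice assms)
  finally show ?thesis .
qed

lemma integral_mult_le_half_squares:
  fixes f g :: "'a \<times> 'a \<Rightarrow> real"
  assumes "nice f" "nice g"
  shows "(\<integral>x. f x * g x \<partial>mu) \<le> ((\<integral>x. (f x)\<^sup>2 \<partial>mu) + (\<integral>x. (g x)\<^sup>2 \<partial>mu)) / 2"
proof -
  have "2 * (\<integral>x. f x * g x \<partial>mu) = (\<integral>x. 2 * (f x * g x) \<partial>mu)" by simp
  also have "\<dots> \<le> (\<integral>x. (f x)\<^sup>2 + (g x)\<^sup>2 \<partial>mu)"
  proof (rule nice_integral_mono)
    fix x show "2 * (f x * g x) \<le> (f x)\<^sup>2 + (g x)\<^sup>2"
      using sum_squares_bound[of "f x" "g x"] by (simp add: mult.assoc)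
  qed (intro nice_cmult nice_mult_nice nice_add nice_power2 assms)+
  also have "\<dots> = (\<integral>x. (f x)\<^sup>2 \<partial>mu) + (\<integral>x. (g x)\<^sup>2 \<partial>mu)"
    by (intro nice_integral_add nice_power2 assms)
  finally show ?thesis by simp
qed

lemma Re_integral_mult_cnj_le:
  assumes "nice f" "nice g"
  shows "Re (\<integral>x. f x * cnj (g x) \<partial>mu) \<le> ((\<integral>x. (cmod (f x))\<^sup>2 \<partial>mu) + (\<integral>x. (cmod (g x))\<^sup>2 \<partial>mu)) / 2"
proof -
  have n: "nice (\<lambda>x. f x * cnj (g x))" by (intro nice_mult_nice nice_cnj assms)
  have "Re (\<integral>x. f x * cnj (g x) \<partial>mu) = (\<integral>x. Re (f x * cnj (g x)) \<partial>mu)"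
    by (rule integral_Re[OF nice_integrable[OF n], symmetric])
  also have "\<dots> \<le> (\<integral>x. cmod (f x) * cmod (g x) \<partial>mu)"
  proof (rule nice_integral_mono)
    show "nice (\<lambda>x. Re (f x * cnj (g x)))" by (rule nice_comp[OF n]) auto
    show "nice (\<lambda>x. cmod (f x) * cmod (g x))"
      using assms by (intro nice_mult_nice) (auto intro: nice_comp)
    fix x show "Re (f x * cnj (g x)) \<le> cmod (f x) * cmod (g x)"
      using complex_Re_le_cmod[of "f x * cnj (g x)"] by (simp add: norm_mult)
  qed
  also have "\<dots> \<le> ((\<integral>x. (cmod (f x))\<^sup>2 \<partial>mu) + (\<integral>x. (cmod (g x))\<^sup>2 \<partial>mu)) / 2"
    using assms by (intro integral_mult_le_half_squares) (auto intro: nice_comp)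
  finally show ?thesis .
qed

end

text \<open>Each entry is split between its two indices; by symmetry both halves are summed by rows,
  and a row has at most \<open>M\<close> entries.\<close>

lemma schur_test:
  fixes a :: "'i \<Rightarrow> 'i \<Rightarrow> real" and q :: "'i \<Rightarrow> real"
  assumes fin: "finite I" and sym: "\<And>i j. i \<in> I \<Longrightarrow> j \<in> I \<Longrightarrow> r i j \<Longrightarrow> r j i"
    and deg: "\<And>i. i \<in> I \<Longrightarrow> real (card {j\<in>I. r i j}) \<le> M"
    and q: "\<And>i. i \<in> I \<Longrightarrow> 0 \<le> q i"
    and a: "\<And>i j. i \<in> I \<Longrightarrow> j \<in> I \<Longrightarrow> r i j \<Longrightarrow> a i j \<le> (q i + q j) / 2"
  shows "(\<Sum>i\<in>I. \<Sum>j\<in>{j\<in>I. r i j}. a i j) \<le> M * (\<Sum>i\<in>I. q i)"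
proof -
  have "(\<Sum>i\<in>I. \<Sum>j\<in>{j\<in>I. r i j}. a i j) \<le> (\<Sum>i\<in>I. \<Sum>j\<in>{j\<in>I. r i j}. q i / 2 + q j / 2)"
    using a by (intro sum_mono) (auto simp: add_divide_distrib)
  also have "\<dots> = (\<Sum>i\<in>I. \<Sum>j\<in>{j\<in>I. r i j}. q i / 2) + (\<Sum>i\<in>I. \<Sum>j\<in>{j\<in>I. r i j}. q j / 2)"
    by (simp add: sum.distrib)
  also have "(\<Sum>i\<in>I. \<Sum>j\<in>{j\<in>I. r i j}. q j / 2) = (\<Sum>j\<in>I. \<Sum>i\<in>{i\<in>I. r i j}. q j / 2)"
    by (rule sum.swap_restrict[OF fin fin])
  also have "\<dots> = (\<Sum>i\<in>I. \<Sum>j\<in>{j\<in>I. r i j}. q i / 2)"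
    using sym by (intro sum.cong refl) auto
  also have "(\<Sum>i\<in>I. \<Sum>j\<in>{j\<in>I. r i j}. q i / 2) = (\<Sum>i\<in>I. real (card {j\<in>I. r i j}) * q i) / 2"
    by (simp add: sum_divide_distrib)
  also have "(\<Sum>i\<in>I. real (card {j\<in>I. r i j}) * q i) / 2 + (\<Sum>i\<in>I. real (card {j\<in>I. r i j}) * q i) / 2
      \<le> M * (\<Sum>i\<in>I. q i)"
    using deg q by (auto simp: sum_distrib_left intro!: sum_mono mult_right_mono)
  finally show ?thesis .
qed

context haar_local_field
begin

lemma of_real_integral_cmod_power2:
  "complex_of_real (\<integral>x. (cmod (f x))\<^sup>2 \<partial>mu) = (\<integral>x. f x * cnj (f x) \<partial>mu)"
  by (simp only: integral_complex_of_real[symmetric] complex_norm_square)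

lemma almost_orthogonal:
  fixes g :: "'i \<Rightarrow> 'a \<times> 'a \<Rightarrow> complex"
  assumes fin: "finite I" and nice: "\<And>i. i \<in> I \<Longrightarrow> nice (g i)"
    and deg: "\<And>i. i \<in> I \<Longrightarrow> real (card {j\<in>I. (\<integral>x. g i x * cnj (g j x) \<partial>mu) \<noteq> 0}) \<le> M"
  shows "(\<integral>x. (cmod (\<Sum>i\<in>I. g i x))\<^sup>2 \<partial>mu) \<le> M * (\<Sum>i\<in>I. \<integral>x. (cmod (g i x))\<^sup>2 \<partial>mu)"
proof -
  define ip where "ip i j = (\<integral>x. g i x * cnj (g j x) \<partial>mu)" for i j
  have ip_cnj: "ip j i = cnj (ip i j)" for i j
    unfolding ip_def using Bochner_Integration.integral_cnj[of mu "\<lambda>x. g i x * cnj (g j x)"] by (simp add: mult.commute)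
  have "complex_of_real (\<integral>x. (cmod (\<Sum>i\<in>I. g i x))\<^sup>2 \<partial>mu)
      = (\<integral>x. (\<Sum>i\<in>I. g i x) * (\<Sum>j\<in>I. cnj (g j x)) \<partial>mu)"
    unfolding of_real_integral_cmod_power2 by simp
  also have "\<dots> = (\<Sum>i\<in>I. \<Sum>j\<in>I. ip i j)"
    unfolding ip_def by (intro nice_sum_mult_sum_integral nice nice_cnj)
  also have "\<dots> = (\<Sum>i\<in>I. \<Sum>j\<in>{j\<in>I. ip i j \<noteq> 0}. ip i j)"
    using fin by (intro sum.cong refl sum.mono_neutral_right) auto
  finally have "Re (complex_of_real (\<integral>x. (cmod (\<Sum>i\<in>I. g i x))\<^sup>2 \<partial>mu))
      = Re (\<Sum>i\<in>I. \<Sum>j\<in>{j\<in>I. ip i j \<noteq> 0}. ip i j)" by presburger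
  then have "(\<integral>x. (cmod (\<Sum>i\<in>I. g i x))\<^sup>2 \<partial>mu) = (\<Sum>i\<in>I. \<Sum>j\<in>{j\<in>I. ip i j \<noteq> 0}. Re (ip i j))"
    by (simp only: Re_complex_of_real Re_sum)
  also have "\<dots> \<le> M * (\<Sum>i\<in>I. \<integral>x. (cmod (g i x))\<^sup>2 \<partial>mu)"
  proof (rule schur_test[OF fin])
    show "ip j i \<noteq> 0" if "ip i j \<noteq> 0" for i j using that ip_cnj[of j i] by simp
    show "real (card {j \<in> I. ip i j \<noteq> 0}) \<le> M" if "i \<in> I" for i using deg[OF that] unfolding ip_def .
    show "Re (ip i j) \<le> ((\<integral>x. (cmod (g i x))\<^sup>2 \<partial>mu) + (\<integral>x. (cmod (g j x))\<^sup>2 \<partial>mu)) / 2"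
      if "i \<in> I" "j \<in> I" for i j
      unfolding ip_def using that by (intro Re_integral_mult_cnj_le nice)
  qed simp
  finally show ?thesis .
qed

lemma integral_mult_cnj_eq_0:
  assumes "nice f" "nice g" "\<And>x. f (x + t) = e a * f x" "\<And>x. g (x + t) = e b * g x" "e (a - b) \<noteq> 1"
  shows "(\<integral>x. f x * cnj (g x) \<partial>mu) = 0"
proof (rule integral_eq_0_if_twisted[OF _ _ assms(5)])
  show "nice (\<lambda>x. f x * cnj (g x))" by (intro nice_mult_nice nice_cnj assms)
  show "f (x + t) * cnj (g (x + t)) = e (a - b) * (f x * cnj (g x))" for x
    using e_add[of a "- b"] by (simp add: assms(3,4) e_minus)
qed

lemma char_trivial_imp_small:
  assumes "\<And>t. av t \<le> P ^ k \<Longrightarrow> e (t * y) = 1" shows "av y \<le> 1 / P ^ k"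
proof (rule ccontr)
  assume "\<not> av y \<le> 1 / P ^ k"
  moreover have z: "av (1 / varpi ^ k) = P ^ k" by (simp add: av_divide av_varpi_power)
  ultimately have "1 < av y * av (1 / varpi ^ k)" by (simp add: field_simps)
  then obtain t where "av t \<le> av (1 / varpi ^ k)" "e (t * y) \<noteq> 1" by (rule e_nontrivial_scaled)
  then show False using assms z by simp
qed

text \<open>With \<open>u = c - d\<close>, \<open>\<delta> = c' - c\<close> and \<open>y = c - d - c' + d'\<close>, the frequency is
  \<open>-2 \<delta> u - 2 u y + 2 \<delta> y + y\<^sup>2\<close>, whose first term dominates.\<close>

lemma biorthogonality_arith:
  fixes c d c' d' :: 'a
  defines "y \<equiv> c - d - c' + d'"
  assumes u: "1 / P ^ Suc j < av (c - d)" and jk: "j < k" and y: "av y \<le> 1 / P ^ k"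
    and triv: "\<And>t. av (2 * (c - c') * t) \<le> P ^ k \<Longrightarrow> av t \<le> P ^ (k + j) \<Longrightarrow>
      e (t * (c\<^sup>2 - d\<^sup>2 - c'\<^sup>2 + d'\<^sup>2 - 2 * c * y)) = 1"
  shows "av (c' - c) \<le> P\<^sup>2 / P ^ k"
proof (rule ccontr)
  assume far: "\<not> av (c' - c) \<le> P\<^sup>2 / P ^ k"
  define u \<delta> where "u = c - d" and "\<delta> = c' - c"
  define Q where "Q = c\<^sup>2 - d\<^sup>2 - c'\<^sup>2 + d'\<^sup>2 - 2 * c * y"
  have Q: "Q = - (2 * \<delta> * u) + ((- (2 * u * y) + 2 * \<delta> * y) + y\<^sup>2)"
    unfolding Q_def u_def \<delta>_def y_def by (simp add: power2_eq_square algebra_simps)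
  have dl: "P\<^sup>2 / P ^ k < av \<delta>" using far by (simp add: \<delta>_def)
  have Pk: "1 / P ^ k \<le> 1 / P ^ Suc j" using jk P_ge_1
    by (intro divide_left_mono power_increasing) auto
  have uk: "1 / P ^ k < av u" using u Pk by (simp add: u_def)
  have P2: "1 / P ^ k \<le> P\<^sup>2 / P ^ k" using P_ge_1 by (intro divide_right_mono) auto
  have pos: "0 < av u" "0 < av \<delta>" "0 < av 2"
  proof -
    have "0 < 1 / P ^ k" "0 < P\<^sup>2 / P ^ k" by simp_all
    then show "0 < av u" "0 < av \<delta>" "0 < av 2"
      using uk dl two_nonzero by (linarith, linarith, simp add: av_pos_iff)
  qed
  have main: "av (2 * \<delta> * u) = av 2 * av \<delta> * av u" by (simp add: av_mult)
  have s1: "av (2 * u * y) < av 2 * av \<delta> * av u"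
  proof -
    have "av y < av \<delta>" using y dl P2 by linarith
    then show ?thesis using pos by (simp add: av_mult mult.assoc mult.left_commute)
  qed
  have s2: "av (2 * \<delta> * y) < av 2 * av \<delta> * av u"
    using y uk pos by (simp add: av_mult)
  \<comment> \<open>In the product \<open>av 2 * av \<delta>\<close>, one factor \<open>P\<close> of
    the lower bound \<open>P\<^sup>2 / P ^ k\<close> for \<open>av \<delta>\<close> compensates
    \<open>av 2 \<ge> 1 / P\<close>.\<close>
  have s3: "av (y\<^sup>2) < av 2 * av \<delta> * av u"
  proof -
    have "av (y\<^sup>2) \<le> (1 / P ^ k) * (1 / P ^ k)"
      unfolding power2_eq_square av_mult using y by (intro mult_mono) auto
    also have "\<dots> \<le> (1 / P * (P\<^sup>2 / P ^ k)) * (1 / P ^ k)"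
      using P_ge_1 by (intro mult_right_mono) (auto simp: power2_eq_square divide_right_mono)
    also have "\<dots> < (1 / P * (P\<^sup>2 / P ^ k)) * av u" using uk by (intro mult_strict_left_mono) auto
    also have "\<dots> \<le> (av 2 * av \<delta>) * av u"
      using av_2_ge dl pos by (intro mult_right_mono mult_mono) auto
    finally show ?thesis .
  qed
  have "av ((- (2 * u * y) + 2 * \<delta> * y) + y\<^sup>2) < av (- (2 * \<delta> * u))"
    using s1 s2 s3 av_add_le[of "- (2 * u * y) + 2 * \<delta> * y" "y\<^sup>2"] av_add_le[of "- (2 * u * y)" "2 * \<delta> * y"]
    unfolding av_minus main by (meson le_less_trans max_less_iff_conj)
  then have avQ: "av Q = av 2 * av \<delta> * av u" unfolding Q using av_add_eq main by (metis av_minus)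
  \<comment> \<open>The contradiction comes from the shift parameter \<open>x / Q\<close>, for which
    the character in \<open>triv\<close> takes the value \<open>e x\<close>.\<close>
  obtain x where x: "av x \<le> 1 / av \<pi>" "e x \<noteq> 1" using e_nontrivial by blast
  have Q0: "Q \<noteq> 0" using avQ pos by (metis av_0 less_irrefl mult_pos_pos)
  have g1: "1 / P ^ k \<le> av u * av \<pi>"
    using av_gap[of "varpi ^ k" u] uk by (simp add: av_varpi_power)
  have g2: "P\<^sup>2 / P ^ k \<le> av \<delta> * av \<pi>"
    using av_gap[of "varpi ^ k / varpi ^ 2" \<delta>] dl by (simp add: av_divide av_varpi_power)
  have t1: "av (2 * (c - c') * (x / Q)) \<le> P ^ k"
  proof -
    have "av (2 * (c - c') * (x / Q)) = av x / av u"
      using pos unfolding av_mult av_divide avQ by (auto simp: \<delta>_def av_commute[of c c'])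
    also have "\<dots> \<le> (1 / av \<pi>) / av u" using x pos by (intro divide_right_mono) auto
    also have "\<dots> \<le> P ^ k" using g1 pos av_pi_pos by (simp add: field_simps)
    finally show ?thesis .
  qed
  \<comment> \<open>This uses up \<open>P\<^sup>2\<close>: one factor for \<open>av 2\<close>, the
    other because \<open>av u\<close> is known only up to the factor \<open>P\<close> between two
    levels. The factor \<open>av \<pi>\<close> from \<open>g2\<close> absorbs the bound
    \<open>1 / av \<pi>\<close> on \<open>x\<close>.\<close>
  have t2: "av (x / Q) \<le> P ^ (k + j)"
  proof -
    have lo: "1 / P ^ (k + j) \<le> av 2 * (av \<delta> * av \<pi>) * av u"
    proof -
      have "1 / P ^ (k + j) = 1 / P * (P\<^sup>2 / P ^ k) * (1 / P ^ Suc j)"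
        by (simp add: power_add power2_eq_square field_simps)
      also have "\<dots> \<le> av 2 * (av \<delta> * av \<pi>) * av u"
        using av_2_ge g2 u pos by (intro mult_mono) (auto simp: u_def)
      finally show ?thesis .
    qed
    have "av (x / Q) \<le> (1 / av \<pi>) / (av 2 * av \<delta> * av u)"
      unfolding av_divide avQ using x pos by (intro divide_right_mono) auto
    also have "\<dots> = 1 / (av 2 * (av \<delta> * av \<pi>) * av u)" by (simp add: field_simps)
    also have "\<dots> \<le> 1 / (1 / P ^ (k + j))" using lo pos av_pi_pos by (intro divide_left_mono mult_pos_pos) auto
    finally show ?thesis by simp
  qed
  have "e (x / Q * Q) = 1" using triv[OF t1 t2] unfolding Q_def .
  then show False using x Q0 by simp
qed

end

subsection \<open>Scales and biorthogonality of the parabola\<close>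

locale scales = haar_local_field av \<pi> e mu
  for av :: "'a::field \<Rightarrow> real" and \<pi> :: 'a and e :: "'a \<Rightarrow> complex" and mu :: "('a \<times> 'a) measure" +
  fixes N :: nat and \<Theta> :: "nat \<Rightarrow> 'a set"
  assumes transversal_Theta: "\<And>k. transversal (\<Theta> k) (1 / P ^ k)"
begin

lemma finite_Theta [simp]: "finite (\<Theta> k)" and av_Theta: "a \<in> \<Theta> k \<Longrightarrow> av a \<le> 1"
  and Theta_ex: "av x \<le> 1 \<Longrightarrow> \<exists>a\<in>\<Theta> k. av (x - a) \<le> 1 / P ^ k"
  and Theta_unique: "a \<in> \<Theta> k \<Longrightarrow> b \<in> \<Theta> k \<Longrightarrow> av (a - b) \<le> 1 / P ^ k \<Longrightarrow> a = b"
  using transversal_Theta[of k] unfolding transversal_def by blast+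

text \<open>Arcs are represented by their centres in \<Theta>. For \<open>k \<le> j\<close> this is
  the set of level-\<open>j\<close> arcs inside the arc of radius \<open>1 / P ^ k\<close> about
  \<open>a\<close>; since balls are nested or disjoint, the arcs of all levels form a tree.\<close>

definition cl :: "nat \<Rightarrow> nat \<Rightarrow> 'a \<Rightarrow> 'a set" where
  "cl j k a = {b \<in> \<Theta> j. av (b - a) \<le> 1 / P ^ k}"

lemma finite_cl [simp]: "finite (cl j k a)"
  by (simp add: cl_def)

lemma cl_subset: "b \<in> cl j k a \<Longrightarrow> b \<in> \<Theta> j"
  by (simp add: cl_def)

lemma cl_self [simp]: "a \<in> \<Theta> j \<Longrightarrow> a \<in> cl j k a"
  by (simp add: cl_def)

lemma cl_cong: assumes "av (a - b) \<le> 1 / P ^ k" shows "cl j k a = cl j k b"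
proof -
  have "av (x - a) \<le> 1 / P ^ k \<longleftrightarrow> av (x - b) \<le> 1 / P ^ k" for x
    using assms av_diff_trans[of x a _ b] av_diff_trans[of x b _ a] av_commute[of a b] by auto
  then show ?thesis by (simp add: cl_def)
qed

lemma inverse_power_P_antimono: "r \<le> k \<Longrightarrow> 1 / P ^ k \<le> 1 / P ^ r"
  using P_ge_1 by (intro divide_left_mono power_increasing) auto

lemma cl_eq_Union: assumes "r \<le> k" shows "cl j r a = (\<Union>b\<in>cl k r a. cl j k b)"
proof (rule set_eqI, rule iffI)
  fix c assume c: "c \<in> cl j r a"
  then obtain b where b: "b \<in> \<Theta> k" "av (c - b) \<le> 1 / P ^ k"
    using Theta_ex[of c k] av_Theta cl_subset by blast
  then have "av (b - a) \<le> 1 / P ^ r"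
    using c inverse_power_P_antimono[OF assms] av_diff_trans[of b c "1 / P ^ r" a] av_commute[of c b]
    by (auto simp: cl_def)
  then show "c \<in> (\<Union>b\<in>cl k r a. cl j k b)" using b c by (auto simp: cl_def)
next
  fix c assume "c \<in> (\<Union>b\<in>cl k r a. cl j k b)"
  then obtain b where b: "b \<in> \<Theta> k" "av (b - a) \<le> 1 / P ^ r" "c \<in> \<Theta> j" "av (c - b) \<le> 1 / P ^ k"
    by (auto simp: cl_def)
  then show "c \<in> cl j r a"
    using inverse_power_P_antimono[OF assms] av_diff_trans[of c b "1 / P ^ r" a] by (auto simp: cl_def)
qed

lemma cl_disjoint:
  assumes "b \<in> \<Theta> k" "b' \<in> \<Theta> k" "c \<in> cl j k b" "c \<in> cl j k b'" shows "b = b'"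
proof (rule Theta_unique[OF assms(1,2)])
  show "av (b - b') \<le> 1 / P ^ k"
    using assms av_diff_trans[of b c _ b'] av_commute[of b c] by (auto simp: cl_def)
qed

lemma sum_cl_regroup:
  assumes "r \<le> k"
  shows "(\<Sum>c\<in>cl j r a. G c) = (\<Sum>b\<in>cl k r a. \<Sum>c\<in>cl j k b. G c)"
  unfolding cl_eq_Union[OF assms, of j a]
  by (rule sum.UNION_disjoint) (auto dest: cl_disjoint[OF cl_subset cl_subset])

lemma Theta_eq_cl: "av a \<le> 1 \<Longrightarrow> cl j 0 a = \<Theta> j"
  using av_Theta[of _ j] by (auto simp: cl_def intro: av_diff_leI)

lemma sum_Theta_regroup: "(\<Sum>c\<in>\<Theta> j. G c) = (\<Sum>b\<in>\<Theta> k. \<Sum>c\<in>cl j k b. G c)"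
  using sum_cl_regroup[of 0 k G j 0] by (simp add: Theta_eq_cl)

lemma card_near_le:
  assumes "B \<subseteq> \<Theta> k" "\<And>b. b \<in> B \<Longrightarrow> av (b - a) \<le> P ^ m / P ^ k" shows "real (card B) \<le> P ^ m"
  using card_transversal_near_le[OF transversal_Theta assms] .

lemma card_children_le: "real (card (cl (Suc k) k a)) \<le> P"
  using card_near_le[of "cl (Suc k) k a" "Suc k" a 1] by (auto simp: cl_def)

lemma ex_level:
  assumes "av u \<le> 1" "1 / P ^ k < av u"
  obtains j where "j < k" "1 / P ^ Suc j < av u" "av u \<le> 1 / P ^ j"
proof -
  define i where "i = (LEAST i. 1 / P ^ i < av u)"
  have i: "1 / P ^ i < av u" "i \<le> k" unfolding i_def
    using assms(2) by (auto intro: LeastI Least_le)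
  have "i \<noteq> 0" using i assms(1) by (cases i) auto
  then obtain j where j: "i = Suc j" using not0_implies_Suc by blast
  have "\<not> 1 / P ^ j < av u" using not_less_Least[of j "\<lambda>i. 1 / P ^ i < av u"] j by (simp add: i_def)
  then show ?thesis using that[of j] i j by auto
qed

lemma biorthogonality:
  fixes g :: "'a \<times> 'a \<Rightarrow> 'a \<times> 'a \<Rightarrow> complex"
  assumes Pr: "Pr \<subseteq> \<Theta> k \<times> \<Theta> k" "\<And>c d. (c, d) \<in> Pr \<Longrightarrow> c \<noteq> d"
    and nice: "\<And>p. p \<in> Pr \<Longrightarrow> nice (g p)"
    and twist: "\<And>c d j t x. (c, d) \<in> Pr \<Longrightarrow> 1 / P ^ Suc j < av (c - d) \<Longrightarrow> av (c - d) \<le> 1 / P ^ j \<Longrightarrow>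
      av (fst t + 2 * c * snd t) \<le> P ^ k \<Longrightarrow> av (snd t) \<le> P ^ (k + j) \<Longrightarrow>
      g (c, d) (x + t) = e (- (fst t * (c - d) + snd t * (c\<^sup>2 - d\<^sup>2))) * g (c, d) x"
  shows "(\<integral>x. (cmod (\<Sum>p\<in>Pr. g p x))\<^sup>2 \<partial>mu) \<le> P\<^sup>2 * (\<Sum>p\<in>Pr. \<integral>x. (cmod (g p x))\<^sup>2 \<partial>mu)"
proof (rule almost_orthogonal)
  show fin: "finite Pr" using Pr(1) by (rule finite_subset) simp
  show "nice (g p)" if "p \<in> Pr" for p by (rule nice[OF that])
  have lev: "\<exists>j<k. 1 / P ^ Suc j < av (c - d) \<and> av (c - d) \<le> 1 / P ^ j" if cd: "(c, d) \<in> Pr" for c d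
  proof -
    have "c \<in> \<Theta> k" "d \<in> \<Theta> k" "c \<noteq> d" using cd Pr by auto
    then have "av (c - d) \<le> 1" "1 / P ^ k < av (c - d)"
      using av_Theta Theta_unique[of c k d] by (auto intro!: av_diff_leI simp: not_le[symmetric])
    then show ?thesis using ex_level by metis
  qed
  fix p assume p: "p \<in> Pr"
  obtain c d where cd: "p = (c, d)" by fastforce
  let ?S = "{q \<in> Pr. (\<integral>x. g p x * cnj (g q x) \<partial>mu) \<noteq> 0}"
  have near: "av (c - d - c' + d') \<le> 1 / P ^ k \<and> av (c' - c) \<le> P\<^sup>2 / P ^ k" if q: "(c', d') \<in> ?S" for c' d'
  proof -
    have qP: "(c', d') \<in> Pr" and nz: "(\<integral>x. g p x * cnj (g (c', d') x) \<partial>mu) \<noteq> 0" using q by auto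
    obtain j where j: "j < k" "1 / P ^ Suc j < av (c - d)" "av (c - d) \<le> 1 / P ^ j"
      using lev p cd by blast
    obtain j' where j': "1 / P ^ Suc j' < av (c' - d')" "av (c' - d') \<le> 1 / P ^ j'"
      using lev qP by blast
    define y where "y = c - d - c' + d'"
    have y: "av y \<le> 1 / P ^ k"
    proof (rule char_trivial_imp_small, rule ccontr)
      fix t assume t: "av t \<le> P ^ k" "e (t * y) \<noteq> 1"
      have "(\<integral>x. g p x * cnj (g (c', d') x) \<partial>mu) = 0"
        unfolding cd
      proof (rule integral_mult_cnj_eq_0[where t = "(- t, 0)"])
        show "g (c, d) (x + (- t, 0)) = e (t * (c - d)) * g (c, d) x" for x
          using twist[of c d j "(- t, 0)" x] p cd j t by simp
        show "g (c', d') (x + (- t, 0)) = e (t * (c' - d')) * g (c', d') x" for x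
          using twist[of c' d' j' "(- t, 0)" x] qP j' t by simp
        have "t * (c - d) - t * (c' - d') = t * y" by (simp add: y_def algebra_simps)
        then show "e (t * (c - d) - t * (c' - d')) \<noteq> 1" using t by simp
      qed (use nice p qP cd in auto)
      then show False using nz by simp
    qed
    \<comment> \<open>Since \<open>y\<close> is smaller than \<open>c - d\<close>, both differences
      have the same absolute value, so \<open>twist\<close> applies to both pairs with the same
      \<open>j\<close>.\<close>
    have "1 / P ^ k < av (c - d)"
      using j inverse_power_P_antimono[of "Suc j" k] by linarith
    moreover have "c' - d' = (c - d) + - y" by (simp add: y_def)
    ultimately have same: "av (c' - d') = av (c - d)" using y by (simp only: av_minus av_add_eq)
    have "av (c' - c) \<le> P\<^sup>2 / P ^ k"
    proof (rule biorthogonality_arith[OF j(2,1) y[unfolded y_def]], rule ccontr, fold y_def)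
      fix t assume t: "av (2 * (c - c') * t) \<le> P ^ k" "av t \<le> P ^ (k + j)"
        and nt: "e (t * (c\<^sup>2 - d\<^sup>2 - c'\<^sup>2 + d'\<^sup>2 - 2 * c * y)) \<noteq> 1"
      \<comment> \<open>A shift along the long side of the tile of \<open>c\<close>: its transverse
        coordinate is 0 for \<open>c\<close> and \<open>2 * (c - c') * t\<close> for
        \<open>c'\<close>.\<close>
      let ?t = "(2 * c * t, - t)"
      have c't: "fst ?t + 2 * c' * snd ?t = 2 * (c - c') * t" by (simp add: algebra_simps)
      have c't_le: "av (fst ?t + 2 * c' * snd ?t) \<le> P ^ k" unfolding c't by (rule t(1))
      have "(\<integral>x. g p x * cnj (g (c', d') x) \<partial>mu) = 0"
        unfolding cd
      proof (rule integral_mult_cnj_eq_0[where t = ?t])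
        show "g (c, d) (x + ?t) = e (- (fst ?t * (c - d) + snd ?t * (c\<^sup>2 - d\<^sup>2))) * g (c, d) x" for x
          using p cd j t by (intro twist) auto
        show "g (c', d') (x + ?t) = e (- (fst ?t * (c' - d') + snd ?t * (c'\<^sup>2 - d'\<^sup>2))) * g (c', d') x" for x
          by (rule twist[OF qP _ _ c't_le]) (use j t same in simp_all)
        have "- (fst ?t * (c - d) + snd ?t * (c\<^sup>2 - d\<^sup>2)) - - (fst ?t * (c' - d') + snd ?t * (c'\<^sup>2 - d'\<^sup>2))
            = t * (c\<^sup>2 - d\<^sup>2 - c'\<^sup>2 + d'\<^sup>2 - 2 * c * y)"
          by (simp add: y_def algebra_simps)
        then show "e (- (fst ?t * (c - d) + snd ?t * (c\<^sup>2 - d\<^sup>2)) - - (fst ?t * (c' - d') + snd ?t * (c'\<^sup>2 - d'\<^sup>2))) \<noteq> 1"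
          using nt by simp
      qed (use nice p qP cd in auto)
      then show False using nz by simp
    qed
    then show ?thesis using y by (simp add: y_def)
  qed
  have "inj_on fst ?S"
  proof (rule inj_onI)
    fix q q' assume q: "q \<in> ?S" "q' \<in> ?S" "fst q = fst q'"
    obtain c' d' d'' where qq: "q = (c', d')" "q' = (c', d'')" using q(3) by (metis prod.collapse)
    have "av ((c - d - c' + d') - (c - d - c' + d'')) \<le> 1 / P ^ k"
      using near q qq by (intro av_diff_leI) auto
    then have "d' = d''" using q qq Pr(1) by (intro Theta_unique[of d' k d'']) auto
    then show "q = q'" using qq by simp
  qed
  then have "card ?S = card (fst ` ?S)" by (simp add: card_image)
  moreover have "real (card (fst ` ?S)) \<le> P ^ 2"
    using Pr(1) near by (intro card_near_le[of _ k c]) auto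
  ultimately show "real (card ?S) \<le> P\<^sup>2" by simp
qed

subsection \<open>Averages over tiles\<close>

text \<open>This is \<open>tile0\<close> for \<open>s = 1 / P ^ j\<close> and
  \<open>R = P ^ (2 * N)\<close>; \<open>T N c\<close> is the rectangle dual to the cap of radius
  \<open>1 / P ^ N\<close> at \<open>c\<close>.\<close>

definition T :: "nat \<Rightarrow> 'a \<Rightarrow> ('a \<times> 'a) set" where
  "T j c = {t. av (fst t + 2 * c * snd t) \<le> P ^ (2 * N) / P ^ j \<and> av (snd t) \<le> P ^ (2 * N)}"

lemma power_P_2N: "P ^ (2 * N) / P ^ N = P ^ N"
  by (simp add: mult_2 power_add)

lemma T_N: "t \<in> T N c \<longleftrightarrow> av (fst t + 2 * c * snd t) \<le> P ^ N \<and> av (snd t) \<le> P ^ (2 * N)"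
  unfolding T_def power_P_2N by simp

lemma T_mono: "i \<le> j \<Longrightarrow> T j c \<subseteq> T i c"
proof -
  assume "i \<le> j"
  then have "P ^ (2 * N) / P ^ j \<le> P ^ (2 * N) / P ^ i"
    using P_ge_1 by (intro divide_left_mono power_increasing) auto
  then show ?thesis unfolding T_def by auto
qed

lemma T_cong: assumes "av (c - d) \<le> 1 / P ^ j" shows "T j c = T j d"
proof -
  have *: "t \<in> T j d" if "t \<in> T j c" "av (c - d) \<le> 1 / P ^ j" for c d t
  proof -
    have "av (2 * (d - c) * snd t) = av 2 * av (c - d) * av (snd t)"
      unfolding av_mult by (simp add: av_commute[of c d])
    also have "\<dots> \<le> 1 * (1 / P ^ j) * P ^ (2 * N)"
      using that av_2_le_1 by (intro mult_mono) (auto simp: T_def)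
    finally have "av (2 * (d - c) * snd t) \<le> P ^ (2 * N) / P ^ j" by simp
    then have "av ((fst t + 2 * c * snd t) + 2 * (d - c) * snd t) \<le> P ^ (2 * N) / P ^ j"
      by (rule av_add_leI[rotated]) (use that in \<open>simp add: T_def\<close>)
    also have "(fst t + 2 * c * snd t) + 2 * (d - c) * snd t = fst t + 2 * d * snd t"
      by (simp add: algebra_simps)
    finally show ?thesis using that by (auto simp: T_def)
  qed
  show ?thesis using *[OF _ assms] *[of _ d c] assms by (auto simp: av_commute)
qed

lemma T_minus: "t \<in> T j c \<Longrightarrow> - t \<in> T j c"
proof -
  assume "t \<in> T j c"
  moreover have "fst (- t) + 2 * c * snd (- t) = - (fst t + 2 * c * snd t)" by simp
  ultimately show ?thesis unfolding T_def mem_Collect_eq by (metis av_minus snd_uminus)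
qed

lemma T_horizontal: "av h \<le> P ^ (2 * N) / P ^ j \<Longrightarrow> (h, 0) \<in> T j c"
  by (simp add: T_def)

text \<open>For \<open>j \<le> N\<close>: representatives of the horizontal shifts in
  \<open>T j c\<close> modulo those in \<open>T N c\<close>, a scaled transversal.\<close>

definition Y :: "nat \<Rightarrow> 'a set" where
  "Y j = (\<lambda>a. a * (varpi ^ j / varpi ^ (2 * N))) ` \<Theta> (N - j)"

lemma finite_Y [simp]: "finite (Y j)"
  by (simp add: Y_def)

lemma Y_nonempty [simp]: "Y j \<noteq> {}" and card_Y_pos: "0 < card (Y j)"
proof -
  have "\<Theta> (N - j) \<noteq> {}" using Theta_ex[of 0 "N - j"] by auto
  then show "Y j \<noteq> {}" by (simp add: Y_def)
  then show "0 < card (Y j)" by (simp add: card_gt_0_iff)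
qed

lemma av_scale: "av (varpi ^ j / varpi ^ (2 * N)) = P ^ (2 * N) / P ^ j"
  by (simp add: av_divide av_varpi_power)

lemma av_Y: "h \<in> Y j \<Longrightarrow> av h \<le> P ^ (2 * N) / P ^ j"
proof -
  assume "h \<in> Y j"
  then obtain a where a: "a \<in> \<Theta> (N - j)" "h = a * (varpi ^ j / varpi ^ (2 * N))" unfolding Y_def by blast
  have "av h = av a * (P ^ (2 * N) / P ^ j)" unfolding a av_mult av_scale ..
  then show ?thesis using av_Theta[OF a(1)] by (simp add: divide_right_mono mult_left_le_one_le)
qed

lemma Y_scale_iff:
  assumes "j \<le> N"
  shows "av ((a - b) * (varpi ^ j / varpi ^ (2 * N))) \<le> P ^ N \<longleftrightarrow> av (a - b) \<le> 1 / P ^ (N - j)"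
proof -
  have "P ^ (2 * N) = P ^ j * P ^ (N - j) * P ^ N"
    using assms by (simp add: mult_2 power_add[symmetric])
  then have "P ^ (2 * N) / P ^ j = P ^ (N - j) * P ^ N" by simp
  then have "av ((a - b) * (varpi ^ j / varpi ^ (2 * N))) = (av (a - b) * P ^ (N - j)) * P ^ N"
    unfolding av_mult av_scale by simp
  also have "\<dots> \<le> P ^ N \<longleftrightarrow> av (a - b) * P ^ (N - j) \<le> 1" by simp
  finally show ?thesis by (simp add: field_simps)
qed

lemma Y_ex:
  assumes "j \<le> N" "av t \<le> P ^ (2 * N) / P ^ j" shows "\<exists>h\<in>Y j. av (t - h) \<le> P ^ N"
proof -
  let ?s = "varpi ^ j / varpi ^ (2 * N)"
  have "av (t / ?s) \<le> 1" unfolding av_divide[of t] av_scale using assms(2) by (simp add: field_simps)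
  then obtain a where a: "a \<in> \<Theta> (N - j)" "av (t / ?s - a) \<le> 1 / P ^ (N - j)" using Theta_ex by blast
  have "t - a * ?s = (t / ?s - a) * ?s" by (simp add: field_simps)
  then have "av (t - a * ?s) \<le> P ^ N" using Y_scale_iff[OF assms(1), of "t / ?s" a] a(2) by metis
  then show ?thesis using a(1) unfolding Y_def by blast
qed

lemma Y_unique:
  assumes "j \<le> N" "h \<in> Y j" "h' \<in> Y j" "av (h - h') \<le> P ^ N" shows "h = h'"
proof -
  let ?s = "varpi ^ j / varpi ^ (2 * N)"
  obtain a b where ab: "a \<in> \<Theta> (N - j)" "b \<in> \<Theta> (N - j)" "h = a * ?s" "h' = b * ?s"
    using assms(2,3) unfolding Y_def by blast
  have "h - h' = (a - b) * ?s" unfolding ab by (simp only: left_diff_distrib)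
  then have "av (a - b) \<le> 1 / P ^ (N - j)" using Y_scale_iff[OF assms(1), of a b] assms(4) by simp
  then show ?thesis using Theta_unique ab by blast
qed

text \<open>On functions invariant under \<open>T N c\<close> this is the mean over translates of
  \<open>T j c\<close>, as \<open>T j c\<close> is generated by \<open>T N c\<close> and horizontal
  shifts. The formula does not mention \<open>c\<close>, so one operator serves all directions and
  commutes with sums over caps.\<close>

definition E :: "nat \<Rightarrow> ('a \<times> 'a \<Rightarrow> real) \<Rightarrow> 'a \<times> 'a \<Rightarrow> real" where
  "E j g x = (\<Sum>h\<in>Y j. g (x + (h, 0))) / real (card (Y j))"

lemma E_nonneg: "(\<And>x. 0 \<le> g x) \<Longrightarrow> 0 \<le> E j g x"
  unfolding E_def by (intro divide_nonneg_nonneg sum_nonneg) auto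

lemma E_mono: "(\<And>h. h \<in> Y j \<Longrightarrow> f (x + (h, 0)) \<le> g (x + (h, 0))) \<Longrightarrow> E j f x \<le> E j g x"
  unfolding E_def by (intro divide_right_mono sum_mono) auto

lemma E_const_0: "(\<And>h. h \<in> Y j \<Longrightarrow> g (x + (h, 0)) = 0) \<Longrightarrow> E j g x = 0"
  unfolding E_def by simp

lemma E_sum: "E j (\<lambda>x. \<Sum>i\<in>I. g i x) x = (\<Sum>i\<in>I. E j (g i) x)"
  unfolding E_def by (simp add: sum.swap[of _ I] sum_divide_distrib)

lemma nice_E: assumes "nice g" shows "nice (E j g)"
proof -
  have "nice (\<lambda>x. (\<Sum>h\<in>Y j. g (x + (h, 0))) / real (card (Y j)))"
    by (rule nice_comp[where \<phi> = "\<lambda>y. y / real (card (Y j))"]) (intro nice_sum nice_shift assms, simp)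
  then show ?thesis by (simp add: E_def[abs_def])
qed

lemma E_commute_shift: "(\<And>x. g (x + t) = g x) \<Longrightarrow> E j g (x + t) = E j g x"
proof -
  assume g: "\<And>x. g (x + t) = g x"
  have "g (x + t + (h, 0)) = g (x + (h, 0))" for h
    using g[of "x + (h, 0)"] by (simp only: add.assoc add.commute[of t])
  then show ?thesis unfolding E_def by (simp only:)
qed

text \<open>A horizontal shift permutes the representatives in \<open>Y j\<close> up to errors of
  size at most \<open>P ^ N\<close>, which \<open>g\<close> does not notice.\<close>

lemma E_shift:
  assumes j: "j \<le> N" and g: "\<And>h x. av h \<le> P ^ N \<Longrightarrow> g (x + (h, 0)) = g x"
    and h: "av h \<le> P ^ (2 * N) / P ^ j"
  shows "E j g (x + (h, 0)) = E j g x"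
proof -
  have "\<forall>k\<in>Y j. \<exists>k'\<in>Y j. av (h + k - k') \<le> P ^ N"
    using Y_ex[OF j] av_add_leI[OF h av_Y] by blast
  then obtain \<phi> where \<phi>: "\<And>k. k \<in> Y j \<Longrightarrow> \<phi> k \<in> Y j" "\<And>k. k \<in> Y j \<Longrightarrow> av (h + k - \<phi> k) \<le> P ^ N"
    by metis
  have inj: "inj_on \<phi> (Y j)"
  proof (rule inj_onI)
    fix k k' assume k: "k \<in> Y j" "k' \<in> Y j" "\<phi> k = \<phi> k'"
    have "av ((h + k - \<phi> k) - (h + k' - \<phi> k')) \<le> P ^ N"
      using \<phi>(2)[OF k(1)] \<phi>(2)[OF k(2)] by (rule av_diff_leI)
    then show "k = k'" using Y_unique[OF j k(1,2)] k(3) by simp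
  qed
  then have "\<phi> ` Y j = Y j" using \<phi>(1) by (simp add: endo_inj_surj image_subset_iff)
  then have bij: "bij_betw \<phi> (Y j) (Y j)" using inj by (simp add: bij_betw_def)
  have "(\<Sum>k\<in>Y j. g (x + (h, 0) + (k, 0))) = (\<Sum>k\<in>Y j. g (x + (\<phi> k, 0)))"
  proof (rule sum.cong[OF refl])
    fix k assume "k \<in> Y j"
    have "x + (h, 0) + (k, 0) = (x + (\<phi> k, 0)) + (h + k - \<phi> k, 0)" by (simp add: prod_eq_iff)
    then show "g (x + (h, 0) + (k, 0)) = g (x + (\<phi> k, 0))" using g \<phi>(2)[OF \<open>k \<in> Y j\<close>] by metis
  qed
  also have "\<dots> = (\<Sum>k\<in>Y j. g (x + (k, 0)))" by (rule sum.reindex_bij_betw[OF bij])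
  finally show ?thesis unfolding E_def by simp
qed

lemma E_T_invariant:
  assumes j: "j \<le> N" and g: "\<And>t x. t \<in> T N c \<Longrightarrow> g (x + t) = g x" and t: "t \<in> T j c"
  shows "E j g (x + t) = E j g x"
proof -
  \<comment> \<open>Split \<open>t\<close> into a vector \<open>?a\<close> along the long side,
    which already lies in the small tile, and the horizontal vector \<open>(?h, 0)\<close>.\<close>
  let ?a = "(- (2 * c * snd t), snd t)" and ?h = "fst t + 2 * c * snd t"
  have "?a \<in> T N c" using t by (simp add: T_N T_def)
  then have 1: "E j g (y + ?a) = E j g y" for y using g by (intro E_commute_shift)
  have 2: "E j g (y + (?h, 0)) = E j g y" for y
  proof (rule E_shift[OF j])
    show "g (x + (h, 0)) = g x" if "av h \<le> P ^ N" for h x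
      using g[OF T_horizontal] that by (simp add: power_P_2N)
    show "av ?h \<le> P ^ (2 * N) / P ^ j" using t by (simp add: T_def)
  qed
  have "x + t = (x + (?h, 0)) + ?a" by (simp add: prod_eq_iff)
  then show ?thesis by (simp only: 1 2)
qed

lemma E_N:
  assumes "\<And>t x. t \<in> T N c \<Longrightarrow> g (x + t) = g x" shows "E N g x = g x"
proof -
  have "g (x + (h, 0)) = g x" if "h \<in> Y N" for h
    using assms[OF T_horizontal] av_Y[OF that] by blast
  then have "E N g x = (\<Sum>h\<in>Y N. g x) / real (card (Y N))" unfolding E_def by (metis (no_types, lifting) sum.cong)
  then show ?thesis using card_Y_pos[of N] by simp
qed

lemma integral_E_square_le:
  assumes "nice g" shows "(\<integral>x. (E j g x)\<^sup>2 \<partial>mu) \<le> (\<integral>x. (g x)\<^sup>2 \<partial>mu)"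
proof -
  let ?n = "real (card (Y j))"
  have n: "0 < ?n" using card_Y_pos by simp
  have "(E j g x)\<^sup>2 \<le> 1 / ?n * (\<Sum>h\<in>Y j. (g (x + (h, 0)))\<^sup>2)" for x
  proof -
    have "(\<Sum>h\<in>Y j. g (x + (h, 0)))\<^sup>2 \<le> ?n * (\<Sum>h\<in>Y j. (g (x + (h, 0)))\<^sup>2)"
      using sum_squared_le_sum_of_squares[of "\<lambda>h. g (x + (h, 0))" "Y j"] by (simp add: mult.commute)
    then show ?thesis using n unfolding E_def power_divide by (simp add: field_simps power2_eq_square)
  qed
  then have "(\<integral>x. (E j g x)\<^sup>2 \<partial>mu) \<le> (\<integral>x. 1 / ?n * (\<Sum>h\<in>Y j. (g (x + (h, 0)))\<^sup>2) \<partial>mu)"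
    by (intro nice_integral_mono nice_power2 nice_E nice_cmult nice_sum nice_shift[of "\<lambda>x. (g x)\<^sup>2"] assms)
  also have "\<dots> = 1 / ?n * (\<Sum>h\<in>Y j. \<integral>x. (g (x + (h, 0)))\<^sup>2 \<partial>mu)"
    unfolding integral_mult_right_zero
    by (subst nice_integral_sum) (intro nice_shift[of "\<lambda>x. (g x)\<^sup>2"] nice_power2 assms, simp)
  also have "\<dots> = 1 / ?n * (\<Sum>h\<in>Y j. \<integral>x. (g x)\<^sup>2 \<partial>mu)"
    using nice_integral_shift[OF nice_power2[OF assms]] by simp
  also have "\<dots> = (\<integral>x. (g x)\<^sup>2 \<partial>mu)" using n by simp
  finally show ?thesis .
qed

text \<open>Two tile-invariant functions with different directions: moving along the tile of one
  moves the other horizontally, so horizontal shifts do not change the integral of the product.\<close>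

lemma integral_horizontal_shift:
  assumes nice: "nice u" "nice v"
    and inv: "\<And>t x. t \<in> T N c \<Longrightarrow> u (x + t) = u x" "\<And>t x. t \<in> T N d \<Longrightarrow> v (x + t) = v x"
    and h: "av h \<le> av 2 * av (c - d) * P ^ (2 * N)"
  shows "(\<integral>x. u (x + (h, 0)) * v x \<partial>mu) = (\<integral>x. u x * (v x :: real) \<partial>mu)"
proof (cases "c = d")
  case True
  then have "av h = 0" using h av_nonneg[of h] by simp
  then have "(h, 0) = (0 :: 'a \<times> 'a)" by (simp add: zero_prod_def)
  then show ?thesis by simp
next
  case False
  define s where "s = h / (2 * (c - d))"
  have s: "av s \<le> P ^ (2 * N)"
  proof -
    have "0 < av 2 * av (c - d)" using False two_nonzero by (simp add: av_pos_iff)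
    then show ?thesis unfolding s_def av_divide av_mult using h by (simp add: field_simps)
  qed
  have h': "h = 2 * c * s - 2 * d * s"
  proof -
    have "2 * c * s - 2 * d * s = 2 * (c - d) * s" by (simp only: left_diff_distrib right_diff_distrib)
    also have "\<dots> = h" unfolding s_def using False two_nonzero by simp
    finally show ?thesis ..
  qed
  let ?a = "(- (2 * c * s), s)" and ?b = "(- (2 * d * s), s)"
  have a: "?a \<in> T N c" "?b \<in> T N d" using s by (simp_all add: T_N)
  have "(\<integral>x. u x * v x \<partial>mu) = (\<integral>x. u (x + ?b) * v (x + ?b) \<partial>mu)"
    by (rule nice_integral_shift[symmetric]) (intro nice_mult_nice nice)
  also have "\<dots> = (\<integral>x. u (x + (h, 0)) * v x \<partial>mu)"
  proof -
    have "x + ?b = (x + (h, 0)) + ?a" for x by (simp add: prod_eq_iff h')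
    then have "u (x + ?b) = u (x + (h, 0))" for x using inv(1)[OF a(1)] by metis
    then show ?thesis using inv(2)[OF a(2)] by simp
  qed
  finally show ?thesis ..
qed

lemma integral_horizontal_shift2:
  assumes nice: "nice u" "nice v"
    and inv: "\<And>t x. t \<in> T N c \<Longrightarrow> u (x + t) = u x" "\<And>t x. t \<in> T N d \<Longrightarrow> v (x + t) = v x"
    and h: "av h \<le> av 2 * av (c - d) * P ^ (2 * N)" "av h' \<le> av 2 * av (c - d) * P ^ (2 * N)"
  shows "(\<integral>x. u (x + (h, 0)) * v (x + (h', 0)) \<partial>mu) = (\<integral>x. u x * (v x :: real) \<partial>mu)"
proof -
  have "(\<integral>x. u (x + (h, 0)) * v (x + (h', 0)) \<partial>mu)
      = (\<integral>x. u (x + (- h', 0) + (h, 0)) * v (x + (- h', 0) + (h', 0)) \<partial>mu)"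
    by (rule nice_integral_shift[symmetric]) (intro nice_mult_nice nice_shift nice)
  also have "\<dots> = (\<integral>x. u (x + (h - h', 0)) * v x \<partial>mu)"
  proof -
    have "x + (- h', 0) + (h, 0) = x + (h - h', 0)" "x + (- h', 0) + (h', 0) = x" for x :: "'a \<times> 'a"
      by (simp_all add: prod_eq_iff)
    then show ?thesis by (simp only:)
  qed
  also have "\<dots> = (\<integral>x. u x * v x \<partial>mu)"
    using h by (intro integral_horizontal_shift[OF nice inv] av_diff_leI)
  finally show ?thesis .
qed

text \<open>All shifts in \<open>Y j\<close> fall in the range allowed by
  \<open>integral_horizontal_shift2\<close> once the directions are separated at level
  \<open>j\<close>, the factor \<open>av 2\<close> included. Averaging one or both functions then
  leaves their overlap unchanged.\<close>

lemma integral_E_far: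
  assumes nice: "nice u" "nice v"
    and inv: "\<And>t x. t \<in> T N c \<Longrightarrow> u (x + t) = u x" "\<And>t x. t \<in> T N d \<Longrightarrow> v (x + t) = v x"
    and far: "1 / P ^ j \<le> av 2 * av (c - d)"
  shows "(\<integral>x. E j u x * E j v x \<partial>mu) = (\<integral>x. u x * v x \<partial>mu)"
    and "(\<integral>x. u x * E j v x \<partial>mu) = (\<integral>x. u x * v x \<partial>mu)"
    and "(\<integral>x. E j u x * v x \<partial>mu) = (\<integral>x. u x * v x \<partial>mu)"
proof -
  let ?n = "real (card (Y j))"
  have n: "0 < ?n" using card_Y_pos by simp
  have le: "av h \<le> av 2 * av (c - d) * P ^ (2 * N)" if "h \<in> Y j \<or> h = 0" for h
  proof -
    have "P ^ (2 * N) / P ^ j \<le> av 2 * av (c - d) * P ^ (2 * N)"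
      using mult_right_mono[OF far, of "P ^ (2 * N)"] by simp
    then show ?thesis using that av_Y[of h j] by auto
  qed
  note sh = integral_horizontal_shift2[OF nice inv le le]
  have sh1: "(\<integral>x. u (x + (h, 0)) * v x \<partial>mu) = (\<integral>x. u x * v x \<partial>mu)" if "h \<in> Y j" for h
    using sh[of h 0] that by (simp add: zero_prod_def[symmetric])
  have sh2: "(\<integral>x. u x * v (x + (h, 0)) \<partial>mu) = (\<integral>x. u x * v x \<partial>mu)" if "h \<in> Y j" for h
    using sh[of 0 h] that by (simp add: zero_prod_def[symmetric])
  have "(\<integral>x. E j u x * E j v x \<partial>mu)
      = (\<integral>x. (\<Sum>h\<in>Y j. u (x + (h, 0))) * (\<Sum>h\<in>Y j. v (x + (h, 0))) \<partial>mu) / (?n * ?n)"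
    unfolding E_def by simp
  also have "\<dots> = (\<Sum>h\<in>Y j. \<Sum>h'\<in>Y j. \<integral>x. u (x + (h, 0)) * v (x + (h', 0)) \<partial>mu) / (?n * ?n)"
    by (subst nice_sum_mult_sum_integral) (intro nice_shift nice | simp)+
  also have "\<dots> = (\<Sum>h\<in>Y j. \<Sum>h'\<in>Y j. \<integral>x. u x * v x \<partial>mu) / (?n * ?n)"
    using sh by (intro arg_cong2[where f = "(/)"] sum.cong refl) auto
  finally show "(\<integral>x. E j u x * E j v x \<partial>mu) = (\<integral>x. u x * v x \<partial>mu)" using n by simp
  have "(\<integral>x. u x * E j v x \<partial>mu) = (\<integral>x. (\<Sum>i\<in>{0::nat}. u x) * (\<Sum>h\<in>Y j. v (x + (h, 0))) \<partial>mu) / ?n"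
    unfolding E_def by simp
  also have "\<dots> = (\<Sum>h\<in>Y j. \<integral>x. u x * v (x + (h, 0)) \<partial>mu) / ?n"
    by (subst nice_sum_mult_sum_integral) (intro nice_shift nice | simp)+
  also have "\<dots> = (\<Sum>h\<in>Y j. \<integral>x. u x * v x \<partial>mu) / ?n" using sh2 by simp
  finally show "(\<integral>x. u x * E j v x \<partial>mu) = (\<integral>x. u x * v x \<partial>mu)" using n by simp
  have "(\<integral>x. E j u x * v x \<partial>mu) = (\<integral>x. (\<Sum>h\<in>Y j. u (x + (h, 0))) * (\<Sum>i\<in>{0::nat}. v x) \<partial>mu) / ?n"
    unfolding E_def by simp
  also have "\<dots> = (\<Sum>h\<in>Y j. \<integral>x. u (x + (h, 0)) * v x \<partial>mu) / ?n"
    by (subst nice_sum_mult_sum_integral) (intro nice_shift nice | simp)+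
  also have "\<dots> = (\<Sum>h\<in>Y j. \<integral>x. u x * v x \<partial>mu) / ?n" using sh1 by simp
  finally show "(\<integral>x. E j u x * v x \<partial>mu) = (\<integral>x. u x * v x \<partial>mu)" using n by simp
qed

end

section \<open>Second moments of sums of tile-invariant weights\<close>

locale weights = scales +
  fixes w :: "'a \<Rightarrow> 'a \<times> 'a \<Rightarrow> real"
  assumes nice_w: "\<And>c. c \<in> \<Theta> N \<Longrightarrow> nice (w c)" and w_nonneg: "\<And>c x. 0 \<le> w c x"
    and w_invariant: "\<And>c t x. c \<in> \<Theta> N \<Longrightarrow> t \<in> T N c \<Longrightarrow> w c (x + t) = w c x"
begin

lemma nice_w_cl: "c \<in> cl N k a \<Longrightarrow> nice (w c)"
  by (intro nice_w cl_subset)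

text \<open>\<open>j\<close> is the coarsest level from \<open>i0\<close> on at which the overlap is
  known to survive averaging; at level \<open>N\<close> averaging does nothing. Minimality makes the
  directions neighbours at level \<open>j\<close>, with one factor \<open>P\<close> lost to the
  level step and one to \<open>av 2\<close>.\<close>

lemma pair_level:
  assumes "i0 \<le> N" "c \<in> cl N i0 a" "d \<in> cl N i0 a"
  obtains j where "i0 \<le> j" "j \<le> N" "av (c - d) \<le> P\<^sup>2 / P ^ j"
    "(\<integral>x. w c x * w d x \<partial>mu) = (\<integral>x. E j (w c) x * E j (w d) x \<partial>mu)"
proof -
  let ?Q = "\<lambda>j. i0 \<le> j \<and> (j = N \<or> 1 / P ^ j \<le> av 2 * av (c - d))"
  define j where "j = (LEAST j. ?Q j)"
  have j: "?Q j" unfolding j_def using assms(1) by (intro LeastI[of ?Q N]) auto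
  have jN: "j \<le> N" unfolding j_def using assms(1) by (intro Least_le) auto
  have P2: "1 / P ^ j \<le> P\<^sup>2 / P ^ j" using P_ge_1 by (intro divide_right_mono) auto
  have near: "av (c - d) \<le> P\<^sup>2 / P ^ j"
  proof (cases "j = i0")
    case True
    have "av (c - d) \<le> 1 / P ^ i0"
      using assms(2,3) av_diff_trans[of c a _ d] av_commute[of a d] by (auto simp: cl_def)
    then show ?thesis using True P2 by simp
  next
    case False
    then obtain i where i: "j = Suc i" "i0 \<le> i" using j by (cases j) auto
    have "\<not> ?Q i" using not_less_Least[of i ?Q] i unfolding j_def[symmetric] by simp
    then have "av 2 * av (c - d) < 1 / P ^ i" using i by auto
    moreover have "1 / P * av (c - d) \<le> av 2 * av (c - d)" using av_2_ge by (intro mult_right_mono) auto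
    ultimately have "1 / P * av (c - d) < P * (1 / P ^ j)" using i by simp
    then have "av (c - d) < P * (P * (1 / P ^ j))" by (simp add: field_simps)
    then show ?thesis by (simp add: power2_eq_square)
  qed
  have cN: "c \<in> \<Theta> N" "d \<in> \<Theta> N" using assms cl_subset by auto
  have "(\<integral>x. w c x * w d x \<partial>mu) = (\<integral>x. E j (w c) x * E j (w d) x \<partial>mu)"
  proof (cases "j = N")
    case True
    have "E N (w c) x = w c x" "E N (w d) x = w d x" for x
      using E_N[of c "w c"] E_N[of d "w d"] w_invariant cN by auto
    then show ?thesis using True by simp
  next
    case False
    then show ?thesis using j cN by (intro integral_E_far(1)[of _ _ c d, symmetric] nice_w w_invariant) auto
  qed
  then show ?thesis using that[of j] j jN near by auto
qed

definition W :: "nat \<Rightarrow> 'a \<Rightarrow> 'a \<times> 'a \<Rightarrow> real" where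
  "W j b x = E j (\<lambda>y. \<Sum>c\<in>cl N j b. w c y) x"

lemma W_eq: "W j b x = (\<Sum>c\<in>cl N j b. E j (w c) x)"
  unfolding W_def by (rule E_sum)

lemma nice_W: "nice (W j b)"
  unfolding W_def[abs_def] by (intro nice_E nice_sum nice_w_cl)

lemma E_w_nonneg: "0 \<le> E j (w c) x"
  by (intro E_nonneg w_nonneg)

text \<open>A Kakeya-type estimate: each pairwise overlap is charged to the level found by
  \<open>pair_level\<close>. There the averaged weights are grouped by arcs, each arc has at most
  \<open>P\<^sup>2\<close> neighbours, and the Schur test leaves the diagonal.\<close>

lemma square_sum_w_le:
  assumes "i0 \<le> N"
  shows "(\<integral>x. (\<Sum>c\<in>cl N i0 a. w c x)\<^sup>2 \<partial>mu) \<le> P\<^sup>2 * (\<Sum>j\<in>{i0..N}. \<Sum>b\<in>cl j i0 a. \<integral>x. (W j b x)\<^sup>2 \<partial>mu)"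
proof -
  let ?I = "\<lambda>j c d. \<integral>x. E j (w c) x * E j (w d) x \<partial>mu"
  let ?near = "\<lambda>j c d. av (c - d) \<le> P\<^sup>2 / P ^ j"
  have I_nonneg: "0 \<le> ?I j c d" for j c d
    by (intro integral_nonneg_AE AE_I2 mult_nonneg_nonneg E_w_nonneg)
  have "(\<integral>x. (\<Sum>c\<in>cl N i0 a. w c x)\<^sup>2 \<partial>mu) = (\<Sum>c\<in>cl N i0 a. \<Sum>d\<in>cl N i0 a. \<integral>x. w c x * w d x \<partial>mu)"
    unfolding power2_eq_square by (intro nice_sum_mult_sum_integral nice_w_cl)
  \<comment> \<open>A single level suffices for each pair; adding the other non-negative terms makes
    the level independent of the pair, so the sums can be interchanged.\<close>
  also have "\<dots> \<le> (\<Sum>c\<in>cl N i0 a. \<Sum>d\<in>cl N i0 a. \<Sum>j\<in>{i0..N}. if ?near j c d then ?I j c d else 0)"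
  proof (intro sum_mono)
    fix c d assume cd: "c \<in> cl N i0 a" "d \<in> cl N i0 a"
    obtain j where j: "i0 \<le> j" "j \<le> N" "?near j c d" "(\<integral>x. w c x * w d x \<partial>mu) = ?I j c d"
      using pair_level[OF assms cd] .
    then have "(\<integral>x. w c x * w d x \<partial>mu) = (if ?near j c d then ?I j c d else 0)" by simp
    also have "\<dots> \<le> (\<Sum>j\<in>{i0..N}. if ?near j c d then ?I j c d else 0)"
      using j I_nonneg by (intro member_le_sum) auto
    finally show "(\<integral>x. w c x * w d x \<partial>mu) \<le> (\<Sum>j\<in>{i0..N}. if ?near j c d then ?I j c d else 0)" .
  qed
  also have "\<dots> = (\<Sum>j\<in>{i0..N}. \<Sum>c\<in>cl N i0 a. \<Sum>d\<in>cl N i0 a. if ?near j c d then ?I j c d else 0)"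
    by (simp add: sum.swap[of _ "{i0..N}"])
  also have "\<dots> \<le> (\<Sum>j\<in>{i0..N}. P\<^sup>2 * (\<Sum>b\<in>cl j i0 a. \<integral>x. (W j b x)\<^sup>2 \<partial>mu))"
  proof (intro sum_mono)
    fix j assume j: "j \<in> {i0..N}"
    have ij: "i0 \<le> j" using j by simp
    let ?B = "cl j i0 a"
    let ?nb = "\<lambda>b b'. av (b - b') \<le> P\<^sup>2 / P ^ j"
    have P2: "1 / P ^ j \<le> P\<^sup>2 / P ^ j" using P_ge_1 by (intro divide_right_mono) auto
    have "(\<Sum>c\<in>cl N i0 a. \<Sum>d\<in>cl N i0 a. if ?near j c d then ?I j c d else 0)
        = (\<Sum>b\<in>?B. \<Sum>c\<in>cl N j b. \<Sum>b'\<in>?B. \<Sum>d\<in>cl N j b'. if ?near j c d then ?I j c d else 0)"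
      unfolding sum_cl_regroup[OF ij, of _ N a] ..
    also have "\<dots> = (\<Sum>b\<in>?B. \<Sum>b'\<in>?B. \<Sum>c\<in>cl N j b. \<Sum>d\<in>cl N j b'. if ?near j c d then ?I j c d else 0)"
      by (intro sum.cong refl sum.swap)
    also have "\<dots> \<le> (\<Sum>b\<in>?B. \<Sum>b'\<in>?B. if ?nb b b' then (\<integral>x. W j b x * W j b' x \<partial>mu) else 0)"
    proof (intro sum_mono)
      fix b b' assume "b \<in> ?B" "b' \<in> ?B"
      show "(\<Sum>c\<in>cl N j b. \<Sum>d\<in>cl N j b'. if ?near j c d then ?I j c d else 0)
          \<le> (if ?nb b b' then (\<integral>x. W j b x * W j b' x \<partial>mu) else 0)"
      proof (cases "?nb b b'")
        case True
        have "(\<Sum>c\<in>cl N j b. \<Sum>d\<in>cl N j b'. if ?near j c d then ?I j c d else 0)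
            \<le> (\<Sum>c\<in>cl N j b. \<Sum>d\<in>cl N j b'. ?I j c d)"
          using I_nonneg by (intro sum_mono) auto
        also have "\<dots> = (\<integral>x. W j b x * W j b' x \<partial>mu)"
          unfolding W_eq by (rule nice_sum_mult_sum_integral[symmetric]) (rule nice_E, erule nice_w_cl)+
        finally show ?thesis using True by simp
      next
        case False
        have "\<not> ?near j c d" if "c \<in> cl N j b" "d \<in> cl N j b'" for c d
        proof
          assume n: "?near j c d"
          have "av (b - c) \<le> P\<^sup>2 / P ^ j" "av (d - b') \<le> P\<^sup>2 / P ^ j"
            using that P2 av_commute[of b c] by (auto simp: cl_def)
          then have "?nb b b'" using n av_diff_trans by blast
          then show False using False by simp
        qed
        then show ?thesis using False by (simp add: sum.neutral)
      qed
    qed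
    also have "\<dots> = (\<Sum>b\<in>?B. \<Sum>b'\<in>{b'\<in>?B. ?nb b b'}. \<integral>x. W j b x * W j b' x \<partial>mu)"
      by (simp add: sum.inter_filter)
    also have "\<dots> \<le> P\<^sup>2 * (\<Sum>b\<in>?B. \<integral>x. (W j b x)\<^sup>2 \<partial>mu)"
    proof (rule schur_test)
      show "real (card {b' \<in> ?B. ?nb b b'}) \<le> P\<^sup>2" for b
        by (rule card_near_le[of _ j b]) (auto simp: cl_def av_commute)
      show "(\<integral>x. W j b x * W j b' x \<partial>mu) \<le> ((\<integral>x. (W j b x)\<^sup>2 \<partial>mu) + (\<integral>x. (W j b' x)\<^sup>2 \<partial>mu)) / 2" for b b'
        by (intro integral_mult_le_half_squares nice_W)
    qed (auto simp: av_commute)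
    finally show "(\<Sum>c\<in>cl N i0 a. \<Sum>d\<in>cl N i0 a. if ?near j c d then ?I j c d else 0)
        \<le> P\<^sup>2 * (\<Sum>b\<in>?B. \<integral>x. (W j b x)\<^sup>2 \<partial>mu)" .
  qed
  finally show ?thesis by (simp add: sum_distrib_left)
qed

text \<open>For directions separated at level \<open>k\<close>, the four integrals in the expanded
  product agree by \<open>integral_E_far\<close> and cancel. So deviations belonging to different
  arcs are orthogonal unless the arcs are within \<open>P / P ^ k\<close>, which leaves at most
  \<open>P\<close> neighbours.\<close>

lemma square_sum_w_minus_E_le:
  assumes "r \<le> k" "k \<le> N"
  shows "(\<integral>x. (\<Sum>c\<in>cl N r a. w c x - E k (w c) x)\<^sup>2 \<partial>mu)
    \<le> P * (\<Sum>b\<in>cl k r a. 2 * (\<integral>x. (\<Sum>c\<in>cl N k b. w c x)\<^sup>2 \<partial>mu))"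
proof -
  define g where "g b x = (\<Sum>c\<in>cl N k b. w c x - E k (w c) x)" for b x
  have nd: "nice (\<lambda>x. w c x - E k (w c) x)" if "c \<in> \<Theta> N" for c
    using that by (intro nice_diff nice_E nice_w)
  have ng: "nice (g b)" for b unfolding g_def[abs_def] by (intro nice_sum nd cl_subset)
  have far: "(\<integral>x. g b x * g b' x \<partial>mu) = 0" if b: "\<not> av (b - b') \<le> P / P ^ k" for b b'
  proof -
    have "(\<integral>x. (w c x - E k (w c) x) * (w d x - E k (w d) x) \<partial>mu) = 0"
      if cd: "c \<in> cl N k b" "d \<in> cl N k b'" for c d
    proof -
      have cN: "c \<in> \<Theta> N" "d \<in> \<Theta> N" using cd cl_subset by auto
      have "1 / P ^ k \<le> av 2 * av (c - d)"
      proof (rule ccontr)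
        assume "\<not> 1 / P ^ k \<le> av 2 * av (c - d)"
        moreover have "1 / P * av (c - d) \<le> av 2 * av (c - d)" using av_2_ge by (intro mult_right_mono) auto
        ultimately have "1 / P * av (c - d) \<le> 1 / P ^ k" by linarith
        then have 1: "av (c - d) \<le> P / P ^ k" by (simp add: field_simps)
        have "1 / P ^ k \<le> P / P ^ k" using P_ge_1 by (intro divide_right_mono) auto
        then have "av (b - c) \<le> P / P ^ k" "av (d - b') \<le> P / P ^ k"
          using cd av_commute[of b c] by (auto simp: cl_def)
        then show False using 1 b av_diff_trans by blast
      qed
      note fars = integral_E_far[OF nice_w[OF cN(1)] nice_w[OF cN(2)] w_invariant[OF cN(1)] w_invariant[OF cN(2)] this]
      have "(\<integral>x. (w c x - E k (w c) x) * (w d x - E k (w d) x) \<partial>mu)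
          = (\<integral>x. (w c x * w d x - w c x * E k (w d) x) - (E k (w c) x * w d x - E k (w c) x * E k (w d) x) \<partial>mu)"
        by (simp add: algebra_simps)
      also have "\<dots> = (\<integral>x. w c x * w d x \<partial>mu) - (\<integral>x. w c x * E k (w d) x \<partial>mu)
          - ((\<integral>x. E k (w c) x * w d x \<partial>mu) - (\<integral>x. E k (w c) x * E k (w d) x \<partial>mu))"
        using cN by (simp add: nice_integral_diff nice_diff nice_mult_nice nice_w nice_E)
      also have "\<dots> = 0" using fars by simp
      finally show ?thesis .
    qed
    then show ?thesis
      unfolding g_def by (subst nice_sum_mult_sum_integral) (auto intro: nd cl_subset)
  qed
  have "(\<integral>x. (\<Sum>c\<in>cl N r a. w c x - E k (w c) x)\<^sup>2 \<partial>mu) = (\<integral>x. (\<Sum>b\<in>cl k r a. g b x) * (\<Sum>b\<in>cl k r a. g b x) \<partial>mu)"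
    unfolding g_def sum_cl_regroup[OF assms(1), of _ N a] power2_eq_square ..
  also have "\<dots> = (\<Sum>b\<in>cl k r a. \<Sum>b'\<in>cl k r a. \<integral>x. g b x * g b' x \<partial>mu)"
    by (intro nice_sum_mult_sum_integral ng)
  also have "\<dots> = (\<Sum>b\<in>cl k r a. \<Sum>b'\<in>{b'\<in>cl k r a. av (b - b') \<le> P / P ^ k}. \<integral>x. g b x * g b' x \<partial>mu)"
    using far by (intro sum.cong refl sum.mono_neutral_right) auto
  also have "\<dots> \<le> P * (\<Sum>b\<in>cl k r a. \<integral>x. (g b x)\<^sup>2 \<partial>mu)"
  proof (rule schur_test)
    show "real (card {b' \<in> cl k r a. av (b - b') \<le> P / P ^ k}) \<le> P" for b
      using card_near_le[of "{b' \<in> cl k r a. av (b - b') \<le> P / P ^ k}" k b 1] by (auto simp: cl_def av_commute)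
    show "(\<integral>x. g b x * g b' x \<partial>mu) \<le> ((\<integral>x. (g b x)\<^sup>2 \<partial>mu) + (\<integral>x. (g b' x)\<^sup>2 \<partial>mu)) / 2" for b b'
      by (intro integral_mult_le_half_squares ng)
  qed (auto simp: av_commute)
  also have "\<dots> \<le> P * (\<Sum>b\<in>cl k r a. 2 * (\<integral>x. (\<Sum>c\<in>cl N k b. w c x)\<^sup>2 \<partial>mu))"
  proof (intro mult_left_mono sum_mono)
    fix b
    define s where "s x = (\<Sum>c\<in>cl N k b. w c x)" for x
    have ns: "nice s" unfolding s_def[abs_def] by (intro nice_sum nice_w_cl)
    have s0: "0 \<le> s x" for x unfolding s_def by (intro sum_nonneg w_nonneg)
    have gs: "g b x = s x - E k s x" for x
      unfolding g_def s_def[abs_def] by (simp add: E_sum sum_subtractf)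
    have "(\<integral>x. (g b x)\<^sup>2 \<partial>mu) \<le> (\<integral>x. (s x)\<^sup>2 + (E k s x)\<^sup>2 \<partial>mu)"
    proof (rule nice_integral_mono)
      fix x
      \<comment> \<open>The sum and its average are non-negative, so the cross term of the square
        may be dropped.\<close>
      have "0 \<le> s x * E k s x" using s0 E_nonneg[of s] by (intro mult_nonneg_nonneg) auto
      then show "(g b x)\<^sup>2 \<le> (s x)\<^sup>2 + (E k s x)\<^sup>2" unfolding gs by (simp add: power2_diff)
    qed (intro nice_power2 nice_add nice_E ng ns)+
    also have "\<dots> = (\<integral>x. (s x)\<^sup>2 \<partial>mu) + (\<integral>x. (E k s x)\<^sup>2 \<partial>mu)"
      by (intro nice_integral_add nice_power2 nice_E ns)
    also have "\<dots> \<le> 2 * (\<integral>x. (s x)\<^sup>2 \<partial>mu)" using integral_E_square_le[OF ns, of k] by simp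
    finally show "(\<integral>x. (g b x)\<^sup>2 \<partial>mu) \<le> 2 * (\<integral>x. (\<Sum>c\<in>cl N k b. w c x)\<^sup>2 \<partial>mu)" by (simp add: s_def)
  qed simp
  finally show ?thesis .
qed

text \<open>Cauchy-Schwarz over the at most \<open>P\<close> children. It is needed for the part
  that is bad at level \<open>k\<close>, whose control by good tiles begins only at level
  \<open>Suc k\<close>.\<close>

lemma square_sum_w_children_le:
  "(\<integral>x. (\<Sum>c\<in>cl N k b. w c x)\<^sup>2 \<partial>mu) \<le> P * (\<Sum>b'\<in>cl (Suc k) k b. \<integral>x. (\<Sum>c\<in>cl N (Suc k) b'. w c x)\<^sup>2 \<partial>mu)"
proof -
  define s where "s b' x = (\<Sum>c\<in>cl N (Suc k) b'. w c x)" for b' x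
  have ns: "nice (s b')" for b' unfolding s_def[abs_def] by (intro nice_sum nice_w_cl)
  have "(\<integral>x. (\<Sum>c\<in>cl N k b. w c x)\<^sup>2 \<partial>mu) = (\<integral>x. (\<Sum>b'\<in>cl (Suc k) k b. s b' x)\<^sup>2 \<partial>mu)"
    unfolding s_def by (subst sum_cl_regroup[of k "Suc k"]) simp_all
  also have "\<dots> \<le> (\<integral>x. P * (\<Sum>b'\<in>cl (Suc k) k b. (s b' x)\<^sup>2) \<partial>mu)"
  proof (rule nice_integral_mono)
    fix x
    have "(\<Sum>b'\<in>cl (Suc k) k b. s b' x)\<^sup>2 \<le> real (card (cl (Suc k) k b)) * (\<Sum>b'\<in>cl (Suc k) k b. (s b' x)\<^sup>2)"
      using sum_squared_le_sum_of_squares[of "\<lambda>b'. s b' x" "cl (Suc k) k b"] by (simp add: mult.commute)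
    also have "\<dots> \<le> P * (\<Sum>b'\<in>cl (Suc k) k b. (s b' x)\<^sup>2)"
      by (intro mult_right_mono card_children_le sum_nonneg) auto
    finally show "(\<Sum>b'\<in>cl (Suc k) k b. s b' x)\<^sup>2 \<le> P * (\<Sum>b'\<in>cl (Suc k) k b. (s b' x)\<^sup>2)" .
  qed (intro nice_power2 nice_cmult nice_sum ns)+
  also have "\<dots> = P * (\<Sum>b'\<in>cl (Suc k) k b. \<integral>x. (s b' x)\<^sup>2 \<partial>mu)"
    by (simp add: nice_integral_sum nice_power2 ns)
  finally show ?thesis unfolding s_def .
qed

end

subsection \<open>High frequencies and the local bilinear estimate\<close>

text \<open>Stated without reference to \<open>f\<close>, so that it can be instantiated with the
  projections and again with each cut piece.\<close>

locale equivariant_family = scales +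
  fixes B :: "'a \<Rightarrow> 'a \<times> 'a \<Rightarrow> complex"
  assumes nice_B: "\<And>c. c \<in> \<Theta> N \<Longrightarrow> nice (B c)"
    and B_twist: "\<And>c t x. c \<in> \<Theta> N \<Longrightarrow> t \<in> T N c \<Longrightarrow> B c (x + t) = e (- (fst t * c + snd t * c\<^sup>2)) * B c x"
begin

abbreviation w :: "'a \<Rightarrow> 'a \<times> 'a \<Rightarrow> real" where "w c x \<equiv> (cmod (B c x))\<^sup>2"

sublocale weights av \<pi> e mu N \<Theta> "\<lambda>c x. (cmod (B c x))\<^sup>2"
proof unfold_locales
  show "nice (\<lambda>x. (cmod (B c x))\<^sup>2)" if "c \<in> \<Theta> N" for c
    using that by (intro nice_cmod_power2 nice_B)
  show "(cmod (B c (x + t)))\<^sup>2 = (cmod (B c x))\<^sup>2" if "c \<in> \<Theta> N" "t \<in> T N c" for c t x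
    using B_twist[OF that] by (simp add: norm_mult)
qed simp

definition Bk :: "nat \<Rightarrow> 'a \<Rightarrow> 'a \<times> 'a \<Rightarrow> complex" where
  "Bk k b x = (\<Sum>c\<in>cl N k b. B c x)"

definition hh :: "nat \<Rightarrow> nat \<Rightarrow> 'a \<Rightarrow> 'a \<times> 'a \<Rightarrow> real" where
  "hh k r a x = (\<Sum>b\<in>cl k r a. (cmod (Bk k b x))\<^sup>2)"

definition ws :: "nat \<Rightarrow> 'a \<Rightarrow> 'a \<times> 'a \<Rightarrow> real" where
  "ws k b x = (\<Sum>c\<in>cl N k b. w c x)"

definition off_diag :: "nat \<Rightarrow> nat \<Rightarrow> 'a \<Rightarrow> ('a \<times> 'a) set" where
  "off_diag k r a = (SIGMA c:cl N r a. cl N k c - {c})"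

definition D :: "nat \<Rightarrow> nat \<Rightarrow> 'a \<Rightarrow> 'a \<times> 'a \<Rightarrow> complex" where
  "D k r a x = (\<Sum>p\<in>off_diag k r a. B (fst p) x * cnj (B (snd p) x))"

lemma nice_Bk: "nice (Bk k b)"
  unfolding Bk_def[abs_def] by (intro nice_sum nice_B cl_subset)

lemma nice_hh: "nice (hh k r a)"
  unfolding hh_def[abs_def] by (intro nice_sum nice_cmod_power2 nice_Bk)

lemma nice_ws: "nice (ws k b)"
  unfolding ws_def[abs_def] by (intro nice_sum nice_w cl_subset)

lemma hh_nonneg: "0 \<le> hh k r a x"
  unfolding hh_def by (intro sum_nonneg) auto

lemma nice_D: "nice (D k r a)"
  unfolding D_def[abs_def]
  by (intro nice_sum nice_mult_nice nice_cnj nice_B) (auto simp: off_diag_def cl_def)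

lemma sum_cl_pairs:
  assumes "r \<le> k"
  shows "(\<Sum>b\<in>cl k r a. \<Sum>c\<in>cl N k b. \<Sum>d\<in>cl N k b. G c d) = (\<Sum>c\<in>cl N r a. \<Sum>d\<in>cl N k c. G c d)"
proof -
  have "(\<Sum>b\<in>cl k r a. \<Sum>c\<in>cl N k b. \<Sum>d\<in>cl N k b. G c d) = (\<Sum>b\<in>cl k r a. \<Sum>c\<in>cl N k b. \<Sum>d\<in>cl N k c. G c d)"
  proof (intro sum.cong refl)
    fix b c d assume "c \<in> cl N k b"
    then show "cl N k b = cl N k c" by (intro cl_cong) (simp add: cl_def av_commute)
  qed
  then show ?thesis unfolding sum_cl_regroup[OF assms, of _ N a] .
qed

text \<open>Expanding the squares, the diagonal gives \<open>ws\<close> and the pairs of distinct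
  small caps within one level-\<open>k\<close> arc give \<open>D\<close>. The diagonal is constant
  under horizontal shifts up to \<open>P ^ N\<close>; \<open>D\<close> oscillates under
  them.\<close>

lemma hh_eq:
  assumes "r \<le> k"
  shows "hh k r a x = Re (D k r a x) + ws r a x"
proof -
  have "complex_of_real (hh k r a x) = (\<Sum>b\<in>cl k r a. \<Sum>c\<in>cl N k b. \<Sum>d\<in>cl N k b. B c x * cnj (B d x))"
    unfolding hh_def Bk_def of_real_sum complex_norm_square by (simp add: sum_product)
  also have "\<dots> = (\<Sum>c\<in>cl N r a. \<Sum>d\<in>cl N k c. B c x * cnj (B d x))" by (rule sum_cl_pairs[OF assms])
  also have "\<dots> = (\<Sum>c\<in>cl N r a. B c x * cnj (B c x) + (\<Sum>d\<in>cl N k c - {c}. B c x * cnj (B d x)))"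
  proof (intro sum.cong refl)
    fix c assume "c \<in> cl N r a"
    then have "c \<in> cl N k c" using cl_subset cl_self by blast
    then show "(\<Sum>d\<in>cl N k c. B c x * cnj (B d x)) = B c x * cnj (B c x) + (\<Sum>d\<in>cl N k c - {c}. B c x * cnj (B d x))"
      by (intro sum.remove) auto
  qed
  also have "\<dots> = complex_of_real (ws r a x) + D k r a x"
    unfolding D_def off_diag_def ws_def of_real_sum complex_norm_square
    by (simp add: sum.distrib sum.Sigma split_def)
  finally have "Re (complex_of_real (hh k r a x)) = Re (complex_of_real (ws r a x) + D k r a x)" by simp
  then show ?thesis by simp
qed

lemma chi_diff:
  "e (- (fst t * (c - d) + snd t * (c\<^sup>2 - d\<^sup>2)))
    = e (- (fst t * c + snd t * c\<^sup>2)) * cnj (e (- (fst t * d + snd t * d\<^sup>2)))"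
proof -
  have "- (fst t * (c - d) + snd t * (c\<^sup>2 - d\<^sup>2)) = - (fst t * c + snd t * c\<^sup>2) + - (- (fst t * d + snd t * d\<^sup>2))"
    by (simp add: algebra_simps)
  then show ?thesis by (simp only: e_add e_minus)
qed

lemma pair_twist:
  assumes "c \<in> \<Theta> N" "d \<in> \<Theta> N" "t \<in> T N c" "t \<in> T N d"
  shows "B c (x + t) * cnj (B d (x + t)) = e (- (fst t * (c - d) + snd t * (c\<^sup>2 - d\<^sup>2))) * (B c x * cnj (B d x))"
proof -
  show ?thesis unfolding chi_diff using assms by (simp add: B_twist)
qed

text \<open>Biorthogonality at the finest level \<open>N\<close>. The squared moduli of the pair
  products are \<open>w c * w d\<close>, and adding the diagonal ones completes the sums to squares
  of \<open>ws\<close>.\<close>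

lemma integral_D_le:
  assumes "r \<le> k"
  shows "(\<integral>x. (cmod (D k r a x))\<^sup>2 \<partial>mu) \<le> P\<^sup>2 * (\<Sum>b\<in>cl k r a. \<integral>x. (ws k b x)\<^sup>2 \<partial>mu)"
proof -
  have "(\<integral>x. (cmod (D k r a x))\<^sup>2 \<partial>mu)
      \<le> P\<^sup>2 * (\<Sum>p\<in>off_diag k r a. \<integral>x. (cmod (B (fst p) x * cnj (B (snd p) x)))\<^sup>2 \<partial>mu)"
    unfolding D_def
  proof (rule biorthogonality[where k = N])
    show sub: "off_diag k r a \<subseteq> \<Theta> N \<times> \<Theta> N" by (auto simp: off_diag_def cl_def)
    show "c \<noteq> d" if "(c, d) \<in> off_diag k r a" for c d using that by (auto simp: off_diag_def)
    show "nice (\<lambda>x. B (fst p) x * cnj (B (snd p) x))" if "p \<in> off_diag k r a" for p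
      using that sub by (intro nice_mult_nice nice_cnj nice_B) auto
    fix c d j t x
    assume cd: "(c, d) \<in> off_diag k r a" and j: "1 / P ^ Suc j < av (c - d)" "av (c - d) \<le> 1 / P ^ j"
      and t: "av (fst t + 2 * c * snd t) \<le> P ^ N" "av (snd t) \<le> P ^ (N + j)"
    have cN: "c \<in> \<Theta> N" "d \<in> \<Theta> N" using cd sub by auto
    have "\<not> av (c - d) \<le> 1 / P ^ N" using Theta_unique[OF cN] cd by (auto simp: off_diag_def)
    then have "\<not> 1 / P ^ j \<le> 1 / P ^ N" using j(2) by linarith
    then have jN: "j \<le> N" using inverse_power_P_antimono[of N j] by linarith
    then have PN: "P ^ (N + j) \<le> P ^ (2 * N)" using P_ge_1 by (intro power_increasing) auto
    have tc: "t \<in> T N c" using t PN by (simp add: T_N)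
    \<comment> \<open>Between directions at distance \<open>1 / P ^ j\<close>, a shift of height
      \<open>P ^ (N + j)\<close> deviates by at most \<open>P ^ N\<close>, so it lies in both small
      tiles.\<close>
    have "av (2 * (d - c) * snd t) = av 2 * av (c - d) * av (snd t)"
      unfolding av_mult by (simp add: av_commute[of c d])
    also have "\<dots> \<le> 1 * (1 / P ^ j) * P ^ (N + j)" using j(2) t(2) av_2_le_1 by (intro mult_mono) auto
    finally have "av (2 * (d - c) * snd t) \<le> P ^ N" by (simp add: power_add)
    then have "av ((fst t + 2 * c * snd t) + 2 * (d - c) * snd t) \<le> P ^ N" by (rule av_add_leI[OF t(1)])
    then have td: "t \<in> T N d" using t PN by (simp add: T_N algebra_simps)
    show "B (fst (c, d)) (x + t) * cnj (B (snd (c, d)) (x + t)) =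
       e (- (fst t * (c - d) + snd t * (c\<^sup>2 - d\<^sup>2))) * (B (fst (c, d)) x * cnj (B (snd (c, d)) x))"
      using pair_twist[OF cN tc td] by simp
  qed
  also have "(\<Sum>p\<in>off_diag k r a. \<integral>x. (cmod (B (fst p) x * cnj (B (snd p) x)))\<^sup>2 \<partial>mu)
      \<le> (\<Sum>b\<in>cl k r a. \<integral>x. (ws k b x)\<^sup>2 \<partial>mu)"
  proof -
    have nn: "0 \<le> (\<integral>x. w c x * w d x \<partial>mu)" for c d by (intro integral_nonneg_AE AE_I2) auto
    have "(\<Sum>p\<in>off_diag k r a. \<integral>x. (cmod (B (fst p) x * cnj (B (snd p) x)))\<^sup>2 \<partial>mu)
        = (\<Sum>c\<in>cl N r a. \<Sum>d\<in>cl N k c - {c}. \<integral>x. w c x * w d x \<partial>mu)"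
      unfolding off_diag_def by (simp add: sum.Sigma split_def norm_mult power_mult_distrib)
    also have "\<dots> \<le> (\<Sum>c\<in>cl N r a. \<Sum>d\<in>cl N k c. \<integral>x. w c x * w d x \<partial>mu)"
      using nn by (intro sum_mono sum_mono2) auto
    also have "\<dots> = (\<Sum>b\<in>cl k r a. \<Sum>c\<in>cl N k b. \<Sum>d\<in>cl N k b. \<integral>x. w c x * w d x \<partial>mu)"
      by (rule sum_cl_pairs[OF assms, symmetric])
    also have "\<dots> = (\<Sum>b\<in>cl k r a. \<integral>x. (ws k b x)\<^sup>2 \<partial>mu)"
      unfolding ws_def power2_eq_square[of "sum _ _"]
      by (intro sum.cong refl nice_sum_mult_sum_integral[symmetric] nice_w cl_subset)
    finally show ?thesis .
  qed
  finally show ?thesis by simp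
qed

text \<open>Each term of \<open>D\<close> has first frequency coordinate \<open>c - d\<close> of
  size above \<open>1 / P ^ N\<close>, while \<open>G\<close> is constant under horizontal shifts up
  to \<open>P ^ N\<close>; some such shift separates them.\<close>

lemma integral_Re_D_mult:
  assumes "nice G" "\<And>h x. av h \<le> P ^ N \<Longrightarrow> G (x + (h, 0)) = G x"
  shows "(\<integral>x. Re (D k r a x) * (G x :: real) \<partial>mu) = 0"
proof -
  have nG: "nice (\<lambda>x. complex_of_real (G x))" by (rule nice_comp[OF assms(1)]) simp
  have "(\<integral>x. (B c x * cnj (B d x)) * complex_of_real (G x) \<partial>mu) = 0" if cd: "(c, d) \<in> off_diag k r a" for c d
  proof -
    have cN: "c \<in> \<Theta> N" "d \<in> \<Theta> N" "c \<noteq> d" using cd by (auto simp: off_diag_def cl_def)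
    have "\<not> av (c - d) \<le> 1 / P ^ N" using Theta_unique[OF cN(1,2)] cN(3) by blast
    then obtain t where t: "av t \<le> P ^ N" "e (t * (c - d)) \<noteq> 1" using char_trivial_imp_small by blast
    have T: "(- t, 0) \<in> T N b" for b using t(1) by (simp add: T_N)
    show ?thesis
    proof (rule integral_eq_0_if_twisted[OF _ _ t(2)])
      show "nice (\<lambda>x. (B c x * cnj (B d x)) * complex_of_real (G x))"
        by (intro nice_mult_nice nice_cnj nice_B nG cN)
      show "(B c (x + (- t, 0)) * cnj (B d (x + (- t, 0)))) * complex_of_real (G (x + (- t, 0)))
          = e (t * (c - d)) * ((B c x * cnj (B d x)) * complex_of_real (G x))" for x
        using pair_twist[OF cN(1,2) T T, of x] assms(2)[of "- t" x] t(1) by simp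
    qed
  qed
  then have "(\<Sum>p\<in>off_diag k r a. \<integral>x. (B (fst p) x * cnj (B (snd p) x)) * complex_of_real (G x) \<partial>mu) = 0"
    by (intro sum.neutral) auto
  also have "(\<Sum>p\<in>off_diag k r a. \<integral>x. (B (fst p) x * cnj (B (snd p) x)) * complex_of_real (G x) \<partial>mu)
      = (\<integral>x. D k r a x * complex_of_real (G x) \<partial>mu)"
    unfolding D_def sum_distrib_right
    by (rule nice_integral_sum[symmetric]) (intro nice_mult_nice nice_cnj nice_B nG, auto simp: off_diag_def cl_def)
  finally have "(\<integral>x. D k r a x * complex_of_real (G x) \<partial>mu) = 0" .
  moreover have "(\<integral>x. Re (D k r a x * complex_of_real (G x)) \<partial>mu) = Re (\<integral>x. D k r a x * complex_of_real (G x) \<partial>mu)"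
    by (intro integral_Re nice_integrable nice_mult_nice nice_D nG)
  ultimately show ?thesis by simp
qed

text \<open>Pythagoras: the cross term vanishes by \<open>integral_Re_D_mult\<close>, so the two
  second moments simply add.\<close>

lemma integral_square_Re_D_add_le:
  assumes "r \<le> k" "nice G" "\<And>h x. av h \<le> P ^ N \<Longrightarrow> G (x + (h, 0)) = G x"
  shows "(\<integral>x. (Re (D k r a x) + (G x :: real))\<^sup>2 \<partial>mu)
    \<le> P\<^sup>2 * (\<Sum>b\<in>cl k r a. \<integral>x. (ws k b x)\<^sup>2 \<partial>mu) + (\<integral>x. (G x)\<^sup>2 \<partial>mu)"
proof -
  have nR: "nice (\<lambda>x. Re (D k r a x))" by (rule nice_comp[OF nice_D]) simp
  have "(\<integral>x. (Re (D k r a x) + G x)\<^sup>2 \<partial>mu)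
      = (\<integral>x. ((Re (D k r a x))\<^sup>2 + (G x)\<^sup>2) + 2 * (Re (D k r a x) * G x) \<partial>mu)"
    by (simp add: power2_sum mult.assoc)
  also have "\<dots> = (\<integral>x. (Re (D k r a x))\<^sup>2 \<partial>mu) + (\<integral>x. (G x)\<^sup>2 \<partial>mu) + 2 * (\<integral>x. Re (D k r a x) * G x \<partial>mu)"
    using nR assms(2) by (simp add: nice_integral_add nice_add nice_power2 nice_mult_nice nice_cmult)
  also have "\<dots> = (\<integral>x. (Re (D k r a x))\<^sup>2 \<partial>mu) + (\<integral>x. (G x)\<^sup>2 \<partial>mu)"
    using integral_Re_D_mult[OF assms(2,3)] by simp
  also have "(\<integral>x. (Re (D k r a x))\<^sup>2 \<partial>mu) \<le> (\<integral>x. (cmod (D k r a x))\<^sup>2 \<partial>mu)"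
    by (intro nice_integral_mono nice_power2 nice_cmod_power2 nR nice_D)
      (simp add: cmod_power2)
  also have "\<dots> \<le> P\<^sup>2 * (\<Sum>b\<in>cl k r a. \<integral>x. (ws k b x)\<^sup>2 \<partial>mu)" by (rule integral_D_le[OF assms(1)])
  finally show ?thesis by simp
qed

lemma w_horizontal: "c \<in> \<Theta> N \<Longrightarrow> av h \<le> P ^ N \<Longrightarrow> w c (x + (h, 0)) = w c x"
  using w_invariant[of c "(h, 0)" x] T_horizontal[of h N c] by (simp add: power_P_2N)

lemma integral_hh_square_le:
  assumes "r \<le> k"
  shows "(\<integral>x. (hh k r a x)\<^sup>2 \<partial>mu) \<le> P\<^sup>2 * (\<Sum>b\<in>cl k r a. \<integral>x. (ws k b x)\<^sup>2 \<partial>mu) + (\<integral>x. (ws r a x)\<^sup>2 \<partial>mu)"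
  unfolding hh_eq[OF assms]
proof (rule integral_square_Re_D_add_le[OF assms nice_ws])
  show "ws r a (x + (h, 0)) = ws r a x" if "av h \<le> P ^ N" for h x
    unfolding ws_def using that by (intro sum.cong refl w_horizontal cl_subset)
qed

text \<open>The diagonal \<open>ws r a\<close> averaged over level-\<open>k\<close> tiles; it plays
  the role of the low-frequency part of \<open>hh k r a\<close>.\<close>

definition LL :: "nat \<Rightarrow> nat \<Rightarrow> 'a \<Rightarrow> 'a \<times> 'a \<Rightarrow> real" where
  "LL k r a x = (\<Sum>c\<in>cl N r a. E k (w c) x)"

lemma nice_LL: "nice (LL k r a)"
  unfolding LL_def[abs_def] by (intro nice_sum nice_E nice_w cl_subset)

text \<open>The part of the square function at scale \<open>k\<close> that lives at frequencies outside the duals of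
  the level-\<open>k\<close> tiles.\<close>

lemma integral_high_square_le:
  assumes "r \<le> k" "k \<le> N"
  shows "(\<integral>x. (hh k r a x - LL k r a x)\<^sup>2 \<partial>mu) \<le> (P\<^sup>2 + 2 * P) * (\<Sum>b\<in>cl k r a. \<integral>x. (ws k b x)\<^sup>2 \<partial>mu)"
proof -
  define G where "G x = (\<Sum>c\<in>cl N r a. w c x - E k (w c) x)" for x
  have nG: "nice G" unfolding G_def[abs_def] by (intro nice_sum nice_diff nice_E nice_w cl_subset)
  have inv: "G (x + (h, 0)) = G x" if h: "av h \<le> P ^ N" for h x
    unfolding G_def
  proof (intro sum.cong refl)
    fix c assume "c \<in> cl N r a"
    then have c: "c \<in> \<Theta> N" by (rule cl_subset)
    have "E k (w c) (x + (h, 0)) = E k (w c) x" by (rule E_commute_shift) (rule w_horizontal[OF c h])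
    then show "w c (x + (h, 0)) - E k (w c) (x + (h, 0)) = w c x - E k (w c) x"
      using w_horizontal[OF c h] by simp
  qed
  \<comment> \<open>Averaging is subtracted from the diagonal only, and the remainder
    \<open>G\<close> keeps its horizontal invariance, so it is still orthogonal to
    \<open>D\<close>.\<close>
  have eq: "hh k r a x - LL k r a x = Re (D k r a x) + G x" for x
    unfolding hh_eq[OF assms(1)] ws_def LL_def G_def by (simp add: sum_subtractf)
  have "(\<integral>x. (hh k r a x - LL k r a x)\<^sup>2 \<partial>mu) \<le> P\<^sup>2 * (\<Sum>b\<in>cl k r a. \<integral>x. (ws k b x)\<^sup>2 \<partial>mu) + (\<integral>x. (G x)\<^sup>2 \<partial>mu)"
    unfolding eq by (rule integral_square_Re_D_add_le[OF assms(1) nG inv])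
  also have "(\<integral>x. (G x)\<^sup>2 \<partial>mu) \<le> P * (\<Sum>b\<in>cl k r a. 2 * (\<integral>x. (ws k b x)\<^sup>2 \<partial>mu))"
    unfolding G_def ws_def by (rule square_sum_w_minus_E_le[OF assms])
  finally show ?thesis by (simp add: sum_distrib_left[symmetric] distrib_right)
qed

text \<open>For \<open>r \<le> k\<close> this box lies in the dual rectangles, of size
  \<open>P ^ k\<close> by \<open>P ^ (2 * k)\<close>, of all level-\<open>k\<close> caps in the arc
  of radius \<open>1 / P ^ r\<close> about \<open>a\<close>: their directions fan out by at most
  \<open>1 / P ^ r\<close>, which is harmless up to height \<open>P ^ (k + r)\<close>.\<close>

definition Q :: "nat \<Rightarrow> nat \<Rightarrow> 'a \<Rightarrow> ('a \<times> 'a) set" where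
  "Q k r a = {t. av (fst t + 2 * a * snd t) \<le> P ^ k \<and> av (snd t) \<le> P ^ (k + r)}"

lemma Q_cong: assumes "av (a - b) \<le> 1 / P ^ r" "t \<in> Q k r a" shows "t \<in> Q k r b"
proof -
  have "av (2 * (b - a) * snd t) = av 2 * av (a - b) * av (snd t)"
    unfolding av_mult by (simp add: av_commute[of a b])
  also have "\<dots> \<le> 1 * (1 / P ^ r) * P ^ (k + r)"
    using assms av_2_le_1 by (intro mult_mono) (auto simp: Q_def)
  finally have "av (2 * (b - a) * snd t) \<le> P ^ k" by (simp add: power_add)
  then have "av ((fst t + 2 * a * snd t) + 2 * (b - a) * snd t) \<le> P ^ k"
    by (rule av_add_leI[rotated]) (use assms in \<open>simp add: Q_def\<close>)
  then show ?thesis using assms by (simp add: Q_def algebra_simps)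
qed

lemma Q_subset_T:
  assumes "r \<le> k" "k \<le> N" "t \<in> Q k r a" "c \<in> cl N r a" shows "t \<in> T N c"
proof -
  have "t \<in> Q k r c" using assms by (intro Q_cong[of a c]) (auto simp: cl_def av_commute)
  moreover have "P ^ k \<le> P ^ N" "P ^ (k + r) \<le> P ^ (2 * N)"
    using assms P_ge_1 by (auto intro!: power_increasing)
  ultimately show ?thesis by (simp add: T_N Q_def)
qed

text \<open>On \<open>Q\<close> the characters of all small caps in one level-\<open>k\<close> arc
  coincide, by \<open>e_dot2_cap\<close> applied to the points \<open>(c, c\<^sup>2)\<close>. Hence
  the sum over the arc is twisted by one character and its modulus is constant on translates of
  \<open>Q\<close>.\<close>

lemma Bk_twist:
  assumes "r \<le> k" "k \<le> N" "t \<in> Q k r a" "b \<in> cl k r a"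
  shows "Bk k b (x + t) = e (- (fst t * b + snd t * b\<^sup>2)) * Bk k b x"
  unfolding Bk_def sum_distrib_left
proof (intro sum.cong refl)
  fix c assume c: "c \<in> cl N k b"
  have ca: "c \<in> cl N r a" using c assms(4) cl_eq_Union[OF assms(1), of N a] by blast
  have "t \<in> Q k r b" using assms by (intro Q_cong[of a b]) (auto simp: cl_def av_commute)
  then have t: "av (fst t + 2 * b * snd t) \<le> P ^ k" "av (snd t) \<le> P ^ (k + r)" by (auto simp: Q_def)
  have "av (snd t) \<le> P ^ (k + k)"
    using t(2) assms(1) P_ge_1 power_increasing[of "k + r" "k + k" P] by simp
  then have "av (snd t) * (1 / P ^ k)\<^sup>2 \<le> 1"
    by (simp add: power_divide power_add power2_eq_square field_simps)
  moreover have "av (fst t + 2 * b * snd t) * (1 / P ^ k) \<le> 1" using t by (simp add: field_simps)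
  moreover have "(c, c\<^sup>2) \<in> cap av b (1 / P ^ k)" using c by (simp add: cap_def cl_def)
  ultimately have "e (- dot2 t (c, c\<^sup>2)) = e (- (fst t * b + snd t * b\<^sup>2))"
    by (intro e_dot2_cap[of _ _ "1 / P ^ k"]) auto
  then have "e (- (fst t * c + snd t * c\<^sup>2)) = e (- (fst t * b + snd t * b\<^sup>2))" by (simp add: dot2_def)
  then show "B c (x + t) = e (- (fst t * b + snd t * b\<^sup>2)) * B c x"
    using B_twist[of c t x] cl_subset[OF ca] Q_subset_T[OF assms(1-3) ca] by simp
qed

text \<open>Points in different children of \<open>a\<close> are separated exactly at level
  \<open>r\<close>, so \<open>biorthogonality\<close> asks only about shifts in
  \<open>Q k r a\<close>. The cutoff \<open>V\<close> is invariant under these and can be carried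
  through.\<close>

lemma bilinear_local:
  assumes rk: "r < k" "k \<le> N"
    and V: "lconst V" "\<And>t x. t \<in> Q k r a \<Longrightarrow> V (x + t) = V x"
    and a: "a' \<in> cl (Suc r) r a" "a'' \<in> cl (Suc r) r a" "a' \<noteq> a''"
  shows "(\<integral>x. (if V x then (cmod (Bk (Suc r) a' x))\<^sup>2 * (cmod (Bk (Suc r) a'' x))\<^sup>2 else 0) \<partial>mu)
    \<le> P\<^sup>2 * (\<integral>x. (if V x then hh k (Suc r) a' x * hh k (Suc r) a'' x else 0) \<partial>mu)"
proof -
  let ?A = "cl k (Suc r) a'" and ?B = "cl k (Suc r) a''"
  define g where "g p x = (if V x then Bk k (fst p) x * cnj (Bk k (snd p) x) else 0)" for p :: "'a \<times> 'a" and x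
  have ng: "nice (g p)" for p
    unfolding g_def[abs_def] by (intro nice_if V(1) nice_mult_nice nice_cnj nice_Bk)
  have Suc_rk: "Suc r \<le> k" using rk by simp
  have sum_Bk: "Bk (Suc r) b x = (\<Sum>c\<in>cl k (Suc r) b. Bk k c x)" for b x
    unfolding Bk_def by (rule sum_cl_regroup[OF Suc_rk])
  have in_a: "c \<in> cl k r a" if "c \<in> cl k (Suc r) b" "b \<in> cl (Suc r) r a" for b c
    using that cl_eq_Union[of r "Suc r" k a] by auto
  have "(\<integral>x. (if V x then (cmod (Bk (Suc r) a' x))\<^sup>2 * (cmod (Bk (Suc r) a'' x))\<^sup>2 else 0) \<partial>mu)
      = (\<integral>x. (cmod (\<Sum>p\<in>?A \<times> ?B. g p x))\<^sup>2 \<partial>mu)"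
  proof (rule Bochner_Integration.integral_cong[OF refl])
    fix x
    have "(\<Sum>p\<in>?A \<times> ?B. g p x) = (if V x then Bk (Suc r) a' x * cnj (Bk (Suc r) a'' x) else 0)"
      unfolding g_def sum_Bk by (simp add: sum_product sum.cartesian_product split_def)
    then show "(if V x then (cmod (Bk (Suc r) a' x))\<^sup>2 * (cmod (Bk (Suc r) a'' x))\<^sup>2 else 0)
        = (cmod (\<Sum>p\<in>?A \<times> ?B. g p x))\<^sup>2"
      by (simp add: norm_mult power_mult_distrib)
  qed
  also have "\<dots> \<le> P\<^sup>2 * (\<Sum>p\<in>?A \<times> ?B. \<integral>x. (cmod (g p x))\<^sup>2 \<partial>mu)"
  proof (rule biorthogonality[where k = k])
    show "?A \<times> ?B \<subseteq> \<Theta> k \<times> \<Theta> k" by (auto simp: cl_def)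
    have sep: "1 / P ^ Suc r < av (c - d)" if "c \<in> ?A" "d \<in> ?B" for c d
    proof (rule ccontr)
      assume "\<not> 1 / P ^ Suc r < av (c - d)"
      then have "av (c - d) \<le> 1 / P ^ Suc r" by simp
      then have "av (a' - a'') \<le> 1 / P ^ Suc r"
        using that av_diff_trans[of a' c _ d] av_diff_trans[of a' d _ a''] av_commute[of a' c]
        by (auto simp: cl_def)
      then show False using Theta_unique a cl_subset by blast
    qed
    show "c \<noteq> d" if "(c, d) \<in> ?A \<times> ?B" for c d
    proof
      assume "c = d"
      then have "1 / P ^ Suc r < 0" using sep[of c d] that by simp
      moreover have "0 < 1 / P ^ Suc r" by simp
      ultimately show False by linarith
    qed
    show "nice (g p)" for p by (rule ng)
    fix c d j t x
    assume cd: "(c, d) \<in> ?A \<times> ?B" and j: "1 / P ^ Suc j < av (c - d)" "av (c - d) \<le> 1 / P ^ j"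
      and t: "av (fst t + 2 * c * snd t) \<le> P ^ k" "av (snd t) \<le> P ^ (k + j)"
    have c: "c \<in> cl k r a" "d \<in> cl k r a" using cd a in_a by auto
    then have le: "av (c - d) \<le> 1 / P ^ r"
      using av_diff_trans[of c a _ d] av_commute[of a d] by (auto simp: cl_def)
    have "j < Suc r"
    proof (rule ccontr)
      assume "\<not> j < Suc r"
      then have "1 / P ^ j \<le> 1 / P ^ Suc r" by (intro inverse_power_P_antimono) simp
      then show False using sep[of c d] cd j(2) by auto
    qed
    moreover have "r < Suc j"
    proof (rule ccontr)
      assume "\<not> r < Suc j"
      then have "1 / P ^ r \<le> 1 / P ^ Suc j" by (intro inverse_power_P_antimono) simp
      then show False using le j(1) by auto
    qed
    ultimately have jr: "j = r" by simp
    have "t \<in> Q k r c" using t jr by (simp add: Q_def)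
    then have tQ: "t \<in> Q k r a" using c by (intro Q_cong[of c a]) (auto simp: cl_def)
    have rk': "r \<le> k" using rk by simp
    show "g (c, d) (x + t) = e (- (fst t * (c - d) + snd t * (c\<^sup>2 - d\<^sup>2))) * g (c, d) x"
      unfolding g_def V(2)[OF tQ] chi_diff
      using Bk_twist[OF rk' rk(2) tQ c(1), of x] Bk_twist[OF rk' rk(2) tQ c(2), of x] by simp
  qed
  also have "(\<Sum>p\<in>?A \<times> ?B. \<integral>x. (cmod (g p x))\<^sup>2 \<partial>mu) = (\<integral>x. (\<Sum>p\<in>?A \<times> ?B. (cmod (g p x))\<^sup>2) \<partial>mu)"
    by (intro nice_integral_sum[symmetric] nice_cmod_power2 ng)
  also have "\<dots> = (\<integral>x. (if V x then hh k (Suc r) a' x * hh k (Suc r) a'' x else 0) \<partial>mu)"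
    unfolding g_def hh_def
    by (intro Bochner_Integration.integral_cong refl)
      (simp add: sum_product sum.cartesian_product split_def norm_mult power_mult_distrib)
  finally show ?thesis .
qed

lemma bilinear_local_sum:
  assumes rk: "r < k" "k \<le> N"
    and V: "lconst V" "\<And>t x. t \<in> Q k r a \<Longrightarrow> V (x + t) = V x"
  shows "(\<integral>x. (if V x then (\<Sum>a'\<in>cl (Suc r) r a. \<Sum>a''\<in>cl (Suc r) r a - {a'}.
      (cmod (Bk (Suc r) a' x))\<^sup>2 * (cmod (Bk (Suc r) a'' x))\<^sup>2) else 0) \<partial>mu)
    \<le> P\<^sup>2 * (\<integral>x. (if V x then (hh k r a x)\<^sup>2 else 0) \<partial>mu)"
proof -
  let ?A = "cl (Suc r) r a"
  let ?f = "\<lambda>a' a'' x. if V x then (cmod (Bk (Suc r) a' x))\<^sup>2 * (cmod (Bk (Suc r) a'' x))\<^sup>2 else 0"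
  let ?h = "\<lambda>a' a'' x. if V x then hh k (Suc r) a' x * hh k (Suc r) a'' x else 0"
  have nf: "nice (?f a' a'')" for a' a'' by (intro nice_if V(1) nice_mult_nice nice_cmod_power2 nice_Bk)
  have nh: "nice (?h a' a'')" for a' a'' by (intro nice_if V(1) nice_mult_nice nice_hh)
  have "(\<integral>x. (if V x then (\<Sum>a'\<in>?A. \<Sum>a''\<in>?A - {a'}.
      (cmod (Bk (Suc r) a' x))\<^sup>2 * (cmod (Bk (Suc r) a'' x))\<^sup>2) else 0) \<partial>mu)
      = (\<integral>x. (\<Sum>a'\<in>?A. \<Sum>a''\<in>?A - {a'}. ?f a' a'' x) \<partial>mu)"
    by (intro Bochner_Integration.integral_cong refl) simp
  also have "\<dots> = (\<Sum>a'\<in>?A. \<Sum>a''\<in>?A - {a'}. \<integral>x. ?f a' a'' x \<partial>mu)"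
    by (subst nice_integral_sum, intro nice_sum nf, intro sum.cong refl nice_integral_sum nf)
  also have "\<dots> \<le> (\<Sum>a'\<in>?A. \<Sum>a''\<in>?A - {a'}. P\<^sup>2 * (\<integral>x. ?h a' a'' x \<partial>mu))"
    by (intro sum_mono bilinear_local[OF rk V]) auto
  \<comment> \<open>Adding the non-negative diagonal terms makes the double sum the square of
    \<open>hh k r a\<close>.\<close>
  also have "\<dots> \<le> (\<Sum>a'\<in>?A. \<Sum>a''\<in>?A. P\<^sup>2 * (\<integral>x. ?h a' a'' x \<partial>mu))"
    by (intro sum_mono sum_mono2)
      (auto intro!: mult_nonneg_nonneg integral_nonneg_AE hh_nonneg)
  also have "\<dots> = P\<^sup>2 * (\<integral>x. (\<Sum>a'\<in>?A. \<Sum>a''\<in>?A. ?h a' a'' x) \<partial>mu)"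
  proof -
    have "(\<integral>x. (\<Sum>a'\<in>?A. \<Sum>a''\<in>?A. ?h a' a'' x) \<partial>mu) = (\<Sum>a'\<in>?A. \<Sum>a''\<in>?A. \<integral>x. ?h a' a'' x \<partial>mu)"
      by (subst nice_integral_sum, intro nice_sum nh, intro sum.cong refl nice_integral_sum nh)
    then show ?thesis by (simp only: sum_distrib_left)
  qed
  also have "(\<integral>x. (\<Sum>a'\<in>?A. \<Sum>a''\<in>?A. ?h a' a'' x) \<partial>mu) = (\<integral>x. (if V x then (hh k r a x)\<^sup>2 else 0) \<partial>mu)"
  proof (intro Bochner_Integration.integral_cong refl)
    fix x
    have "hh k r a x = (\<Sum>a'\<in>?A. hh k (Suc r) a' x)"
      unfolding hh_def by (rule sum_cl_regroup) simp
    then show "(\<Sum>a'\<in>?A. \<Sum>a''\<in>?A. ?h a' a'' x) = (if V x then (hh k r a x)\<^sup>2 else 0)"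
      by (simp add: power2_eq_square sum_product)
  qed
  finally show ?thesis .
qed

end

subsection \<open>Broad and narrow points\<close>

text \<open>Let \<open>S\<close> be the modulus of the sum and \<open>s\<close> the sum of the
  moduli. Each term is at most \<open>S / (1 + \<delta>)\<close> and \<open>S \<le> s\<close>, so
  the terms other than a given one add up to at least \<open>S - S / (1 + \<delta>)\<close>.\<close>

lemma broad_or_narrow:
  fixes z :: "'i \<Rightarrow> complex" and \<delta> :: real
  assumes "finite A" "0 < \<delta>" "\<And>a. a \<in> A \<Longrightarrow> (1 + \<delta>) * cmod (z a) < cmod (\<Sum>a\<in>A. z a)"
  shows "\<delta> / (1 + \<delta>) * (cmod (\<Sum>a\<in>A. z a))\<^sup>2 \<le> (\<Sum>a\<in>A. \<Sum>b\<in>A - {a}. cmod (z a) * cmod (z b))"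
proof -
  define S where "S = cmod (\<Sum>a\<in>A. z a)"
  define s where "s = (\<Sum>a\<in>A. cmod (z a))"
  have Ss: "S \<le> s" unfolding S_def s_def by (rule norm_sum)
  have S0: "0 \<le> S" by (simp add: S_def)
  have "\<delta> / (1 + \<delta>) * S\<^sup>2 = S * (S - S / (1 + \<delta>))"
    using assms(2) by (simp add: field_simps power2_eq_square)
  also have "\<dots> \<le> s * (s - S / (1 + \<delta>))"
  proof -
    have "S / (1 + \<delta>) \<le> S" using S0 assms(2) by (simp add: divide_le_eq distrib_left)
    then show ?thesis using Ss S0 by (intro mult_mono) auto
  qed
  also have "\<dots> = (\<Sum>a\<in>A. cmod (z a) * (s - S / (1 + \<delta>)))" by (simp add: s_def sum_distrib_right)
  also have "\<dots> \<le> (\<Sum>a\<in>A. cmod (z a) * (s - cmod (z a)))"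
  proof (intro sum_mono mult_left_mono diff_left_mono)
    show "cmod (z a) \<le> S / (1 + \<delta>)" if "a \<in> A" for a
      using assms(3)[OF that] assms(2) by (simp add: S_def field_simps)
  qed simp
  also have "\<dots> = (\<Sum>a\<in>A. \<Sum>b\<in>A - {a}. cmod (z a) * cmod (z b))"
    using assms(1) by (intro sum.cong refl) (simp add: s_def sum_diff1 flip: sum_distrib_left)
  finally show ?thesis unfolding S_def .
qed

text \<open>Cauchy-Schwarz over the non-zero terms only; through this the number of caps with
  non-zero projection enters.\<close>

lemma sum_power2_le_card_support:
  fixes z :: "'i \<Rightarrow> complex"
  assumes "finite A" "real (card {a\<in>A. z a \<noteq> 0}) \<le> n"
  shows "(cmod (\<Sum>a\<in>A. z a))\<^sup>2 \<le> n * (\<Sum>a\<in>A. (cmod (z a))\<^sup>2)"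
proof -
  let ?S = "{a\<in>A. z a \<noteq> 0}"
  have "(\<Sum>a\<in>A. z a) = (\<Sum>a\<in>?S. z a)" using assms(1) by (intro sum.mono_neutral_right) auto
  then have "(cmod (\<Sum>a\<in>A. z a))\<^sup>2 \<le> (\<Sum>a\<in>?S. cmod (z a))\<^sup>2" by (simp add: norm_sum power_mono)
  also have "\<dots> \<le> (\<Sum>a\<in>?S. (cmod (z a))\<^sup>2) * real (card ?S)" by (rule sum_squared_le_sum_of_squares)
  also have "\<dots> \<le> (\<Sum>a\<in>A. (cmod (z a))\<^sup>2) * n"
    using assms by (intro mult_mono sum_mono2 sum_nonneg) auto
  finally show ?thesis by (simp add: mult.commute)
qed

text \<open>The total loss of the narrow steps over at most \<open>N\<close> generations stays below
  \<open>exp (1 / 4)\<close>.\<close>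

lemma one_plus_quarter_power_le:
  assumes "r \<le> N" "1 \<le> (N::nat)"
  shows "(1 + 1 / (4 * real N)) ^ r \<le> 21 / 16"
proof -
  have "(1 + 1 / (4 * real N)) ^ r \<le> exp (1 / (4 * real N)) ^ r"
    by (intro power_mono exp_ge_add_one_self) auto
  also have "\<dots> = exp (real r * (1 / (4 * real N)))" by (rule exp_of_nat_mult[symmetric])
  also have "\<dots> \<le> exp (1 / 4)" using assms by (simp add: field_simps)
  also have "\<dots> \<le> 1 + 1 / 4 + (1 / 4)\<^sup>2" by (rule exp_bound) auto
  finally show ?thesis by (simp add: power2_eq_square)
qed

context equivariant_family
begin

abbreviation broad_sum :: "nat \<Rightarrow> 'a \<Rightarrow> 'a \<times> 'a \<Rightarrow> real" where
  "broad_sum r a x \<equiv> (\<Sum>a'\<in>cl (Suc r) r a. \<Sum>a''\<in>cl (Suc r) r a - {a'}.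
      (cmod (Bk (Suc r) a' x))\<^sup>2 * (cmod (Bk (Suc r) a'' x))\<^sup>2)"

text \<open>The square of \<open>broad_or_narrow\<close>, followed by Cauchy-Schwarz over the at
  most \<open>P\<^sup>2\<close> ordered pairs of children.\<close>

lemma broad_sum_ge:
  assumes "0 < \<delta>" "\<And>a'. a' \<in> cl (Suc r) r a \<Longrightarrow> (1 + \<delta>) * cmod (Bk (Suc r) a' x) < cmod (Bk r a x)"
  shows "(cmod (Bk r a x)) ^ 4 \<le> ((1 + \<delta>) / \<delta>)\<^sup>2 * P\<^sup>2 * broad_sum r a x"
proof -
  let ?A = "cl (Suc r) r a"
  have Bk_children: "Bk r a x = (\<Sum>a'\<in>?A. Bk (Suc r) a' x)"
    unfolding Bk_def by (rule sum_cl_regroup) simp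
  define p where "p = (\<Sum>a'\<in>?A. \<Sum>a''\<in>?A - {a'}. cmod (Bk (Suc r) a' x) * cmod (Bk (Suc r) a'' x))"
  have "\<delta> / (1 + \<delta>) * (cmod (Bk r a x))\<^sup>2 \<le> p"
    unfolding p_def Bk_children using assms unfolding Bk_children by (intro broad_or_narrow) auto
  then have "(cmod (Bk r a x))\<^sup>2 \<le> (1 + \<delta>) / \<delta> * p" using assms(1) by (simp add: field_simps)
  then have "((cmod (Bk r a x))\<^sup>2)\<^sup>2 \<le> ((1 + \<delta>) / \<delta> * p)\<^sup>2" by (intro power_mono) auto
  moreover have "(cmod (Bk r a x)) ^ 4 = ((cmod (Bk r a x))\<^sup>2)\<^sup>2" by (simp flip: power_mult)
  ultimately have 1: "(cmod (Bk r a x)) ^ 4 \<le> ((1 + \<delta>) / \<delta>)\<^sup>2 * p\<^sup>2"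
    by (simp only: power_mult_distrib)
  let ?S = "SIGMA a':?A. ?A - {a'}"
  have pS: "p = (\<Sum>q\<in>?S. cmod (Bk (Suc r) (fst q) x) * cmod (Bk (Suc r) (snd q) x))"
    unfolding p_def by (simp add: sum.Sigma split_def)
  have bS: "broad_sum r a x = (\<Sum>q\<in>?S. (cmod (Bk (Suc r) (fst q) x) * cmod (Bk (Suc r) (snd q) x))\<^sup>2)"
    by (simp add: sum.Sigma split_def power_mult_distrib)
  have "real (card ?S) \<le> real (card (?A \<times> ?A))"
    by (intro of_nat_mono card_mono) auto
  also have "\<dots> = real (card ?A) * real (card ?A)" by (simp add: card_cartesian_product)
  also have "\<dots> \<le> P * P" by (intro mult_mono card_children_le) auto
  finally have card: "real (card ?S) \<le> P\<^sup>2" by (simp add: power2_eq_square)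
  have "p\<^sup>2 \<le> broad_sum r a x * real (card ?S)"
    unfolding pS bS by (rule sum_squared_le_sum_of_squares)
  also have "\<dots> \<le> broad_sum r a x * P\<^sup>2" using card by (intro mult_left_mono) (auto intro!: sum_nonneg)
  finally have "((1 + \<delta>) / \<delta>)\<^sup>2 * p\<^sup>2 \<le> ((1 + \<delta>) / \<delta>)\<^sup>2 * (broad_sum r a x * P\<^sup>2)"
    by (intro mult_left_mono) auto
  from order_trans[OF 1 this] show ?thesis by (simp only: mult_ac)
qed

text \<open>Descend the tree of arcs: while some child carries the fraction
  \<open>1 / (1 + \<delta>)\<close> of its parent, pass to that child; an arc without such a child
  is broad and the descent stops there.\<close>

lemma broad_narrow_tree:
  assumes "0 < \<delta>" "a0 \<in> \<Theta> 0" "lam \<le> cmod (Bk 0 a0 x)"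
  shows "(\<exists>r<n. \<exists>a\<in>\<Theta> r. lam \<le> (1 + \<delta>) ^ r * cmod (Bk r a x) \<and>
      (cmod (Bk r a x)) ^ 4 \<le> ((1 + \<delta>) / \<delta>)\<^sup>2 * P\<^sup>2 * broad_sum r a x) \<or>
    (\<exists>a\<in>\<Theta> n. lam \<le> (1 + \<delta>) ^ n * cmod (Bk n a x))"
proof (induction n)
  case 0
  then show ?case using assms by auto
next
  case (Suc n)
  then consider "\<exists>r<n. \<exists>a\<in>\<Theta> r. lam \<le> (1 + \<delta>) ^ r * cmod (Bk r a x) \<and>
      (cmod (Bk r a x)) ^ 4 \<le> ((1 + \<delta>) / \<delta>)\<^sup>2 * P\<^sup>2 * broad_sum r a x"
    | a where "a \<in> \<Theta> n" "lam \<le> (1 + \<delta>) ^ n * cmod (Bk n a x)" by blast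
  then show ?case
  proof cases
    case 1
    then show ?thesis using less_SucI by blast
  next
    case 2
    show ?thesis
    proof (cases "\<forall>a'\<in>cl (Suc n) n a. (1 + \<delta>) * cmod (Bk (Suc n) a' x) < cmod (Bk n a x)")
      case True
      then show ?thesis using broad_sum_ge[OF assms(1), of n a x] 2 by blast
    next
      case False
      then obtain a' where a': "a' \<in> \<Theta> (Suc n)" "cmod (Bk n a x) \<le> (1 + \<delta>) * cmod (Bk (Suc n) a' x)"
        using cl_subset by (meson not_less)
      have "lam \<le> (1 + \<delta>) ^ n * ((1 + \<delta>) * cmod (Bk (Suc n) a' x))"
        using assms(1) by (intro order_trans[OF 2(2) mult_left_mono[OF a'(2)]]) simp
      then show ?thesis using a'(1) by (auto simp: mult.assoc mult.left_commute mult.commute)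
    qed
  qed
qed

lemma Bk_0: "a0 \<in> \<Theta> 0 \<Longrightarrow> Bk 0 a0 x = (\<Sum>c\<in>\<Theta> N. B c x)"
  unfolding Bk_def by (simp add: Theta_eq_cl av_Theta)

lemma nice_total: "nice (\<lambda>x. \<Sum>c\<in>\<Theta> N. B c x)"
  by (intro nice_sum nice_B)

text \<open>On this set at least two thirds of \<open>hh\<close> are high frequency. The third left
  over accommodates the value 49/160 found in \<open>superlevel_pointwise\<close>, and the two
  thirds give the factor 9/4 of \<open>integral_V_le\<close>.\<close>

definition V :: "nat \<Rightarrow> nat \<Rightarrow> 'a \<Rightarrow> 'a \<times> 'a \<Rightarrow> bool" where
  "V k r a x \<longleftrightarrow> 3 * LL k r a x \<le> hh k r a x"

lemma lconst_V: "lconst (V k r a)"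
  unfolding V_def[abs_def]
  by (rule lconst_comp2[where \<phi> = "\<lambda>l h. 3 * l \<le> h"]) (intro nice_lconst nice_LL nice_hh)+

lemma V_invariant:
  assumes "r \<le> k" "k \<le> N" "t \<in> Q k r a" shows "V k r a (x + t) = V k r a x"
proof -
  have "LL k r a (x + t) = LL k r a x"
    unfolding LL_def
    by (intro sum.cong refl E_commute_shift w_invariant cl_subset Q_subset_T[OF assms])
  moreover have "hh k r a (x + t) = hh k r a x"
    unfolding hh_def by (intro sum.cong refl) (simp add: Bk_twist[OF assms] norm_mult)
  ultimately show ?thesis by (simp add: V_def)
qed

lemma integral_V_le:
  assumes "r \<le> k" "k \<le> N"
  shows "(\<integral>x. (if V k r a x then (hh k r a x)\<^sup>2 else 0) \<partial>mu)
    \<le> 9 / 4 * ((P\<^sup>2 + 2 * P) * (\<Sum>b\<in>cl k r a. \<integral>x. (ws k b x)\<^sup>2 \<partial>mu))"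
proof -
  have "(\<integral>x. (if V k r a x then (hh k r a x)\<^sup>2 else 0) \<partial>mu) \<le> (\<integral>x. 9 / 4 * (hh k r a x - LL k r a x)\<^sup>2 \<partial>mu)"
  proof (rule nice_integral_mono)
    fix x
    show "(if V k r a x then (hh k r a x)\<^sup>2 else 0) \<le> 9 / 4 * (hh k r a x - LL k r a x)\<^sup>2"
    proof (cases "V k r a x")
      case True
      then have "2 / 3 * hh k r a x \<le> hh k r a x - LL k r a x" by (simp add: V_def)
      then have "(2 / 3 * hh k r a x)\<^sup>2 \<le> (hh k r a x - LL k r a x)\<^sup>2"
        using hh_nonneg[of k r a x] by (intro power_mono) auto
      then show ?thesis using True by (simp add: power_mult_distrib power2_eq_square)
    qed simp
  qed (intro nice_if lconst_V nice_power2 nice_cmult nice_diff nice_hh nice_LL)+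
  also have "\<dots> = 9 / 4 * (\<integral>x. (hh k r a x - LL k r a x)\<^sup>2 \<partial>mu)" by simp
  also have "\<dots> \<le> 9 / 4 * ((P\<^sup>2 + 2 * P) * (\<Sum>b\<in>cl k r a. \<integral>x. (ws k b x)\<^sup>2 \<partial>mu))"
    by (intro mult_left_mono integral_high_square_le assms) auto
  finally show ?thesis .
qed

text \<open>For \<open>r < k\<close> this serves a descent that stops at a broad arc of level
  \<open>r\<close>; for \<open>r = k\<close> the descent has reached level \<open>k\<close>, where
  \<open>hh k k a\<close> is the square of a single term.\<close>

definition \<Phi> :: "nat \<Rightarrow> nat \<Rightarrow> 'a \<Rightarrow> 'a \<times> 'a \<Rightarrow> real" where
  "\<Phi> k r a x = (if V k r a x then (if r = k then (hh k r a x)\<^sup>2 else broad_sum r a x) else 0)"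

lemma Phi_eq:
  "\<Phi> k k a = (\<lambda>x. if V k k a x then (hh k k a x)\<^sup>2 else 0)"
  "r \<noteq> k \<Longrightarrow> \<Phi> k r a = (\<lambda>x. if V k r a x then broad_sum r a x else 0)"
  by (auto simp: \<Phi>_def)

lemma nice_Phi: "nice (\<Phi> k r a)"
proof (cases "r = k")
  case True
  show ?thesis unfolding True Phi_eq(1) by (intro nice_if lconst_V nice_power2 nice_hh)
next
  case False
  have "nice (broad_sum r a)" by (intro nice_sum nice_mult_nice nice_cmod_power2 nice_Bk)
  then show ?thesis unfolding Phi_eq(2)[OF False] by (intro nice_if lconst_V)
qed

lemma Phi_nonneg: "0 \<le> \<Phi> k r a x"
  unfolding \<Phi>_def by (auto intro!: sum_nonneg)

lemma integral_Phi_le: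
  assumes "r \<le> k" "k \<le> N"
  shows "(\<integral>x. \<Phi> k r a x \<partial>mu) \<le> P\<^sup>2 * (9 / 4 * ((P\<^sup>2 + 2 * P) * (\<Sum>b\<in>cl k r a. \<integral>x. (ws k b x)\<^sup>2 \<partial>mu)))"
proof -
  have "(\<integral>x. \<Phi> k r a x \<partial>mu) \<le> P\<^sup>2 * (\<integral>x. (if V k r a x then (hh k r a x)\<^sup>2 else 0) \<partial>mu)"
  proof (cases "r = k")
    case True
    have "1 * (\<integral>x. (if V k r a x then (hh k r a x)\<^sup>2 else 0) \<partial>mu) \<le> P\<^sup>2 * (\<integral>x. (if V k r a x then (hh k r a x)\<^sup>2 else 0) \<partial>mu)"
      using P_ge_1 by (intro mult_right_mono integral_nonneg_AE) (auto simp: one_le_power)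
    then show ?thesis unfolding True Phi_eq(1) by simp
  next
    case False
    then have "r < k" using assms(1) by simp
    then show ?thesis unfolding Phi_eq(2)[OF False]
      by (rule bilinear_local_sum[OF _ assms(2) lconst_V V_invariant[OF assms]])
  qed
  also have "\<dots> \<le> P\<^sup>2 * (9 / 4 * ((P\<^sup>2 + 2 * P) * (\<Sum>b\<in>cl k r a. \<integral>x. (ws k b x)\<^sup>2 \<partial>mu)))"
    by (intro mult_left_mono integral_V_le assms) auto
  finally show ?thesis .
qed

text \<open>At the arc where the descent stops, the partial sum is still comparable to
  \<open>\<alpha> / N\<close>. Cauchy-Schwarz over at most \<open>n\<close> active caps makes
  \<open>hh\<close> there larger than the low part can account for, so \<open>V\<close> holds and
  \<Phi> dominates the fourth power.\<close>

lemma superlevel_pointwise: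
  assumes k: "k < N" and \<alpha>: "0 < \<alpha>" and n: "0 < n"
    and support: "real (card {b\<in>\<Theta> k. Bk k b x \<noteq> 0}) \<le> n"
    and low: "(\<Sum>c\<in>\<Theta> N. E k (w c) x) \<le> 5 * \<alpha>\<^sup>2 / (72 * (real N)\<^sup>2 * n)"
    and big: "5 * \<alpha> / (8 * real N) < cmod (\<Sum>c\<in>\<Theta> N. B c x)"
  shows "\<alpha> ^ 4 \<le> (\<Sum>r\<in>{..k}. \<Sum>a\<in>\<Theta> r. (21 / 10) ^ 4 * 25 * real N ^ 6 * P\<^sup>2 * \<Phi> k r a x)"
proof -
  have N1: "1 \<le> real N" using k by simp
  define \<delta> where "\<delta> = 1 / (4 * real N)"
  have \<delta>: "0 < \<delta>" using N1 by (simp add: \<delta>_def)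
  have ratio: "((1 + \<delta>) / \<delta>)\<^sup>2 \<le> 25 * (real N)\<^sup>2"
  proof -
    have "(1 + \<delta>) / \<delta> = 4 * real N + 1" using N1 by (simp add: \<delta>_def field_simps)
    also have "\<dots> \<le> 5 * real N" using N1 by simp
    finally have "((1 + \<delta>) / \<delta>)\<^sup>2 \<le> (5 * real N)\<^sup>2" using \<delta> by (intro power_mono) auto
    then show ?thesis by (simp add: power_mult_distrib)
  qed
  obtain a0 where a0: "a0 \<in> \<Theta> 0" using Theta_ex[of 0 0] by auto
  have "5 * \<alpha> / (8 * real N) \<le> cmod (Bk 0 a0 x)" using big Bk_0[OF a0] by simp
  from broad_narrow_tree[OF \<delta> a0 this, of k]
  have "\<exists>r\<le>k. \<exists>a\<in>\<Theta> r. 5 * \<alpha> / (8 * real N) \<le> (1 + \<delta>) ^ r * cmod (Bk r a x) \<and>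
      (r = k \<or> (cmod (Bk r a x)) ^ 4 \<le> ((1 + \<delta>) / \<delta>)\<^sup>2 * P\<^sup>2 * broad_sum r a x)"
    by (elim disjE) (use less_imp_le in blast, blast)
  then obtain r a where ra: "r \<le> k" "a \<in> \<Theta> r" "5 * \<alpha> / (8 * real N) \<le> (1 + \<delta>) ^ r * cmod (Bk r a x)"
    "r = k \<or> (cmod (Bk r a x)) ^ 4 \<le> ((1 + \<delta>) / \<delta>)\<^sup>2 * P\<^sup>2 * broad_sum r a x"
    by blast
  have "5 * \<alpha> / (8 * real N) \<le> 21 / 16 * cmod (Bk r a x)"
    using ra(3) mult_right_mono[OF one_plus_quarter_power_le[of r N], of "cmod (Bk r a x)"] ra(1) k N1
    by (simp add: \<delta>_def)
  \<comment> \<open>Here 21/10 is 21/16, the narrow loss, times 8/5 from the hypothesis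
    \<open>big\<close>.\<close>
  then have lower: "\<alpha> \<le> 21 / 10 * real N * cmod (Bk r a x)" using N1 by (simp add: field_simps)
  have hh_ge: "(cmod (Bk r a x))\<^sup>2 \<le> n * hh k r a x"
  proof -
    have eq: "Bk r a x = (\<Sum>b\<in>cl k r a. Bk k b x)" unfolding Bk_def by (rule sum_cl_regroup[OF ra(1)])
    have "card {b\<in>cl k r a. Bk k b x \<noteq> 0} \<le> card {b\<in>\<Theta> k. Bk k b x \<noteq> 0}"
      by (intro card_mono) (auto simp: cl_def)
    then have "real (card {b\<in>cl k r a. Bk k b x \<noteq> 0}) \<le> n" using support by linarith
    then show ?thesis unfolding eq hh_def by (intro sum_power2_le_card_support) auto
  qed
  have "V k r a x"
  proof -
    have "LL k r a x \<le> (\<Sum>c\<in>\<Theta> N. E k (w c) x)"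
      unfolding LL_def by (intro sum_mono2 E_w_nonneg) (auto simp: cl_def)
    also have "\<dots> \<le> 5 * \<alpha>\<^sup>2 / (72 * (real N)\<^sup>2 * n)" by (rule low)
    also have "\<dots> \<le> 5 * (21 / 10 * real N * cmod (Bk r a x))\<^sup>2 / (72 * (real N)\<^sup>2 * n)"
      using lower \<alpha> n N1 by (intro divide_right_mono mult_left_mono power_mono) auto
    \<comment> \<open>49/160 is 5/72 times the square of 21/10, and it is below the 1/3 that
      \<open>V\<close> requires.\<close>
    also have "\<dots> = 49 / 160 * ((cmod (Bk r a x))\<^sup>2 / n)"
      using N1 n by (simp add: power_mult_distrib field_simps)
    also have "\<dots> \<le> 49 / 160 * hh k r a x" using hh_ge n by (simp add: field_simps)
    finally show ?thesis using hh_nonneg[of k r a x] by (simp add: V_def)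
  qed
  have four: "(cmod (Bk r a x)) ^ 4 \<le> 25 * (real N)\<^sup>2 * P\<^sup>2 * \<Phi> k r a x"
  proof (cases "r = k")
    case True
    have "cl k k a = {a}"
    proof -
      have "b = a" if "b \<in> cl k k a" for b
        using that ra(2) True Theta_unique[of b k a] by (auto simp: cl_def)
      moreover have "a \<in> cl k k a" using ra(2) True by simp
      ultimately show ?thesis by blast
    qed
    then have "(cmod (Bk r a x)) ^ 4 = 1 * \<Phi> k r a x"
      using \<open>V k r a x\<close> True by (simp add: \<Phi>_def hh_def flip: power_mult)
    also have "\<dots> \<le> 25 * (real N)\<^sup>2 * P\<^sup>2 * \<Phi> k r a x"
    proof (intro mult_right_mono Phi_nonneg)
      have "1 * 1 \<le> (25 * (real N)\<^sup>2) * P\<^sup>2"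
        using N1 P_ge_1 by (intro mult_mono) (auto simp: one_le_power intro: order_trans[of 1 "(real N)\<^sup>2"])
      then show "1 \<le> 25 * (real N)\<^sup>2 * P\<^sup>2" by simp
    qed
    finally show ?thesis .
  next
    case False
    then have "(cmod (Bk r a x)) ^ 4 \<le> ((1 + \<delta>) / \<delta>)\<^sup>2 * (P\<^sup>2 * \<Phi> k r a x)"
      using ra(4) \<open>V k r a x\<close> by (simp add: \<Phi>_def mult.assoc)
    also have "\<dots> \<le> 25 * (real N)\<^sup>2 * (P\<^sup>2 * \<Phi> k r a x)"
      using ratio Phi_nonneg[of k r a x] by (intro mult_right_mono) auto
    finally show ?thesis by (simp add: mult.assoc)
  qed
  have "\<alpha> ^ 4 \<le> (21 / 10 * real N * cmod (Bk r a x)) ^ 4" using lower \<alpha> by (intro power_mono) auto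
  also have "\<dots> = (21 / 10) ^ 4 * real N ^ 4 * (cmod (Bk r a x)) ^ 4" by (simp only: power_mult_distrib)
  also have "\<dots> \<le> (21 / 10) ^ 4 * real N ^ 4 * (25 * (real N)\<^sup>2 * P\<^sup>2 * \<Phi> k r a x)"
    using four by (intro mult_left_mono) auto
  also have "\<dots> = (21 / 10) ^ 4 * 25 * real N ^ 6 * P\<^sup>2 * \<Phi> k r a x"
    by (simp add: power_add[of "real N" 4 2, simplified] mult_ac)
  also have "\<dots> \<le> (\<Sum>a\<in>\<Theta> r. (21 / 10) ^ 4 * 25 * real N ^ 6 * P\<^sup>2 * \<Phi> k r a x)"
    using ra(2) Phi_nonneg by (intro member_le_sum) auto
  also have "\<dots> \<le> (\<Sum>r\<in>{..k}. \<Sum>a\<in>\<Theta> r. (21 / 10) ^ 4 * 25 * real N ^ 6 * P\<^sup>2 * \<Phi> k r a x)"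
    using ra(1) Phi_nonneg
    by (intro member_le_sum[of r "{..k}" "\<lambda>r. \<Sum>a\<in>\<Theta> r. (21 / 10) ^ 4 * 25 * real N ^ 6 * P\<^sup>2 * \<Phi> k r a x"] sum_nonneg) auto
  finally show ?thesis .
qed

lemma superlevel_estimate:
  assumes k: "k < N" and \<alpha>: "0 < \<alpha>" and n: "0 < n"
    and support: "\<And>x. real (card {b\<in>\<Theta> k. Bk k b x \<noteq> 0}) \<le> n"
    and low: "\<And>x. (\<Sum>c\<in>\<Theta> N. E k (w c) x) \<le> 5 * \<alpha>\<^sup>2 / (72 * (real N)\<^sup>2 * n)"
  shows "(\<integral>x. (if 5 * \<alpha> / (8 * real N) < cmod (\<Sum>c\<in>\<Theta> N. B c x) then \<alpha> ^ 4 else 0) \<partial>mu)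
    \<le> real N * ((21 / 10) ^ 4 * 25 * real N ^ 6 * P\<^sup>2 * (P\<^sup>2 * (9 / 4 * ((P\<^sup>2 + 2 * P) * (\<Sum>b\<in>\<Theta> k. \<integral>x. (ws k b x)\<^sup>2 \<partial>mu)))))"
proof -
  let ?C = "(21 / 10) ^ 4 * 25 * real N ^ 6 * P\<^sup>2"
  let ?w = "\<lambda>b. \<integral>x. (ws k b x)\<^sup>2 \<partial>mu"
  let ?f = "\<lambda>x. \<Sum>c\<in>\<Theta> N. B c x"
  have C0: "0 \<le> ?C" by simp
  have n1: "nice (\<lambda>x. if 5 * \<alpha> / (8 * real N) < cmod (?f x) then \<alpha> ^ 4 else 0)"
    by (rule nice_comp[OF nice_total, where \<phi> = "\<lambda>y. if 5 * \<alpha> / (8 * real N) < cmod y then \<alpha> ^ 4 else 0"])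
      (use \<alpha> in \<open>simp add: not_less\<close>)
  have "(\<integral>x. (if 5 * \<alpha> / (8 * real N) < cmod (?f x) then \<alpha> ^ 4 else 0) \<partial>mu)
      \<le> (\<integral>x. (\<Sum>r\<in>{..k}. \<Sum>a\<in>\<Theta> r. ?C * \<Phi> k r a x) \<partial>mu)"
  proof (rule nice_integral_mono[OF n1])
    show "nice (\<lambda>x. \<Sum>r\<in>{..k}. \<Sum>a\<in>\<Theta> r. ?C * \<Phi> k r a x)" by (intro nice_sum nice_cmult nice_Phi)
    fix x
    have "0 \<le> (\<Sum>r\<in>{..k}. \<Sum>a\<in>\<Theta> r. ?C * \<Phi> k r a x)" by (intro sum_nonneg mult_nonneg_nonneg C0 Phi_nonneg)
    then show "(if 5 * \<alpha> / (8 * real N) < cmod (?f x) then \<alpha> ^ 4 else 0) \<le> (\<Sum>r\<in>{..k}. \<Sum>a\<in>\<Theta> r. ?C * \<Phi> k r a x)"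
      using superlevel_pointwise[OF k \<alpha> n support low] by simp
  qed
  also have "\<dots> = (\<Sum>r\<in>{..k}. \<Sum>a\<in>\<Theta> r. ?C * (\<integral>x. \<Phi> k r a x \<partial>mu))"
    by (subst nice_integral_sum, intro nice_sum nice_cmult nice_Phi, intro sum.cong refl,
        subst nice_integral_sum, intro nice_cmult nice_Phi, simp)
  also have "\<dots> \<le> (\<Sum>r\<in>{..k}. \<Sum>a\<in>\<Theta> r. ?C * (P\<^sup>2 * (9 / 4 * ((P\<^sup>2 + 2 * P) * (\<Sum>b\<in>cl k r a. ?w b)))))"
    using k by (intro sum_mono mult_left_mono integral_Phi_le C0) auto
  \<comment> \<open>Every level-\<open>k\<close> arc lies in exactly one arc of level
    \<open>r\<close>, so each of the \<open>Suc k \<le> N\<close> levels contributes the same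
    total.\<close>
  also have "\<dots> = (\<Sum>r\<in>{..k}. ?C * (P\<^sup>2 * (9 / 4 * ((P\<^sup>2 + 2 * P) * (\<Sum>b\<in>\<Theta> k. ?w b)))))"
  proof (intro sum.cong refl)
    fix r
    show "(\<Sum>a\<in>\<Theta> r. ?C * (P\<^sup>2 * (9 / 4 * ((P\<^sup>2 + 2 * P) * (\<Sum>b\<in>cl k r a. ?w b)))))
        = ?C * (P\<^sup>2 * (9 / 4 * ((P\<^sup>2 + 2 * P) * (\<Sum>b\<in>\<Theta> k. ?w b))))"
      unfolding sum_Theta_regroup[of ?w k r] by (simp only: sum_distrib_left)
  qed
  also have "\<dots> = real (Suc k) * (?C * (P\<^sup>2 * (9 / 4 * ((P\<^sup>2 + 2 * P) * (\<Sum>b\<in>\<Theta> k. ?w b)))))" by simp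
  also have "\<dots> \<le> real N * (?C * (P\<^sup>2 * (9 / 4 * ((P\<^sup>2 + 2 * P) * (\<Sum>b\<in>\<Theta> k. ?w b)))))"
    using k C0 by (intro mult_right_mono mult_nonneg_nonneg sum_nonneg integral_nonneg_AE) auto
  finally show ?thesis .
qed

lemma sum_ws_square_le:
  assumes "k \<le> N"
  shows "(\<Sum>b\<in>\<Theta> k. \<integral>x. (ws k b x)\<^sup>2 \<partial>mu) \<le> P\<^sup>2 * (\<Sum>j\<in>{k..N}. \<Sum>b\<in>\<Theta> j. \<integral>x. (W j b x)\<^sup>2 \<partial>mu)"
proof -
  let ?W = "\<lambda>j b. \<integral>x. (W j b x)\<^sup>2 \<partial>mu"
  have "(\<Sum>b\<in>\<Theta> k. \<integral>x. (ws k b x)\<^sup>2 \<partial>mu) \<le> (\<Sum>b\<in>\<Theta> k. P\<^sup>2 * (\<Sum>j\<in>{k..N}. \<Sum>b'\<in>cl j k b. ?W j b'))"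
    unfolding ws_def by (intro sum_mono square_sum_w_le assms)
  also have "\<dots> = P\<^sup>2 * (\<Sum>j\<in>{k..N}. \<Sum>b\<in>\<Theta> k. \<Sum>b'\<in>cl j k b. ?W j b')"
    by (simp add: sum_distrib_left sum.swap[of _ "{k..N}"])
  also have "(\<Sum>j\<in>{k..N}. \<Sum>b\<in>\<Theta> k. \<Sum>b'\<in>cl j k b. ?W j b') = (\<Sum>j\<in>{k..N}. \<Sum>b\<in>\<Theta> j. ?W j b)"
    by (intro sum.cong refl sum_Theta_regroup[symmetric])
  finally show ?thesis .
qed

lemma sum_ws_square_children_le:
  "(\<Sum>b\<in>\<Theta> k. \<integral>x. (ws k b x)\<^sup>2 \<partial>mu) \<le> P * (\<Sum>b\<in>\<Theta> (Suc k). \<integral>x. (ws (Suc k) b x)\<^sup>2 \<partial>mu)"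
proof -
  have "(\<Sum>b\<in>\<Theta> k. \<integral>x. (ws k b x)\<^sup>2 \<partial>mu) \<le> (\<Sum>b\<in>\<Theta> k. P * (\<Sum>b'\<in>cl (Suc k) k b. \<integral>x. (ws (Suc k) b' x)\<^sup>2 \<partial>mu))"
    unfolding ws_def by (intro sum_mono square_sum_w_children_le)
  also have "\<dots> = P * (\<Sum>b\<in>\<Theta> k. \<Sum>b'\<in>cl (Suc k) k b. \<integral>x. (ws (Suc k) b' x)\<^sup>2 \<partial>mu)"
    by (simp only: sum_distrib_left)
  also have "\<dots> = P * (\<Sum>b\<in>\<Theta> (Suc k). \<integral>x. (ws (Suc k) b x)\<^sup>2 \<partial>mu)"
    by (simp only: sum_Theta_regroup[of _ "Suc k" k])
  finally show ?thesis .
qed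

text \<open>At level 0 there is only one arc, so \<open>hh 0 0 a\<close> is the squared modulus of
  the whole sum, and its second moment is the fourth moment.\<close>

lemma fourth_moment_le:
  "(\<integral>x. (cmod (\<Sum>c\<in>\<Theta> N. B c x)) ^ 4 \<partial>mu) \<le> (P\<^sup>2 + 1) * (\<Sum>b\<in>\<Theta> 0. \<integral>x. (ws 0 b x)\<^sup>2 \<partial>mu)"
proof -
  obtain a where a: "a \<in> \<Theta> 0" using Theta_ex[of 0 0] by auto
  have all: "\<Theta> 0 = {a}"
    using a Theta_unique[of _ 0 a] av_Theta[of _ 0] by (auto intro!: av_diff_leI)
  have cl0: "cl 0 0 a = {a}" using Theta_eq_cl[OF av_Theta[OF a], of 0] all by simp
  have "(cmod (\<Sum>c\<in>\<Theta> N. B c x)) ^ 4 = (hh 0 0 a x)\<^sup>2" for x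
    unfolding hh_def cl0 using Bk_0[OF a, of x] by (simp flip: power_mult)
  then show ?thesis using integral_hh_square_le[of 0 0 a] unfolding cl0 all by (simp add: distrib_right)
qed

end

subsection \<open>Pruning\<close>

text \<open>\<open>n k\<close> bounds the number of level-\<open>k\<close> arcs that carry
  something. The constant 5/72 is \<open>1 / (2 * (36 / 5))\<close>: the factor
  \<open>(exp 1)\<^sup>2 / 2\<close> of good tiles supplies it through
  \<open>exp_1_square_ge\<close>.\<close>

locale pruning = equivariant_family av \<pi> e mu N \<Theta> F
  for av :: "'a::field \<Rightarrow> real" and \<pi> :: 'a and e :: "'a \<Rightarrow> complex" and mu :: "('a \<times> 'a) measure"
    and N :: nat and \<Theta> :: "nat \<Rightarrow> 'a set" and F :: "'a \<Rightarrow> 'a \<times> 'a \<Rightarrow> complex" +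
  fixes thr n :: "nat \<Rightarrow> real" and \<alpha> :: real
  assumes N_pos: "1 \<le> N" and \<alpha>_pos: "0 < \<alpha>" and thr_pos: "\<And>k. k \<le> N \<Longrightarrow> 0 < thr k"
    and n_pos: "\<And>k. k \<le> N \<Longrightarrow> 0 < n k"
    and card_active_le: "\<And>k. k \<le> N \<Longrightarrow> real (card {b\<in>\<Theta> k. \<exists>c\<in>cl N k b. \<exists>x. F c x \<noteq> 0}) \<le> n k"
    and thr_le: "\<And>k. k \<le> N \<Longrightarrow> thr k * (n k)\<^sup>2 \<le> 5 * \<alpha>\<^sup>2 / (72 * (real N)\<^sup>2)"
begin

lemma W_invariant: assumes "j \<le> N" "t \<in> T j c" shows "W j c (x + t) = W j c x"
  unfolding W_eq
proof (intro sum.cong refl)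
  fix d assume d: "d \<in> cl N j c"
  then have "t \<in> T j d" using assms(2) T_cong[of d c j] by (simp add: cl_def)
  then show "E j (\<lambda>x. (cmod (F d x))\<^sup>2) (x + t) = E j (\<lambda>x. (cmod (F d x))\<^sup>2) x"
    using w_invariant[OF cl_subset[OF d]] by (intro E_T_invariant[OF assms(1), of d]) auto
qed

lemma W_cong: "av (c - b) \<le> 1 / P ^ j \<Longrightarrow> W j c x = W j b x"
  unfolding W_def by (simp add: cl_cong)

lemma lconst_W: "lconst (W j c)"
  by (intro nice_lconst nice_W)

definition cut :: "('a \<Rightarrow> 'a \<times> 'a \<Rightarrow> bool) \<Rightarrow> 'a \<Rightarrow> 'a \<times> 'a \<Rightarrow> complex" where
  "cut ok c x = (if ok c x then F c x else 0)"

lemma equivariant_cut: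
  assumes "\<And>c. c \<in> \<Theta> N \<Longrightarrow> lconst (ok c)" "\<And>c t x. c \<in> \<Theta> N \<Longrightarrow> t \<in> T N c \<Longrightarrow> ok c (x + t) = ok c x"
  shows "equivariant_family av \<pi> e mu N \<Theta> (cut ok)"
proof unfold_locales
  show "nice (cut ok c)" if "c \<in> \<Theta> N" for c
    unfolding cut_def[abs_def] using that by (intro nice_if nice_B assms)
  show "cut ok c (x + t) = e (- (fst t * c + snd t * c\<^sup>2)) * cut ok c x" if "c \<in> \<Theta> N" "t \<in> T N c" for c t x
    using assms(2)[OF that] B_twist[OF that] by (simp add: cut_def)
qed

text \<open>Level 0 is the coarsest and \<open>N\<close> the finest. The test uses \<open>W\<close>
  of the uncut family; for \<open>k = Suc N\<close> it is vacuous.\<close>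

definition good_above :: "nat \<Rightarrow> 'a \<Rightarrow> 'a \<times> 'a \<Rightarrow> bool" where
  "good_above k c x \<longleftrightarrow> (\<forall>i\<in>{k..N}. thr i \<le> W i c x)"

text \<open>The order is from fine to coarse: \<open>k\<close> is the first bad level met when
  starting at \<open>N\<close>.\<close>

definition first_bad :: "nat \<Rightarrow> 'a \<Rightarrow> 'a \<times> 'a \<Rightarrow> bool" where
  "first_bad k c x \<longleftrightarrow> good_above (Suc k) c x \<and> W k c x < thr k"

lemma lconst_good_above: "lconst (good_above k c)"
  unfolding good_above_def[abs_def]
  by (intro lconst_ball lconst_comp[OF lconst_W, where \<phi> = "\<lambda>y. thr _ \<le> y"]) auto

lemma lconst_first_bad: "lconst (first_bad k c)"
  unfolding first_bad_def[abs_def]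
  by (intro lconst_comp2[where \<phi> = "\<lambda>p y. p \<and> y < thr k"] lconst_good_above lconst_W)

lemma good_above_invariant: assumes "t \<in> T N c" shows "good_above k c (x + t) = good_above k c x"
proof -
  have "W i c (x + t) = W i c x" if "i \<le> N" for i
    using W_invariant[OF that] T_mono[OF that] assms by blast
  then show ?thesis by (simp add: good_above_def)
qed

lemma first_bad_invariant: assumes "k \<le> N" "t \<in> T N c" shows "first_bad k c (x + t) = first_bad k c x"
proof -
  have "W k c (x + t) = W k c x" using assms T_mono[OF assms(1)] by (intro W_invariant) auto
  then show ?thesis unfolding first_bad_def good_above_invariant[OF assms(2)] by simp
qed

text \<open>Telescoping: \<open>good_above m\<close> is \<open>good_above (Suc m)\<close> minus the
  points bad at level \<open>m\<close>, and \<open>good_above (Suc N)\<close> holds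
  everywhere.\<close>

lemma F_decomposition: "F c x = cut (good_above 0) c x + (\<Sum>k\<in>{..N}. cut (first_bad k) c x)"
proof -
  have "cut (good_above m) c x = cut (good_above 0) c x + (\<Sum>k<m. cut (first_bad k) c x)" if "m \<le> Suc N" for m
    using that
  proof (induction m)
    case (Suc m)
    have "{m..N} = insert m {Suc m..N}" using Suc.prems by auto
    then have "good_above m c x \<longleftrightarrow> thr m \<le> W m c x \<and> good_above (Suc m) c x" by (simp add: good_above_def)
    then have "cut (good_above (Suc m)) c x = cut (good_above m) c x + cut (first_bad m) c x"
      by (auto simp: cut_def first_bad_def)
    then show ?case using Suc by simp
  qed simp
  from this[of "Suc N"] show ?thesis
    by (simp add: cut_def[of "good_above (Suc N)"] good_above_def[of "Suc N"] lessThan_Suc_atMost)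
qed

section \<open>Tile averages of the cut pieces\<close>

abbreviation Wc :: "('a \<Rightarrow> 'a \<times> 'a \<Rightarrow> bool) \<Rightarrow> nat \<Rightarrow> 'a \<Rightarrow> 'a \<times> 'a \<Rightarrow> real" where
  "Wc ok j b x \<equiv> E j (\<lambda>y. \<Sum>c\<in>cl N j b. (cmod (cut ok c y))\<^sup>2) x"

lemma Wc_le_W: "Wc ok j b x \<le> W j b x"
  unfolding W_def by (intro E_mono sum_mono) (simp add: cut_def)

text \<open>Shifts in \<open>Y j\<close> stay inside the tile and nearby directions share it, so a
  level-\<open>j\<close> test has the same outcome at all points and caps entering one average.
  Cutting therefore keeps or kills a whole level-\<open>j\<close> average when only that test
  matters.\<close>

lemma W_horizontal:
  assumes "j \<le> N" "c \<in> cl N j b" "h \<in> Y j" shows "W j c (x + (h, 0)) = W j b x"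
proof -
  have "W j c (x + (h, 0)) = W j c x" by (intro W_invariant assms T_horizontal av_Y)
  then show ?thesis using W_cong[of c b j x] assms(2) by (simp add: cl_def)
qed

lemma Wc_eq_0:
  assumes "j \<le> N" "\<And>c y. c \<in> cl N j b \<Longrightarrow> W j c y = W j b x \<Longrightarrow> \<not> ok c y"
  shows "Wc ok j b x = 0"
  using assms(2) W_horizontal[OF assms(1)] by (intro E_const_0 sum.neutral) (simp add: cut_def)

lemma Wc_good_le:
  assumes "j \<le> N" "\<And>c y. c \<in> \<Theta> N \<Longrightarrow> ok c y \<Longrightarrow> thr j \<le> W j c y"
  shows "Wc ok j b x \<le> (if thr j \<le> W j b x then W j b x else 0)"
proof (cases "thr j \<le> W j b x")
  case False
  have "Wc ok j b x = 0"
    using assms(2) cl_subset False by (intro Wc_eq_0[OF assms(1)]) fastforce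
  then show ?thesis using False by simp
qed (use Wc_le_W in simp)

text \<open>The contribution of scale \<open>1 / P ^ j\<close> to the right-hand side of the
  theorem, in integral form; \<open>sum_good_tiles\<close> makes the translation.\<close>

definition S :: "nat \<Rightarrow> real" where
  "S j = (\<Sum>b\<in>\<Theta> j. \<integral>x. (if thr j \<le> W j b x then (W j b x)\<^sup>2 else 0) \<partial>mu)"

lemma S_nonneg: "0 \<le> S j"
  unfolding S_def by (intro sum_nonneg integral_nonneg_AE) auto

lemma sum_Wc_square_le:
  assumes "j \<le> N" "\<And>c y. c \<in> \<Theta> N \<Longrightarrow> ok c y \<Longrightarrow> thr j \<le> W j c y"
    and "equivariant_family av \<pi> e mu N \<Theta> (cut ok)"
  shows "(\<Sum>b\<in>\<Theta> j. \<integral>x. (Wc ok j b x)\<^sup>2 \<partial>mu) \<le> S j"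
  unfolding S_def
proof (intro sum_mono nice_integral_mono)
  interpret C: equivariant_family av \<pi> e mu N \<Theta> "cut ok" by (rule assms(3))
  fix b
  show "nice (\<lambda>x. (Wc ok j b x)\<^sup>2)"
    using C.nice_W[of j b] unfolding C.W_def[abs_def] by (rule nice_power2)
  show "nice (\<lambda>x. if thr j \<le> W j b x then (W j b x)\<^sup>2 else 0)"
    by (intro nice_if nice_power2 nice_W lconst_comp[OF lconst_W, where \<phi> = "\<lambda>y. thr j \<le> y"])
  fix x
  have nonneg: "0 \<le> Wc ok j b x" by (intro E_nonneg sum_nonneg) simp
  have le: "Wc ok j b x \<le> (if thr j \<le> W j b x then W j b x else 0)"
    by (rule Wc_good_le[OF assms(1)]) (rule assms(2))
  have "(Wc ok j b x)\<^sup>2 \<le> (if thr j \<le> W j b x then W j b x else 0)\<^sup>2"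
    by (rule power_mono[OF le nonneg])
  then show "(Wc ok j b x)\<^sup>2 \<le> (if thr j \<le> W j b x then (W j b x)\<^sup>2 else 0)"
    by (cases "thr j \<le> W j b x") simp_all
qed

abbreviation total_cut :: "('a \<Rightarrow> 'a \<times> 'a \<Rightarrow> bool) \<Rightarrow> 'a \<times> 'a \<Rightarrow> complex" where
  "total_cut ok x \<equiv> (\<Sum>c\<in>\<Theta> N. cut ok c x)"

text \<open>Chebyshev with the fourth moment; 6561 is the fourth power of 9, as this part may use
  \<alpha> / 9. All levels are good here, so all averages are bounded by \<open>S\<close>.\<close>

lemma good_estimate:
  "(\<integral>x. (if \<alpha> / 9 < cmod (total_cut (good_above 0) x) then \<alpha> ^ 4 else 0) \<partial>mu)
    \<le> 6561 * ((P\<^sup>2 + 1) * (P\<^sup>2 * (\<Sum>j\<in>{0..N}. S j)))"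
proof -
  let ?ok = "good_above 0"
  have eq: "equivariant_family av \<pi> e mu N \<Theta> (cut ?ok)"
    by (intro equivariant_cut lconst_good_above good_above_invariant)
  interpret C: equivariant_family av \<pi> e mu N \<Theta> "cut ?ok" by (rule eq)
  have "(\<integral>x. (if \<alpha> / 9 < cmod (total_cut ?ok x) then \<alpha> ^ 4 else 0) \<partial>mu)
      \<le> (\<integral>x. 6561 * (cmod (total_cut ?ok x)) ^ 4 \<partial>mu)"
  proof (rule nice_integral_mono)
    show "nice (\<lambda>x. if \<alpha> / 9 < cmod (total_cut ?ok x) then \<alpha> ^ 4 else 0)"
      by (rule nice_comp[OF C.nice_total, where \<phi> = "\<lambda>y. if \<alpha> / 9 < cmod y then \<alpha> ^ 4 else 0"])
        (use \<alpha>_pos in simp)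
    show "nice (\<lambda>x. 6561 * (cmod (total_cut ?ok x)) ^ 4)"
      by (rule nice_comp[OF C.nice_total, where \<phi> = "\<lambda>y. 6561 * (cmod y) ^ 4"]) simp
    fix x
    have "(\<alpha> / 9) ^ 4 \<le> (cmod (total_cut ?ok x)) ^ 4" if "\<alpha> / 9 < cmod (total_cut ?ok x)"
      using that \<alpha>_pos by (intro power_mono) auto
    then show "(if \<alpha> / 9 < cmod (total_cut ?ok x) then \<alpha> ^ 4 else 0) \<le> 6561 * (cmod (total_cut ?ok x)) ^ 4"
      by (auto simp: power_divide)
  qed
  also have "\<dots> = 6561 * (\<integral>x. (cmod (total_cut ?ok x)) ^ 4 \<partial>mu)" by simp
  also have "\<dots> \<le> 6561 * ((P\<^sup>2 + 1) * (P\<^sup>2 * (\<Sum>j\<in>{0..N}. S j)))"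
  proof (intro mult_left_mono)
    have "(\<integral>x. (cmod (total_cut ?ok x)) ^ 4 \<partial>mu) \<le> (P\<^sup>2 + 1) * (\<Sum>b\<in>\<Theta> 0. \<integral>x. (C.ws 0 b x)\<^sup>2 \<partial>mu)"
      by (rule C.fourth_moment_le)
    also have "\<dots> \<le> (P\<^sup>2 + 1) * (P\<^sup>2 * (\<Sum>j\<in>{0..N}. \<Sum>b\<in>\<Theta> j. \<integral>x. (C.W j b x)\<^sup>2 \<partial>mu))"
      by (intro mult_left_mono C.sum_ws_square_le) auto
    also have "\<dots> \<le> (P\<^sup>2 + 1) * (P\<^sup>2 * (\<Sum>j\<in>{0..N}. S j))"
      unfolding C.W_def using eq
      by (intro mult_left_mono sum_mono sum_Wc_square_le) (auto simp: good_above_def)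
    finally show "(\<integral>x. (cmod (total_cut ?ok x)) ^ 4 \<partial>mu) \<le> (P\<^sup>2 + 1) * (P\<^sup>2 * (\<Sum>j\<in>{0..N}. S j))" .
  qed simp
  finally show ?thesis .
qed

text \<open>The level-\<open>k\<close> averages of this piece are at most \<open>thr k\<close>: over
  a bad tile because cutting only decreases them, over a good one because the piece vanishes there.
  Summed over the active arcs this is the smallness that \<open>superlevel_estimate\<close> asks
  for. The resulting bound is pushed to levels \<open>Suc k\<close> and finer, where the piece lives
  on good tiles.\<close>

lemma bad_estimate:
  assumes k: "k < N"
  shows "(\<integral>x. (if 5 * \<alpha> / (8 * real N) < cmod (total_cut (first_bad k) x) then \<alpha> ^ 4 else 0) \<partial>mu)
    \<le> real N * ((21 / 10) ^ 4 * 25 * real N ^ 6 * P\<^sup>2 * (P\<^sup>2 * (9 / 4 * ((P\<^sup>2 + 2 * P) * (P * (P\<^sup>2 * (\<Sum>j\<in>{0..N}. S j)))))))"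
proof -
  let ?ok = "first_bad k"
  have kN: "k \<le> N" using k by simp
  have eq: "equivariant_family av \<pi> e mu N \<Theta> (cut ?ok)"
    using first_bad_invariant[OF kN] by (intro equivariant_cut lconst_first_bad)
  interpret C: equivariant_family av \<pi> e mu N \<Theta> "cut ?ok" by (rule eq)
  let ?act = "{b\<in>\<Theta> k. \<exists>c\<in>cl N k b. \<exists>x. F c x \<noteq> 0}"
  have C_support: "real (card {b\<in>\<Theta> k. C.Bk k b x \<noteq> 0}) \<le> n k" for x
  proof -
    have "b \<in> ?act" if b: "b \<in> \<Theta> k" "C.Bk k b x \<noteq> 0" for b
    proof -
      obtain c where c: "c \<in> cl N k b" "cut ?ok c x \<noteq> 0"
        using b(2) unfolding C.Bk_def by (rule sum.not_neutral_contains_not_neutral)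
      then have "F c x \<noteq> 0" by (auto simp: cut_def split: if_splits)
      then show ?thesis using b(1) c(1) by blast
    qed
    then have "{b\<in>\<Theta> k. C.Bk k b x \<noteq> 0} \<subseteq> ?act" by blast
    then have "card {b\<in>\<Theta> k. C.Bk k b x \<noteq> 0} \<le> card ?act" by (intro card_mono) auto
    then show ?thesis using card_active_le[OF kN] by linarith
  qed
  have C_low: "(\<Sum>c\<in>\<Theta> N. E k (\<lambda>x. (cmod (cut ?ok c x))\<^sup>2) x) \<le> 5 * \<alpha>\<^sup>2 / (72 * (real N)\<^sup>2 * n k)" for x
  proof -
    have le_thr: "Wc ?ok k b x \<le> thr k" for b
    proof (cases "W k b x < thr k")
      case False
      have "Wc ?ok k b x = 0"
        using False by (intro Wc_eq_0[OF kN]) (auto simp: first_bad_def)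
      then show ?thesis using thr_pos[OF kN] by simp
    qed (use Wc_le_W[where ok = ?ok and j = k and b = b and x = x] in simp)
    have zero: "Wc ?ok k b x = 0" if "b \<in> \<Theta> k - ?act" for b
    proof -
      have F0: "F c y = 0" if "c \<in> cl N k b" for c y using \<open>b \<in> \<Theta> k - ?act\<close> that by blast
      show ?thesis by (intro E_const_0 sum.neutral) (simp add: cut_def F0)
    qed
    have "(\<Sum>c\<in>\<Theta> N. E k (\<lambda>x. (cmod (cut ?ok c x))\<^sup>2) x) = (\<Sum>b\<in>\<Theta> k. Wc ?ok k b x)"
      unfolding sum_Theta_regroup[of _ N k] E_sum ..
    also have "\<dots> = (\<Sum>b\<in>?act. Wc ?ok k b x)"
      using zero by (intro sum.mono_neutral_right) auto
    also have "\<dots> \<le> real (card ?act) * thr k" using le_thr by (intro sum_bounded_above)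
    also have "\<dots> \<le> n k * thr k"
      using card_active_le[OF kN] thr_pos[OF kN] by (intro mult_right_mono) auto
    also have "\<dots> \<le> 5 * \<alpha>\<^sup>2 / (72 * (real N)\<^sup>2 * n k)"
    proof -
      have "n k * thr k * n k \<le> 5 * \<alpha>\<^sup>2 / (72 * (real N)\<^sup>2)"
        using thr_le[OF kN] by (simp add: power2_eq_square mult_ac)
      then show ?thesis using n_pos[OF kN] by (simp add: pos_le_divide_eq divide_divide_eq_left[symmetric] del: divide_divide_eq_left)
    qed
    finally show ?thesis .
  qed
  have sq: "(\<Sum>b\<in>\<Theta> k. \<integral>x. (C.ws k b x)\<^sup>2 \<partial>mu) \<le> P * (P\<^sup>2 * (\<Sum>j\<in>{0..N}. S j))"
  proof -
    have "(\<Sum>b\<in>\<Theta> k. \<integral>x. (C.ws k b x)\<^sup>2 \<partial>mu) \<le> P * (\<Sum>b\<in>\<Theta> (Suc k). \<integral>x. (C.ws (Suc k) b x)\<^sup>2 \<partial>mu)"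
      by (rule C.sum_ws_square_children_le)
    also have "\<dots> \<le> P * (P\<^sup>2 * (\<Sum>j\<in>{Suc k..N}. \<Sum>b\<in>\<Theta> j. \<integral>x. (C.W j b x)\<^sup>2 \<partial>mu))"
      using k by (intro mult_left_mono C.sum_ws_square_le) auto
    also have "\<dots> \<le> P * (P\<^sup>2 * (\<Sum>j\<in>{Suc k..N}. S j))"
      unfolding C.W_def using eq
      by (intro mult_left_mono sum_mono sum_Wc_square_le) (auto simp: first_bad_def good_above_def)
    also have "\<dots> \<le> P * (P\<^sup>2 * (\<Sum>j\<in>{0..N}. S j))"
      using S_nonneg by (intro mult_left_mono sum_mono2) auto
    finally show ?thesis .
  qed
  have "(\<integral>x. (if 5 * \<alpha> / (8 * real N) < cmod (total_cut ?ok x) then \<alpha> ^ 4 else 0) \<partial>mu)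
    \<le> real N * ((21 / 10) ^ 4 * 25 * real N ^ 6 * P\<^sup>2 * (P\<^sup>2 * (9 / 4 * ((P\<^sup>2 + 2 * P) * (\<Sum>b\<in>\<Theta> k. \<integral>x. (C.ws k b x)\<^sup>2 \<partial>mu)))))"
    by (rule C.superlevel_estimate[OF k \<alpha>_pos n_pos[OF kN] C_support C_low])
  also have "\<dots> \<le> real N * ((21 / 10) ^ 4 * 25 * real N ^ 6 * P\<^sup>2 * (P\<^sup>2 * (9 / 4 * ((P\<^sup>2 + 2 * P) * (P * (P\<^sup>2 * (\<Sum>j\<in>{0..N}. S j)))))))"
    using sq by (intro mult_left_mono) auto
  finally show ?thesis .
qed

text \<open>At the finest level the average is \<open>(cmod (F c))\<^sup>2\<close> itself, so
  badness is a pointwise bound and no superlevel estimate is needed. The number 19/72 is just above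
  the square root of 5/72.\<close>

lemma last_bad_small: "cmod (total_cut (first_bad N) x) \<le> 19 / 72 * \<alpha>"
proof -
  let ?act = "{b\<in>\<Theta> N. \<exists>c\<in>cl N N b. \<exists>x. F c x \<noteq> 0}"
  have small: "cmod (cut (first_bad N) c x) \<le> sqrt (thr N)" if c: "c \<in> \<Theta> N" for c
  proof (cases "first_bad N c x")
    case True
    have "cl N N c = {c}" using c Theta_unique[of _ N c] cl_self[OF c, of N] by (auto simp: cl_def)
    then have "W N c x = (cmod (F c x))\<^sup>2"
      unfolding W_eq using E_N[of c "\<lambda>x. (cmod (F c x))\<^sup>2"] w_invariant[OF c] by simp
    then have "(cmod (F c x))\<^sup>2 \<le> thr N" using True by (simp add: first_bad_def)
    then show ?thesis using True by (simp add: cut_def real_le_rsqrt)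
  qed (use thr_pos[of N] in \<open>simp add: cut_def\<close>)
  have "cut (first_bad N) c x = 0" if "c \<in> \<Theta> N - ?act" for c
  proof -
    have "F c x = 0" using that cl_self[of c N N] by blast
    then show ?thesis by (simp add: cut_def)
  qed
  then have "total_cut (first_bad N) x = (\<Sum>c\<in>?act. cut (first_bad N) c x)"
    by (intro sum.mono_neutral_right) auto
  then have "cmod (total_cut (first_bad N) x) \<le> (\<Sum>c\<in>?act. cmod (cut (first_bad N) c x))"
    by (simp add: norm_sum)
  also have "\<dots> \<le> real (card ?act) * sqrt (thr N)"
    using small by (intro sum_bounded_above) auto
  also have "\<dots> \<le> n N * sqrt (thr N)"
    using card_active_le[of N] thr_pos[of N] by (intro mult_right_mono) auto
  also have "\<dots> \<le> 19 / 72 * \<alpha>"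
  proof (rule power2_le_imp_le)
    have "(n N * sqrt (thr N))\<^sup>2 = thr N * (n N)\<^sup>2" using thr_pos[of N] by (simp add: power_mult_distrib)
    also have "\<dots> \<le> 5 * \<alpha>\<^sup>2 / (72 * (real N)\<^sup>2)" by (rule thr_le) simp
    also have "\<dots> \<le> 5 * \<alpha>\<^sup>2 / (72 * 1)"
      using N_pos by (intro divide_left_mono mult_left_mono) (auto simp: one_le_power)
    also have "\<dots> \<le> (19 / 72 * \<alpha>)\<^sup>2" by (simp add: power_mult_distrib power2_eq_square)
    finally show "(n N * sqrt (thr N))\<^sup>2 \<le> (19 / 72 * \<alpha>)\<^sup>2" .
  qed (use \<alpha>_pos in simp)
  finally show ?thesis .
qed

lemma wave_envelope_estimate:
  "(\<integral>x. (if \<alpha> < cmod (\<Sum>c\<in>\<Theta> N. F c x) then \<alpha> ^ 4 else 0) \<partial>mu)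
    \<le> (6561 * ((P\<^sup>2 + 1) * P\<^sup>2) + real N * (real N * ((21 / 10) ^ 4 * 25 * real N ^ 6 * P\<^sup>2 * (P\<^sup>2 * (9 / 4 * ((P\<^sup>2 + 2 * P) * (P * P\<^sup>2))))))) * (\<Sum>j\<in>{0..N}. S j)"
proof -
  let ?g = "\<lambda>x. if \<alpha> / 9 < cmod (total_cut (good_above 0) x) then \<alpha> ^ 4 else 0"
  let ?b = "\<lambda>k x. if 5 * \<alpha> / (8 * real N) < cmod (total_cut (first_bad k) x) then \<alpha> ^ 4 else 0"
  let ?K = "real N * ((21 / 10) ^ 4 * 25 * real N ^ 6 * P\<^sup>2 * (P\<^sup>2 * (9 / 4 * ((P\<^sup>2 + 2 * P) * (P * (P\<^sup>2 * (\<Sum>j\<in>{0..N}. S j)))))))"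
  have N0: "0 < real N" using N_pos by simp
  interpret G: equivariant_family av \<pi> e mu N \<Theta> "cut (good_above 0)"
    by (intro equivariant_cut lconst_good_above good_above_invariant)
  have ng: "nice ?g"
    by (rule nice_comp[OF G.nice_total, where \<phi> = "\<lambda>y. if \<alpha> / 9 < cmod y then \<alpha> ^ 4 else 0"])
      (use \<alpha>_pos in simp)
  have nb: "nice (?b k)" if "k < N" for k
  proof -
    have "k \<le> N" using that by simp
    then interpret C: equivariant_family av \<pi> e mu N \<Theta> "cut (first_bad k)"
      by (intro equivariant_cut lconst_first_bad first_bad_invariant)
    show ?thesis
      by (rule nice_comp[OF C.nice_total, where \<phi> = "\<lambda>y. if 5 * \<alpha> / (8 * real N) < cmod y then \<alpha> ^ 4 else 0"])
        (use \<alpha>_pos in \<open>simp add: not_less\<close>)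
  qed
  have "(\<integral>x. (if \<alpha> < cmod (\<Sum>c\<in>\<Theta> N. F c x) then \<alpha> ^ 4 else 0) \<partial>mu) \<le> (\<integral>x. ?g x + (\<Sum>k<N. ?b k x) \<partial>mu)"
  proof (rule nice_integral_mono)
    show "nice (\<lambda>x. if \<alpha> < cmod (\<Sum>c\<in>\<Theta> N. F c x) then \<alpha> ^ 4 else 0)"
      by (rule nice_comp[OF nice_total, where \<phi> = "\<lambda>y. if \<alpha> < cmod y then \<alpha> ^ 4 else 0"])
        (use \<alpha>_pos in simp)
    show "nice (\<lambda>x. ?g x + (\<Sum>k<N. ?b k x))" by (intro nice_add ng nice_sum nb) simp
    fix x
    have a4: "0 \<le> \<alpha> ^ 4" by simp
    have b0: "0 \<le> (\<Sum>k<N. ?b k x)" by (intro sum_nonneg) simp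
    show "(if \<alpha> < cmod (\<Sum>c\<in>\<Theta> N. F c x) then \<alpha> ^ 4 else 0) \<le> ?g x + (\<Sum>k<N. ?b k x)"
    proof (cases "\<alpha> / 9 < cmod (total_cut (good_above 0) x) \<or> (\<exists>k<N. 5 * \<alpha> / (8 * real N) < cmod (total_cut (first_bad k) x))")
      case True
      then show ?thesis
      proof
        assume "\<alpha> / 9 < cmod (total_cut (good_above 0) x)"
        then show ?thesis using b0 a4 by simp
      next
        assume "\<exists>k<N. 5 * \<alpha> / (8 * real N) < cmod (total_cut (first_bad k) x)"
        then obtain k where k: "k < N" "5 * \<alpha> / (8 * real N) < cmod (total_cut (first_bad k) x)" by blast
        have "\<alpha> ^ 4 = ?b k x" using k(2) by simp
        also have "\<dots> \<le> (\<Sum>k<N. ?b k x)" using k(1) by (intro member_le_sum) auto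
        finally show ?thesis using a4 b0 by (auto intro: add_nonneg_nonneg order_trans)
      qed
    next
      \<comment> \<open>If no part exceeds its share, the sum is at most \<alpha>, since 1/9 + 5/8 +
        19/72 = 1.\<close>
      case False
      have "(\<Sum>c\<in>\<Theta> N. F c x) = total_cut (good_above 0) x + (\<Sum>k\<in>{..N}. total_cut (first_bad k) x)"
        by (subst F_decomposition) (simp add: sum.distrib sum.swap[of _ "{..N}"])
      also have "(\<Sum>k\<in>{..N}. total_cut (first_bad k) x) = (\<Sum>k<N. total_cut (first_bad k) x) + total_cut (first_bad N) x"
        by (simp add: lessThan_Suc_atMost[symmetric])
      finally have "cmod (\<Sum>c\<in>\<Theta> N. F c x)
          \<le> cmod (total_cut (good_above 0) x) + (cmod (\<Sum>k<N. total_cut (first_bad k) x) + cmod (total_cut (first_bad N) x))"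
        by (metis norm_triangle_le norm_triangle_ineq add_left_mono)
      also have "cmod (\<Sum>k<N. total_cut (first_bad k) x) \<le> (\<Sum>k<N. 5 * \<alpha> / (8 * real N))"
      proof (rule order_trans[OF norm_sum], rule sum_mono)
        show "cmod (total_cut (first_bad k) x) \<le> 5 * \<alpha> / (8 * real N)" if "k \<in> {..<N}" for k
          using False that not_less lessThan_iff by blast
      qed
      also have "(\<Sum>k<N. 5 * \<alpha> / (8 * real N)) = 5 / 8 * \<alpha>" using N0 by simp
      also have "cmod (total_cut (good_above 0) x) + (5 / 8 * \<alpha> + cmod (total_cut (first_bad N) x))
          \<le> \<alpha> / 9 + (5 / 8 * \<alpha> + 19 / 72 * \<alpha>)"
        using False last_bad_small[of x] by (intro add_mono) auto
      also have "\<dots> = \<alpha>" by simp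
      finally show ?thesis using b0 a4 by simp
    qed
  qed
  also have "\<dots> = (\<integral>x. ?g x \<partial>mu) + (\<Sum>k<N. \<integral>x. ?b k x \<partial>mu)"
  proof -
    have "(\<integral>x. (\<Sum>k<N. ?b k x) \<partial>mu) = (\<Sum>k<N. \<integral>x. ?b k x \<partial>mu)"
      by (rule nice_integral_sum) (use nb in blast)
    moreover have "nice (\<lambda>x. \<Sum>k<N. ?b k x)" by (intro nice_sum nb) simp
    ultimately show ?thesis using nice_integral_add[OF ng] by simp
  qed
  also have "\<dots> \<le> 6561 * ((P\<^sup>2 + 1) * (P\<^sup>2 * (\<Sum>j\<in>{0..N}. S j))) + (\<Sum>k<N. ?K)"
    by (intro add_mono good_estimate sum_mono bad_estimate) simp
  also have "\<dots> = (6561 * ((P\<^sup>2 + 1) * P\<^sup>2) + real N * (real N * ((21 / 10) ^ 4 * 25 * real N ^ 6 * P\<^sup>2 * (P\<^sup>2 * (9 / 4 * ((P\<^sup>2 + 2 * P) * (P * P\<^sup>2))))))) * (\<Sum>j\<in>{0..N}. S j)"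
    by (simp add: distrib_right mult.assoc)
  finally show ?thesis .
qed

end

context haar_local_field
begin

lemma nice_integral_pos:
  fixes g :: "'a \<times> 'a \<Rightarrow> real"
  assumes "nice g" "\<And>x. 0 \<le> g x" "0 < g a" shows "0 < (\<integral>x. g x \<partial>mu)"
proof -
  obtain d where d: "0 < d" "\<And>x t. nm t \<le> d \<Longrightarrow> g (x + t) = g x"
    using assms(1) unfolding nice_def lconst_def by blast
  obtain z where z: "z \<noteq> 0" "\<And>x. av x \<le> d \<longleftrightarrow> av x \<le> av z" using ex_av_radius[OF d(1)] by metis
  have zp: "0 < av z" using z(1) by (simp add: av_pos_iff)
  let ?B = "ball2 av a (av z)"
  have "measure mu ?B \<noteq> 0"
    using measure_ball2_inverse[OF z(1)] measure_ball2_shift[OF zp, of a] by auto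
  then have "0 < g a * measure mu ?B" using assms(3) by (simp add: zero_less_measure_iff)
  also have "\<dots> = (\<integral>x. g a * indicator ?B x \<partial>mu)" by simp
  also have "\<dots> \<le> (\<integral>x. g x \<partial>mu)"
  proof (rule nice_integral_mono)
    show "nice (\<lambda>x. g a * indicator ?B x)" by (intro nice_cmult nice_indicator_ball2 zp)
    show "nice g" by (rule assms(1))
    fix x
    show "g a * indicator ?B x \<le> g x"
    proof (cases "x \<in> ?B")
      case True
      then have "nm (x - a) \<le> d" using z(2) by (simp add: mem_ball2_iff nm_le_iff)
      then have "g x = g a" using d(2)[of "x - a" a] by simp
      then show ?thesis using True by simp
    qed (use assms(2) in simp)
  qed
  finally show ?thesis .
qed

lemma mem_cap_center: "0 \<le> s \<Longrightarrow> (c, c\<^sup>2) \<in> cap av b s \<longleftrightarrow> av (c - b) \<le> s"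
  by (simp add: cap_def)

lemma cap_cong: assumes "av (c - b) \<le> s" shows "cap av c s = cap av b s"
proof -
  have "av (x - c) \<le> s \<longleftrightarrow> av (x - b) \<le> s" for x
    using assms av_diff_trans[of x c s b] av_diff_trans[of x b s c] av_commute[of b c] by auto
  then show ?thesis by (simp add: cap_def)
qed

lemma cap_eq_iff: "0 \<le> s \<Longrightarrow> cap av c s = cap av b s \<longleftrightarrow> av (c - b) \<le> s"
  using cap_cong[of c b s] mem_cap_center[of s c c] mem_cap_center[of s c b] by auto

end

subsection \<open>Caps, tiles and good tiles\<close>

locale parabola_data = scales av \<pi> e mu N \<Theta>
  for av :: "'a::field \<Rightarrow> real" and \<pi> :: 'a and e :: "'a \<Rightarrow> complex" and mu :: "('a \<times> 'a) measure"
    and N :: nat and \<Theta> :: "nat \<Rightarrow> 'a set" +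
  fixes f :: "'a \<times> 'a \<Rightarrow> complex" and R :: real
  assumes R_eq: "R = P ^ (2 * N)" and nice_f: "nice f"
    and spectrum: "{\<xi>. fourier mu e f \<xi> \<noteq> 0} \<subseteq> nbhdP av R"
begin

abbreviation F :: "'a \<Rightarrow> 'a \<times> 'a \<Rightarrow> complex" where
  "F c \<equiv> fproj mu e f (cap av c (1 / P ^ N))"

lemma scale_bounds: "0 < 1 / P ^ k" "1 / P ^ k \<le> 1"
  using P_ge_1 by (simp_all add: one_le_power)

sublocale equivariant_family av \<pi> e mu N \<Theta> "\<lambda>c. fproj mu e f (cap av c (1 / P ^ N))"
proof unfold_locales
  show "nice (F c)" if "c \<in> \<Theta> N" for c
    by (intro nice_fproj nice_f lconst_indicator_cap av_Theta[OF that] scale_bounds)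
  show "F c (x + t) = e (- (fst t * c + snd t * c\<^sup>2)) * F c x" if "c \<in> \<Theta> N" "t \<in> T N c" for c t x
  proof (rule fproj_shift, rule e_dot2_cap)
    show "av (fst t + 2 * c * snd t) * (1 / P ^ N) \<le> 1" using that by (simp add: T_N field_simps)
    show "av (snd t) * (1 / P ^ N)\<^sup>2 \<le> 1"
      using that by (simp add: T_N power_divide power_mult mult.commute[of 2] field_simps)
  qed (use scale_bounds in simp_all)
qed

text \<open>The neighbourhood has thickness \<open>1 / R = (1 / P ^ N)\<^sup>2\<close>, the
  thickness of the small caps, so each point of the spectrum lies in exactly one cap with centre in
  \<open>\<Theta> N\<close>.\<close>

lemma sum_indicator_caps:
  assumes "fourier mu e f (x, y) \<noteq> 0" "C \<subseteq> \<Theta> N"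
  obtains c where "c \<in> \<Theta> N" "av (x - c) \<le> 1 / P ^ N" "av (y - x\<^sup>2) \<le> 1 / P ^ (2 * N)"
    "(\<Sum>d\<in>C. indicator (cap av d (1 / P ^ N)) (x, y)) = (if c \<in> C then 1 else (0 :: complex))"
proof -
  have xy: "av x \<le> 1" "av (y - x\<^sup>2) \<le> 1 / P ^ (2 * N)"
    using spectrum assms(1) by (auto simp: nbhdP_def R_eq)
  obtain c where c: "c \<in> \<Theta> N" "av (x - c) \<le> 1 / P ^ N" using Theta_ex[OF xy(1)] by blast
  have PN: "(1 / P ^ N)\<^sup>2 = 1 / P ^ (2 * N)" by (simp add: power_divide power_mult mult.commute[of 2])
  have ind: "(x, y) \<in> cap av d (1 / P ^ N) \<longleftrightarrow> d = c" if "d \<in> \<Theta> N" for d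
  proof
    assume "(x, y) \<in> cap av d (1 / P ^ N)"
    then have "av (d - x) \<le> 1 / P ^ N" by (simp add: cap_def av_commute)
    then show "d = c" using av_diff_trans[OF _ c(2)] Theta_unique that c(1) by blast
  qed (use c xy PN in \<open>simp add: cap_def\<close>)
  have "finite C" using assms(2) finite_subset finite_Theta by blast
  have "(\<Sum>d\<in>C. indicator (cap av d (1 / P ^ N)) (x, y)) = (\<Sum>d\<in>C. if d = c then 1 else (0 :: complex))"
    using assms(2) ind by (intro sum.cong refl) (auto simp: indicator_def)
  also have "\<dots> = (if c \<in> C then 1 else 0)" using \<open>finite C\<close> by simp
  finally show ?thesis using that c xy by blast
qed

lemma fproj_cap_eq_Bk:
  assumes "k \<le> N" "b \<in> \<Theta> k" shows "fproj mu e f (cap av b (1 / P ^ k)) x = Bk k b x"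
  unfolding Bk_def
proof (rule fproj_sum[OF nice_f])
  show "lconst (indicator (cap av c (1 / P ^ N)) :: _ \<Rightarrow> complex)" if "c \<in> cl N k b" for c
    by (intro lconst_indicator_cap av_Theta[OF cl_subset[OF that]] scale_bounds)
  fix \<xi> assume nz: "fourier mu e f \<xi> \<noteq> 0"
  obtain x y where xy: "\<xi> = (x, y)" by fastforce
  have "cl N k b \<subseteq> \<Theta> N" using cl_subset by blast
  then obtain c where c: "c \<in> \<Theta> N" "av (x - c) \<le> 1 / P ^ N" "av (y - x\<^sup>2) \<le> 1 / P ^ (2 * N)"
    "(\<Sum>d\<in>cl N k b. indicator (cap av d (1 / P ^ N)) (x, y)) = (if c \<in> cl N k b then 1 else (0 :: complex))"
    using sum_indicator_caps nz xy by blast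
  have "1 / P ^ (2 * N) \<le> 1 / P ^ (2 * k)" using assms(1) by (intro inverse_power_P_antimono) simp
  moreover have "(1 / P ^ k)\<^sup>2 = 1 / P ^ (2 * k)" by (simp add: power_divide power_mult mult.commute[of 2])
  ultimately have y: "av (y - x\<^sup>2) \<le> (1 / P ^ k)\<^sup>2" using c(3) by linarith
  have xc: "av (x - c) \<le> 1 / P ^ k" using c(2) inverse_power_P_antimono[OF assms(1)] by linarith
  have "av (x - b) \<le> 1 / P ^ k \<longleftrightarrow> av (c - b) \<le> 1 / P ^ k"
    using xc av_diff_trans[of x c _ b] av_diff_trans[of c x _ b] av_commute[of c x] by auto
  then have "\<xi> \<in> cap av b (1 / P ^ k) \<longleftrightarrow> c \<in> cl N k b" using y c(1) by (simp add: cap_def xy cl_def)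
  then show "indicator (cap av b (1 / P ^ k)) \<xi> = (\<Sum>c\<in>cl N k b. indicator (cap av c (1 / P ^ N)) \<xi> :: complex)"
    using c(4) unfolding xy by simp
qed

lemma sum_F_eq: "(\<Sum>c\<in>\<Theta> N. F c x) = f x"
proof -
  have "fproj mu e f UNIV x = (\<Sum>c\<in>\<Theta> N. F c x)"
  proof (rule fproj_sum[OF nice_f])
    show "lconst (indicator (cap av c (1 / P ^ N)) :: _ \<Rightarrow> complex)" if "c \<in> \<Theta> N" for c
      by (intro lconst_indicator_cap av_Theta[OF that] scale_bounds)
    fix \<xi> assume nz: "fourier mu e f \<xi> \<noteq> 0"
    obtain x y where xy: "\<xi> = (x, y)" by fastforce
    obtain c where "c \<in> \<Theta> N"
      "(\<Sum>d\<in>\<Theta> N. indicator (cap av d (1 / P ^ N)) (x, y)) = (if c \<in> \<Theta> N then 1 else (0 :: complex))"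
      using sum_indicator_caps[OF nz[unfolded xy] order_refl] by blast
    then show "indicator UNIV \<xi> = (\<Sum>c\<in>\<Theta> N. indicator (cap av c (1 / P ^ N)) \<xi> :: complex)"
      unfolding xy by simp
  qed
  then show ?thesis using fproj_UNIV[OF nice_f] by simp
qed

text \<open>The \<open>F d\<close> are mutually orthogonal and cannot cancel: pairing a vanishing
  sum with \<open>F c\<close> would give \<open>F c\<close> norm zero. Thus active arcs are among
  the caps counted by \<open>numcaps\<close>.\<close>

lemma F_nonzero_imp_Bk_nonzero:
  assumes "c \<in> cl N k b" "F c x \<noteq> 0" shows "\<exists>x. Bk k b x \<noteq> 0"
proof (rule ccontr)
  assume "\<not> (\<exists>x. Bk k b x \<noteq> 0)"
  then have "Bk k b x = 0" for x by blast
  then have zero: "(\<Sum>d\<in>cl N k b. F d x) = 0" for x unfolding Bk_def .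
  have c: "c \<in> \<Theta> N" using assms(1) by (rule cl_subset)
  have orth: "(\<integral>x. F d x * cnj (F c x) \<partial>mu) = 0" if d: "d \<in> cl N k b" "d \<noteq> c" for d
  proof -
    have dN: "d \<in> \<Theta> N" using d(1) by (rule cl_subset)
    then have "\<not> av (d - c) \<le> 1 / P ^ N" using Theta_unique c d(2) by blast
    then obtain t where t: "av t \<le> P ^ N" "e (t * (d - c)) \<noteq> 1" using char_trivial_imp_small by blast
    have T: "(- t, 0) \<in> T N a" for a using t(1) by (simp add: T_N)
    show ?thesis
    proof (rule integral_mult_cnj_eq_0[where t = "(- t, 0)"])
      show "F d (x + (- t, 0)) = e (t * d) * F d x" for x using B_twist[OF dN T] by simp
      show "F c (x + (- t, 0)) = e (t * c) * F c x" for x using B_twist[OF c T] by simp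
      show "e (t * d - t * c) \<noteq> 1" using t(2) by (simp add: right_diff_distrib)
    qed (intro nice_B dN c)+
  qed
  have "complex_of_real (\<integral>x. (cmod (F c x))\<^sup>2 \<partial>mu) = (\<integral>x. F c x * cnj (F c x) \<partial>mu)"
    by (rule of_real_integral_cmod_power2)
  also have "\<dots> = (\<Sum>d\<in>cl N k b. \<integral>x. F d x * cnj (F c x) \<partial>mu)"
    using orth assms(1) by (subst sum.remove[of _ c]) auto
  also have "\<dots> = (\<integral>x. (\<Sum>d\<in>cl N k b. F d x * cnj (F c x)) \<partial>mu)"
    by (rule nice_integral_sum[symmetric]) (intro nice_mult_nice nice_cnj nice_B c cl_subset)
  also have "\<dots> = 0" unfolding sum_distrib_right[symmetric] zero by simp
  finally have "(\<integral>x. (cmod (F c x))\<^sup>2 \<partial>mu) = 0" by simp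
  moreover have "0 < (\<integral>x. (cmod (F c x))\<^sup>2 \<partial>mu)"
    using assms(2) by (intro nice_integral_pos[of _ x] nice_cmod_power2 nice_B c) auto
  ultimately show False by simp
qed

lemma caps_eq: "caps av (1 / P ^ k) = (\<lambda>b. cap av b (1 / P ^ k)) ` \<Theta> k"
proof
  show "caps av (1 / P ^ k) \<subseteq> (\<lambda>b. cap av b (1 / P ^ k)) ` \<Theta> k"
  proof
    fix \<tau> assume "\<tau> \<in> caps av (1 / P ^ k)"
    then obtain c where c: "av c \<le> 1" "\<tau> = cap av c (1 / P ^ k)" by (auto simp: caps_def)
    then show "\<tau> \<in> (\<lambda>b. cap av b (1 / P ^ k)) ` \<Theta> k" using Theta_ex[OF c(1), of k] cap_cong by blast
  qed
qed (use av_Theta in \<open>auto simp: caps_def\<close>)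

lemma inj_on_cap: "inj_on (\<lambda>b. cap av b (1 / P ^ k)) (\<Theta> k)"
  by (rule inj_onI) (use scale_bounds[of k] in \<open>auto simp: cap_eq_iff intro: Theta_unique\<close>)

lemma card_active_le_numcaps:
  assumes "k \<le> N"
  shows "card {b\<in>\<Theta> k. \<exists>c\<in>cl N k b. \<exists>x. F c x \<noteq> 0} \<le> numcaps av mu e f (1 / P ^ k)"
proof -
  let ?act = "{b\<in>\<Theta> k. \<exists>c\<in>cl N k b. \<exists>x. F c x \<noteq> 0}"
  have "card ?act = card ((\<lambda>b. cap av b (1 / P ^ k)) ` ?act)"
    by (intro card_image[symmetric] inj_on_subset[OF inj_on_cap]) auto
  also have "\<dots> \<le> numcaps av mu e f (1 / P ^ k)"
    unfolding numcaps_def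
  proof (rule card_mono)
    show "finite {\<tau> \<in> caps av (1 / P ^ k). \<exists>x. fproj mu e f \<tau> x \<noteq> 0}" unfolding caps_eq by simp
    show "(\<lambda>b. cap av b (1 / P ^ k)) ` ?act \<subseteq> {\<tau> \<in> caps av (1 / P ^ k). \<exists>x. fproj mu e f \<tau> x \<noteq> 0}"
    proof
      fix \<tau> assume "\<tau> \<in> (\<lambda>b. cap av b (1 / P ^ k)) ` ?act"
      then obtain b c x where b: "\<tau> = cap av b (1 / P ^ k)" "b \<in> \<Theta> k" "c \<in> cl N k b" "F c x \<noteq> 0" by blast
      then have "\<exists>x. fproj mu e f \<tau> x \<noteq> 0"
        using F_nonzero_imp_Bk_nonzero[OF b(3,4)] fproj_cap_eq_Bk[OF assms b(2)] by simp
      then show "\<tau> \<in> {\<tau> \<in> caps av (1 / P ^ k). \<exists>x. fproj mu e f \<tau> x \<noteq> 0}"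
        using b caps_eq by blast
    qed
  qed
  finally show ?thesis .
qed

lemma inverse_sqrt_R: "1 / sqrt R = 1 / P ^ N"
proof -
  have "R = (P ^ N)\<^sup>2" by (simp add: R_eq power_mult mult.commute[of 2])
  then show ?thesis by simp
qed

lemma prec_iff:
  assumes "k \<le> N" "c \<in> \<Theta> N" "b \<in> \<Theta> k"
  shows "prec av (1 / P ^ N) (1 / P ^ k) (cap av c (1 / P ^ N)) (cap av b (1 / P ^ k)) \<longleftrightarrow> c \<in> cl N k b"
proof
  have Nk: "1 / P ^ N \<le> 1 / P ^ k" by (rule inverse_power_P_antimono[OF assms(1)])
  assume "prec av (1 / P ^ N) (1 / P ^ k) (cap av c (1 / P ^ N)) (cap av b (1 / P ^ k))"
  then obtain b' c' where *: "cap av c (1 / P ^ N) = cap av c' (1 / P ^ N)"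
    "cap av b (1 / P ^ k) = cap av b' (1 / P ^ k)"
    "{x. av (x - c') \<le> 1 / P ^ N} \<subseteq> {x. av (x - b') \<le> 1 / P ^ k}" unfolding prec_def by blast
  have "c' \<in> {x. av (x - c') \<le> 1 / P ^ N}" using scale_bounds[of N] by simp
  then have "av (c' - b') \<le> 1 / P ^ k" using *(3) by blast
  moreover have "av (c - c') \<le> 1 / P ^ k" using *(1) scale_bounds[of N] Nk by (simp add: cap_eq_iff)
  moreover have "av (b' - b) \<le> 1 / P ^ k" using *(2) scale_bounds[of k] by (simp add: cap_eq_iff av_commute)
  ultimately have "av (c - b) \<le> 1 / P ^ k" using av_diff_trans by blast
  then show "c \<in> cl N k b" using assms(2) by (simp add: cl_def)
next
  assume c: "c \<in> cl N k b"
  have Nk: "1 / P ^ N \<le> 1 / P ^ k" by (rule inverse_power_P_antimono[OF assms(1)])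
  have "{x. av (x - c) \<le> 1 / P ^ N} \<subseteq> {x. av (x - b) \<le> 1 / P ^ k}"
  proof
    fix x assume "x \<in> {x. av (x - c) \<le> 1 / P ^ N}"
    then have "av (x - c) \<le> 1 / P ^ k" using Nk by simp
    then show "x \<in> {x. av (x - b) \<le> 1 / P ^ k}" using c av_diff_trans[of x c _ b] by (simp add: cl_def)
  qed
  then show "prec av (1 / P ^ N) (1 / P ^ k) (cap av c (1 / P ^ N)) (cap av b (1 / P ^ k))"
    unfolding prec_def using av_Theta assms by blast
qed

lemma sqfun_eq:
  assumes "k \<le> N" "b \<in> \<Theta> k"
  shows "sqfun av mu e f R (1 / P ^ k) (cap av b (1 / P ^ k)) x = (\<Sum>c\<in>cl N k b. (cmod (F c x))\<^sup>2)"
proof -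
  have "{\<theta> \<in> caps av (1 / P ^ N). prec av (1 / P ^ N) (1 / P ^ k) \<theta> (cap av b (1 / P ^ k))}
      = (\<lambda>c. cap av c (1 / P ^ N)) ` cl N k b"
    using prec_iff[OF assms(1) _ assms(2)] cl_subset unfolding caps_eq by blast
  then show ?thesis unfolding sqfun_def inverse_sqrt_R
    by (simp add: sum.reindex inj_on_subset[OF inj_on_cap] subsetI cl_subset)
qed

section \<open>Tiles and averages over them\<close>

lemma tile0_eq: "tile0 av c (1 / P ^ k) R = T k c"
  by (auto simp: tile0_def T_def R_eq)

text \<open>Another base point in the cap gives the same centred tile by \<open>T_cong\<close>, so
  one subgroup \<open>T k b\<close> suffices.\<close>

lemma tiles_eq:
  "tiles av (1 / P ^ k) R (cap av b (1 / P ^ k)) = range (\<lambda>a. transl2 a (T k b))"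
proof -
  have center: "(c, c\<^sup>2) \<in> cap av b (1 / P ^ k) \<longleftrightarrow> av (c - b) \<le> 1 / P ^ k" for c
    using scale_bounds[of k] by (intro mem_cap_center) simp
  show ?thesis
  proof (rule set_eqI, rule iffI)
    fix U assume "U \<in> tiles av (1 / P ^ k) R (cap av b (1 / P ^ k))"
    then obtain c a where "av (c - b) \<le> 1 / P ^ k" "U = transl2 a (T k c)"
      unfolding tiles_def tile0_eq center by blast
    then show "U \<in> range (\<lambda>a. transl2 a (T k b))" using T_cong[of c b k] by simp
  next
    fix U assume "U \<in> range (\<lambda>a. transl2 a (T k b))"
    then obtain a where "U = transl2 a (T k b)" by blast
    moreover have "av (b - b) \<le> 1 / P ^ k" by simp
    ultimately show "U \<in> tiles av (1 / P ^ k) R (cap av b (1 / P ^ k))"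
      unfolding tiles_def tile0_eq center mem_Collect_eq by blast
  qed
qed

lemma T_add: "s \<in> T k b \<Longrightarrow> t \<in> T k b \<Longrightarrow> s + t \<in> T k b"
proof -
  assume st: "s \<in> T k b" "t \<in> T k b"
  have "av ((fst s + 2 * b * snd s) + (fst t + 2 * b * snd t)) \<le> P ^ (2 * N) / P ^ k"
    by (rule av_add_leI) (use st in \<open>simp_all add: T_def\<close>)
  moreover have "(fst s + 2 * b * snd s) + (fst t + 2 * b * snd t) = fst (s + t) + 2 * b * snd (s + t)"
    by (simp add: algebra_simps)
  ultimately show ?thesis using st unfolding T_def by (simp add: av_add_leI)
qed

lemma T_diff: "s \<in> T k b \<Longrightarrow> t \<in> T k b \<Longrightarrow> s - t \<in> T k b"
  using T_add[of s k b "- t"] T_minus by simp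

lemma transl2_T_cong: assumes "x - a \<in> T k b" shows "transl2 x (T k b) = transl2 a (T k b)"
proof (rule set_eqI)
  fix y
  have "y - a \<in> T k b" if "y - x \<in> T k b" using T_add[OF that assms] by simp
  moreover have "y - x \<in> T k b" if "y - a \<in> T k b" using T_diff[OF that assms] by simp
  ultimately show "y \<in> transl2 x (T k b) \<longleftrightarrow> y \<in> transl2 a (T k b)" by (auto simp: mem_transl2_iff)
qed

lemma mem_transl2_T_self: "x \<in> transl2 x (T k b)"
  by (simp add: mem_transl2_iff T_def)

lemma unit_ball_subset_T: assumes "k \<le> N" "b \<in> \<Theta> k" "nm t \<le> 1" shows "t \<in> T k b"
proof -
  have "P ^ k \<le> P ^ (2 * N)" using assms(1) P_ge_1 by (intro power_increasing) auto
  then have P1: "1 \<le> P ^ (2 * N) / P ^ k" "1 \<le> P ^ (2 * N)" using P_ge_1 by (simp_all add: one_le_power)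
  have "av (2 * b * snd t) \<le> 1"
    unfolding av_mult using av_2_le_1 av_Theta[OF assms(2)] assms(3) by (intro mult_le_one) (auto simp: nm_le_iff)
  then have "av (fst t + 2 * b * snd t) \<le> 1" using assms(3) by (intro av_add_leI) (auto simp: nm_le_iff)
  then have "av (fst t + 2 * b * snd t) \<le> P ^ (2 * N) / P ^ k" using P1 by linarith
  moreover have "av (snd t) \<le> P ^ (2 * N)" using assms(3) P1 unfolding nm_le_iff by linarith
  ultimately show ?thesis unfolding T_def by blast
qed

lemma T_bounded: assumes "b \<in> \<Theta> k" "t \<in> T k b" shows "nm t \<le> P ^ (2 * N)"
proof -
  have "av (2 * b * snd t) \<le> 1 * 1 * P ^ (2 * N)"
    unfolding av_mult using av_2_le_1 av_Theta[OF assms(1)] assms(2) by (intro mult_mono) (auto simp: T_def)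
  moreover have "P ^ (2 * N) / P ^ k \<le> P ^ (2 * N) / 1"
    using P_ge_1 by (intro divide_left_mono) (auto simp: one_le_power)
  then have "av (fst t + 2 * b * snd t) \<le> P ^ (2 * N)" using assms(2) by (simp add: T_def)
  ultimately have "av ((fst t + 2 * b * snd t) - 2 * b * snd t) \<le> P ^ (2 * N)" by (intro av_diff_leI) auto
  then show ?thesis using assms(2) by (simp add: nm_le_iff T_def)
qed

lemma nice_indicator_tile:
  assumes "k \<le> N" "b \<in> \<Theta> k" shows "nice (indicator (transl2 a (T k b)) :: _ \<Rightarrow> real)"
proof -
  have "x + t \<in> transl2 a (T k b) \<longleftrightarrow> x \<in> transl2 a (T k b)" if "nm t \<le> 1" for x t
  proof -
    have t: "t \<in> T k b" by (rule unit_ball_subset_T[OF assms that])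
    have "x + t - a = (x - a) + t" by (simp add: prod_eq_iff)
    then show ?thesis using T_add[OF _ t, of "x - a"] T_diff[OF _ t, of "(x - a) + t"]
      unfolding mem_transl2_iff by (metis add_diff_cancel)
  qed
  then have "lconst (indicator (transl2 a (T k b)) :: _ \<Rightarrow> real)"
    unfolding lconst_def indicator_def by (intro exI[of _ 1]) simp
  moreover have "nm x \<le> max (P ^ (2 * N)) (nm a)" if "x \<in> transl2 a (T k b)" for x
  proof -
    have "nm (x - a) \<le> P ^ (2 * N)" using that by (intro T_bounded[OF assms(2)]) (simp add: mem_transl2_iff)
    then show ?thesis using nm_add_leI[of "x - a" "max (P ^ (2 * N)) (nm a)" a] by simp
  qed
  then have "bsupp (indicator (transl2 a (T k b)) :: _ \<Rightarrow> real)"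
    unfolding bsupp_def by (intro exI[of _ "max (P ^ (2 * N)) (nm a)"]) (simp add: indicator_def)
  ultimately show ?thesis by (simp add: nice_def)
qed

lemma W_tile_invariant:
  assumes "k \<le> N" "x \<in> transl2 a (T k b)" shows "W k b x = W k b a"
proof -
  have "x = a + (x - a)" by simp
  moreover have "W k b (a + (x - a)) = W k b a"
    unfolding W_eq
  proof (intro sum.cong refl)
    fix d assume d: "d \<in> cl N k b"
    then have "x - a \<in> T k d" using assms(2) T_cong[of d b k] by (simp add: cl_def mem_transl2_iff)
    then show "E k (\<lambda>x. (cmod (F d x))\<^sup>2) (a + (x - a)) = E k (\<lambda>x. (cmod (F d x))\<^sup>2) a"
      using w_invariant[OF cl_subset[OF d]] by (intro E_T_invariant[OF assms(1), of d]) auto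
  qed
  ultimately show ?thesis by simp
qed

lemma measure_tile:
  assumes "k \<le> N" "b \<in> \<Theta> k"
  shows "measure mu (transl2 a (T k b)) = (\<integral>x. indicator (transl2 a (T k b)) x \<partial>mu)"
    "0 < measure mu (transl2 a (T k b))"
proof -
  show eq: "measure mu (transl2 a (T k b)) = (\<integral>x. indicator (transl2 a (T k b)) x \<partial>mu)" by simp
  show "0 < measure mu (transl2 a (T k b))"
    unfolding eq using mem_transl2_T_self[of a k b]
    by (intro nice_integral_pos[of _ a] nice_indicator_tile assms) auto
qed

text \<open>The shifts in \<open>Y k\<close> preserve the tile, so integrating \<open>W k b\<close>
  over the tile gives the integral of the square function; and \<open>W k b\<close> is constant
  there, so that integral is its value times the measure.\<close>

lemma avgsq_eq:
  assumes "k \<le> N" "b \<in> \<Theta> k"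
  shows "avgsq av mu e f R (1 / P ^ k) (cap av b (1 / P ^ k)) (transl2 a (T k b)) = W k b a"
proof -
  let ?U = "transl2 a (T k b)" and ?n = "real (card (Y k))"
  define g where "g x = (\<Sum>c\<in>cl N k b. (cmod (F c x))\<^sup>2)" for x
  have ng: "nice g" unfolding g_def[abs_def] by (intro nice_sum nice_w cl_subset)
  have nU: "nice (indicator ?U :: _ \<Rightarrow> real)" by (rule nice_indicator_tile[OF assms])
  have W: "W k b x = E k g x" for x unfolding W_def g_def[abs_def] ..
  have shift: "(\<integral>x. indicator ?U x * g (x + (h, 0)) \<partial>mu) = (\<integral>x. indicator ?U x * g x \<partial>mu)" if "h \<in> Y k" for h
  proof -
    have h: "(h, 0) \<in> T k b" by (intro T_horizontal av_Y that)
    have "x + (h, 0) \<in> ?U \<longleftrightarrow> x \<in> ?U" for x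
    proof -
      have "x + (h, 0) - a = (x - a) + (h, 0)" by (simp add: prod_eq_iff)
      then show ?thesis using T_add[OF _ h, of "x - a"] T_diff[OF _ h, of "(x - a) + (h, 0)"]
        unfolding mem_transl2_iff by (metis add_diff_cancel)
    qed
    then have "(\<integral>x. indicator ?U x * g (x + (h, 0)) \<partial>mu) = (\<integral>x. indicator ?U (x + (h, 0)) * g (x + (h, 0)) \<partial>mu)"
      by (simp add: indicator_def)
    also have "\<dots> = (\<integral>x. indicator ?U x * g x \<partial>mu)"
      by (rule nice_integral_shift) (intro nice_mult_nice nU ng)
    finally show ?thesis .
  qed
  have "W k b a * measure mu ?U = (\<integral>x. W k b a * indicator ?U x \<partial>mu)" by simp
  also have "\<dots> = (\<integral>x. indicator ?U x * E k g x \<partial>mu)"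
  proof (rule Bochner_Integration.integral_cong[OF refl])
    fix x show "W k b a * indicator ?U x = indicator ?U x * E k g x"
      using W_tile_invariant[OF assms(1), of x a b] W[of x] by (cases "x \<in> ?U") auto
  qed
  also have "\<dots> = (\<integral>x. (\<Sum>h\<in>Y k. indicator ?U x * g (x + (h, 0))) \<partial>mu) / ?n"
    unfolding E_def by (simp add: sum_distrib_left)
  also have "\<dots> = (\<Sum>h\<in>Y k. \<integral>x. indicator ?U x * g (x + (h, 0)) \<partial>mu) / ?n"
    by (subst nice_integral_sum) (intro nice_mult_nice nice_shift nU ng, rule refl)
  also have "\<dots> = (\<integral>x. indicator ?U x * g x \<partial>mu)" using shift card_Y_pos[of k] by simp
  finally have "W k b a * measure mu ?U = (\<integral>x. indicator ?U x * g x \<partial>mu)" .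
  then show ?thesis unfolding avgsq_def set_lebesgue_integral_def sqfun_eq[OF assms] g_def[symmetric]
    using measure_tile(2)[OF assms, of a] by (simp add: field_simps)
qed

text \<open>The tiles partition the plane and \<open>W k b\<close> is constant on each of them, so
  the truncated function is a step function on the good tiles.\<close>

lemma sum_good_tiles:
  assumes "k \<le> N" "b \<in> \<Theta> k" "0 < t"
  shows "(\<Sum>U\<in>{U \<in> range (\<lambda>a. transl2 a (T k b)). t \<le> avgsq av mu e f R (1 / P ^ k) (cap av b (1 / P ^ k)) U}.
      measure mu U * (avgsq av mu e f R (1 / P ^ k) (cap av b (1 / P ^ k)) U)\<^sup>2)
    = (\<integral>x. (if t \<le> W k b x then (W k b x)\<^sup>2 else 0) \<partial>mu)"
proof -
  let ?tile = "\<lambda>a. transl2 a (T k b)"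
  let ?avg = "avgsq av mu e f R (1 / P ^ k) (cap av b (1 / P ^ k))"
  have avg: "?avg (?tile a) = W k b a" for a by (rule avgsq_eq[OF assms(1,2)])
  define G where "G = {U \<in> range ?tile. t \<le> ?avg U}"
  have G: "U \<in> G \<longleftrightarrow> (\<exists>a. U = ?tile a \<and> t \<le> W k b a)" for U 
  proof
    assume "U \<in> G"
    then obtain a where "U = ?tile a" "t \<le> ?avg U" unfolding G_def by blast
    then have "U = ?tile a \<and> t \<le> W k b a" using avg[of a] by simp
    then show "\<exists>a. U = ?tile a \<and> t \<le> W k b a" by (rule exI)
  next
    assume "\<exists>a. U = ?tile a \<and> t \<le> W k b a"
    then obtain a where "U = ?tile a" "t \<le> W k b a" by blast
    then show "U \<in> G" using avg[of a] unfolding G_def by simp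
  qed
  have same: "U = ?tile x" if "U \<in> range ?tile" "x \<in> U" for U x
    using that transl2_T_cong[of x _ k b] by (auto simp: mem_transl2_iff)
  \<comment> \<open>A sum over an infinite set would be 0 by convention. A good tile has positive
    average and so is centred in the bounded support of \<open>W k b\<close>; finitely many unit
    balls cover that, each inside one tile.\<close>
  have fin: "finite G"
  proof -
    obtain A where A: "\<And>x. W k b x \<noteq> 0 \<Longrightarrow> nm x \<le> A" using nice_W[of k b] unfolding nice_def bsupp_def by blast
    have "1 < 1 / av \<pi>" using av_pi_pos av_pi_less_1 by simp
    then obtain m where m: "A < (1 / av \<pi>) ^ m" using real_arch_pow by blast
    define z where "z = inverse (\<pi> ^ m)"
    have z: "A \<le> av z" "z \<noteq> 0" "av z * av \<pi> ^ m = 1"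
      using m unfolding z_def av_inverse av_power by (simp_all add: power_divide inverse_eq_divide)
    obtain X where X: "finite X" "\<And>x. nm x \<le> av z \<longleftrightarrow> (\<exists>a\<in>X. nm (x - a) \<le> av z * av \<pi> ^ m)"
      using ball2_cover[OF z(2), of m] by metis
    have "G \<subseteq> ?tile ` X"
    proof
      fix U assume "U \<in> G"
      then obtain a where a: "U = ?tile a" "t \<le> W k b a" using G by blast
      then have "W k b a \<noteq> 0" using assms(3) by auto
      then have "nm a \<le> av z" using A[of a] z(1) by linarith
      then obtain x where x: "x \<in> X" "nm (a - x) \<le> 1" using X(2) z(3) by auto
      then have "?tile a = ?tile x" by (intro transl2_T_cong unit_ball_subset_T assms(1,2))
      then show "U \<in> ?tile ` X" using a x by blast
    qed
    then show ?thesis using X(1) finite_subset by blast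
  qed
  have "(if t \<le> W k b x then (W k b x)\<^sup>2 else 0) = (\<Sum>U\<in>G. (?avg U)\<^sup>2 * indicator U x)" for x
  proof -
    have "(\<Sum>U\<in>G. (?avg U)\<^sup>2 * indicator U x) = (\<Sum>U\<in>G. if U = ?tile x then (W k b x)\<^sup>2 else 0)"
    proof (rule sum.cong[OF refl])
      fix U assume "U \<in> G"
      then have "U \<in> range ?tile" by (simp add: G_def)
      then have U: "x \<in> U \<longleftrightarrow> U = ?tile x" using same[of U x] mem_transl2_T_self[of x k b] by blast
      show "(?avg U)\<^sup>2 * indicator U x = (if U = ?tile x then (W k b x)\<^sup>2 else 0)"
      proof (cases "x \<in> U")
        case True
        then have "?avg U = W k b x" using U avg[of x] by simp
        then show ?thesis using True U by simp
      next
        case False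
        then show ?thesis using U by simp
      qed
    qed
    also have "\<dots> = (if ?tile x \<in> G then (W k b x)\<^sup>2 else 0)" using fin by simp
    also have "?tile x \<in> G \<longleftrightarrow> t \<le> W k b x" unfolding G_def using avg[of x] by simp
    finally show ?thesis by simp
  qed
  then have "(\<integral>x. (if t \<le> W k b x then (W k b x)\<^sup>2 else 0) \<partial>mu) = (\<integral>x. (\<Sum>U\<in>G. (?avg U)\<^sup>2 * indicator U x) \<partial>mu)"
    by presburger
  also have "\<dots> = (\<Sum>U\<in>G. \<integral>x. (?avg U)\<^sup>2 * indicator U x \<partial>mu)"
  proof (rule nice_integral_sum)
    fix U assume "U \<in> G"
    then obtain a where "U = ?tile a" using G by blast
    then show "nice (\<lambda>x. (?avg U)\<^sup>2 * indicator U x)" by (auto intro!: nice_cmult nice_indicator_tile assms)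
  qed
  also have "\<dots> = (\<Sum>U\<in>G. measure mu U * (?avg U)\<^sup>2)" by (simp add: mult.commute)
  finally show ?thesis unfolding G_def ..
qed

end

subsection \<open>The wave envelope estimate\<close>

text \<open>A quadratic Taylor bound at 1/4, raised to the eighth power:
  \<open>(41 / 32) ^ 8\<close> exceeds 36/5.\<close>

lemma exp_1_square_ge: "36 / 5 \<le> (exp 1 :: real)\<^sup>2"
proof -
  have "1 + 1 / 4 + (1 / 4)\<^sup>2 / 2 \<le> exp (1 / 4 :: real)" by (rule exp_lower_Taylor_quadratic) simp
  then have "(41 / 32 :: real) ^ 8 \<le> exp (1 / 4) ^ 8" by (intro power_mono) (simp_all add: power2_eq_square)
  also have "exp (1 / 4 :: real) ^ 8 = exp 2" by (simp add: exp_of_nat_mult[symmetric])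
  also have "exp (2 :: real) = (exp 1)\<^sup>2" using exp_of_nat_mult[of 2 "1 :: real"] by simp
  finally show ?thesis by (simp add: power_divide eval_nat_numeral)
qed

text \<open>A rational lower bound for \<open>ln 2\<close>; cutting the exponent into 40 steps makes
  the quadratic bound for \<open>exp\<close> sharp enough.\<close>

lemma ln_ge_if_ge_2: assumes "2 \<le> (p :: real)" shows "343 / 500 \<le> ln p"
proof -
  have "exp (343 / 500 / 40 :: real) \<le> 1 + 343 / 500 / 40 + (343 / 500 / 40)\<^sup>2" by (rule exp_bound) auto
  then have "exp (343 / 500 / 40 :: real) ^ 40 \<le> (1 + 343 / 500 / 40 + (343 / 500 / 40)\<^sup>2) ^ 40"
    by (intro power_mono) auto
  also have "exp (343 / 500 / 40 :: real) ^ 40 = exp (343 / 500)" by (simp add: exp_of_nat_mult[symmetric])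
  also have "(1 + 343 / 500 / 40 + (343 / 500 / 40)\<^sup>2 :: real) ^ 40 \<le> 2"
    by (simp add: power_divide power2_eq_square)
  finally have "exp (343 / 500) \<le> p" using assms by linarith
  then show ?thesis using assms by (subst ln_ge_iff) auto
qed

text \<open>Both terms become multiples of \<open>N ^ 8 * p ^ 9\<close>, with 257 from the good part
  and 2188 from the bad parts. On the other side \<open>p ^ 3 \<ge> 8\<close> and
  \<open>ln p \<ge> 343 / 500\<close> yield the coefficient
  \<open>13 * 8 * 1024 * (343 / 500) ^ 10\<close>, which exceeds their sum 2445.\<close>

lemma constant_bound:
  fixes p :: real
  assumes p: "2 \<le> p" and N: "1 \<le> (N::nat)"
  shows "6561 * ((p\<^sup>2 + 1) * p\<^sup>2) + real N * (real N * ((21 / 10) ^ 4 * 25 * real N ^ 6 * p\<^sup>2 * (p\<^sup>2 * (9 / 4 * ((p\<^sup>2 + 2 * p) * (p * p\<^sup>2))))))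
    \<le> 13 * p ^ 12 * (2 * real N * ln p) ^ 10"
proof -
  have p8: "8 \<le> p ^ 3" and p32: "32 \<le> p ^ 5" and p4: "4 \<le> p\<^sup>2"
    using power_mono[OF p, of 3] power_mono[OF p, of 5] power_mono[OF p, of 2] by simp_all
  have N8: "1 \<le> real N ^ 8" using N by (simp add: one_le_power)
  have Np: "0 \<le> real N ^ 8 * p ^ 9" using p by simp
  have "6561 * ((p\<^sup>2 + 1) * p\<^sup>2) \<le> 6561 * ((5 / 4 * p\<^sup>2) * p\<^sup>2)"
    using p4 by (intro mult_left_mono mult_right_mono) auto
  also have "\<dots> = 32805 / 4 * p ^ 4" by (simp add: power2_eq_square power4_eq_xxxx)
  also have "\<dots> \<le> 32805 / 4 * (p ^ 5 / 32 * p ^ 4)"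
    using p p32 mult_right_mono[of 1 "p ^ 5 / 32" "p ^ 4"] by (intro mult_left_mono) auto
  also have "\<dots> = 32805 / 128 * p ^ 9" by (simp flip: power_add)
  also have "\<dots> \<le> 32805 / 128 * (real N ^ 8 * p ^ 9)"
    using p N8 by (intro mult_left_mono) (auto simp: mult_le_cancel_right1)
  finally have 1: "6561 * ((p\<^sup>2 + 1) * p\<^sup>2) \<le> 257 * (real N ^ 8 * p ^ 9)" using Np by linarith
  have "p\<^sup>2 + 2 * p \<le> 2 * p\<^sup>2" using p by (simp add: power2_eq_square)
  then have "(p\<^sup>2 + 2 * p) * (p * p\<^sup>2) \<le> (2 * p\<^sup>2) * (p * p\<^sup>2)" using p by (intro mult_right_mono) auto
  then have "real N * (real N * ((21 / 10) ^ 4 * 25 * real N ^ 6 * p\<^sup>2 * (p\<^sup>2 * (9 / 4 * ((p\<^sup>2 + 2 * p) * (p * p\<^sup>2))))))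
      \<le> real N * (real N * ((21 / 10) ^ 4 * 25 * real N ^ 6 * p\<^sup>2 * (p\<^sup>2 * (9 / 4 * ((2 * p\<^sup>2) * (p * p\<^sup>2))))))"
    using p by (intro mult_left_mono) auto
  also have "\<dots> = (21 / 10) ^ 4 * 25 * (9 / 4) * 2 * ((real N * real N * real N ^ 6) * (p\<^sup>2 * p\<^sup>2 * p\<^sup>2 * p * p\<^sup>2))"
    by (simp only: mult_ac)
  also have "real N * real N * real N ^ 6 = real N ^ 8" by (simp add: eval_nat_numeral)
  also have "p\<^sup>2 * p\<^sup>2 * p\<^sup>2 * p * p\<^sup>2 = p ^ 9" by (simp add: eval_nat_numeral mult_ac)
  also have "(21 / 10) ^ 4 * 25 * (9 / 4) * 2 * (real N ^ 8 * p ^ 9) \<le> 2188 * (real N ^ 8 * p ^ 9)"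
    using Np by (intro mult_right_mono) (simp_all add: power_divide)
  finally have 2: "real N * (real N * ((21 / 10) ^ 4 * 25 * real N ^ 6 * p\<^sup>2 * (p\<^sup>2 * (9 / 4 * ((p\<^sup>2 + 2 * p) * (p * p\<^sup>2))))))
      \<le> 2188 * (real N ^ 8 * p ^ 9)" .
  have ln: "(343 / 500) ^ 10 \<le> ln p ^ 10" using ln_ge_if_ge_2[OF p] by (intro power_mono) auto
  have "2445 * (real N ^ 8 * p ^ 9) \<le> (13 * 8 * (1024 * (343 / 500) ^ 10)) * (real N ^ 8 * p ^ 9)"
    using Np by (intro mult_right_mono) (simp_all add: power_divide)
  also have "\<dots> = (13 * 1024) * (real N ^ 8 * ((8 * p ^ 9) * (343 / 500) ^ 10))" by simp
  also have "\<dots> \<le> (13 * 1024) * (real N ^ 10 * ((p ^ 3 * p ^ 9) * ln p ^ 10))"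
    using p8 ln N p by (intro mult_mono mult_left_mono power_increasing) auto
  also have "\<dots> = 13 * p ^ 12 * (2 * real N * ln p) ^ 10"
    by (simp add: power_mult_distrib mult_ac flip: power_add)
  finally show ?thesis using 1 2 by linarith
qed

theorem mainTheorem2:
  fixes av :: "'a::field \<Rightarrow> real" and \<pi> :: 'a and e :: "'a \<Rightarrow> complex"
    and mu :: "('a \<times> 'a) measure" and f :: "'a \<times> 'a \<Rightarrow> complex" and R \<alpha> :: real
  assumes "nonarch_local_field av \<pi>"
    and "additive_char av \<pi> e"
    and "haar2 av mu"
    and "\<exists>m::nat. 1 \<le> m \<and> R = bfp av \<pi> ^ (2 * m)"
    and "schwartz_bruhat av f"
    and "{\<xi>. fourier mu e f \<xi> \<noteq> 0} \<subseteq> nbhdP av R"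
    and "0 < \<alpha>"
  shows "\<alpha> ^ 4 * measure mu {x. cmod (f x) > \<alpha>}
     \<le> 13 * bfp av \<pi> ^ 12 * (ln R) ^ 10 *
       (\<Sum>s\<in>{s. \<exists>k::int. s = bfp av \<pi> powi k \<and> 1 / sqrt R \<le> s \<and> s \<le> 1}.
          \<Sum>\<tau>\<in>caps av s. \<Sum>U\<in>good av \<pi> mu e f R \<alpha> s \<tau>.
             measure mu U * (avgsq av mu e f R s \<tau> U)\<^sup>2)"
proof -
  interpret haar_local_field av \<pi> e mu
    by unfold_locales (rule assms(1-3))+
  obtain N where N: "1 \<le> N" "R = P ^ (2 * N)" using assms(4) by blast
  have "\<exists>\<Theta>. \<forall>k. transversal (\<Theta> k) (1 / P ^ k)" using ex_transversal_P by (intro choice) blast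
  then obtain \<Theta> where \<Theta>: "\<And>k. transversal (\<Theta> k) (1 / P ^ k)" by blast
  interpret parabola_data av \<pi> e mu N \<Theta> f R
    by unfold_locales (use \<Theta> N(2) assms(6) schwartz_bruhat_nice[OF assms(5)] in auto)
  define rhs where "rhs s = (\<Sum>\<tau>\<in>caps av s. \<Sum>U\<in>good av \<pi> mu e f R \<alpha> s \<tau>. measure mu U * (avgsq av mu e f R s \<tau> U)\<^sup>2)" for s
  have rhs_nonneg: "0 \<le> rhs s" for s unfolding rhs_def by (intro sum_nonneg mult_nonneg_nonneg) auto
  have lnP: "0 < ln P" using P_ge_2 by simp
  have lnR: "ln R = 2 * real N * ln P" unfolding N(2) by (simp add: ln_realpow)
  have const_nonneg: "0 \<le> 13 * P ^ 12 * (ln R) ^ 10" by simp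
  have scales: "{s. \<exists>k::int. s = P powi k \<and> 1 / sqrt R \<le> s \<and> s \<le> 1} = (\<lambda>k. 1 / P ^ k) ` {0..N}"
  proof (rule set_eqI, rule iffI)
    fix s assume "s \<in> {s. \<exists>k::int. s = P powi k \<and> 1 / sqrt R \<le> s \<and> s \<le> 1}"
    then obtain k :: int where k: "s = P powi k" "1 / P ^ N \<le> s" "s \<le> 1" unfolding inverse_sqrt_R by blast
    have P1: "1 < P" using P_ge_2 by simp
    have "k \<le> 0" using k(1,3) P1 power_int_strict_increasing[of 0 k P] by (force simp: not_le[symmetric])
    then obtain m where m: "k = - int m" by (metis nonpos_int_cases)
    then have s: "s = 1 / P ^ m" using k(1) by (simp add: power_int_minus inverse_eq_divide)
    have "m \<le> N"
    proof (rule ccontr)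
      assume "\<not> m \<le> N"
      then have "P ^ N < P ^ m" using P1 by (intro power_strict_increasing) auto
      then have "1 / P ^ m < 1 / P ^ N" by (intro divide_strict_left_mono) auto
      then show False using k(2) s by simp
    qed
    then show "s \<in> (\<lambda>k. 1 / P ^ k) ` {0..N}" using s by auto
  next
    fix s assume "s \<in> (\<lambda>k. 1 / P ^ k) ` {0..N}"
    then obtain m where m: "m \<le> N" "s = 1 / P ^ m" by auto
    have "s = P powi (- int m)" using m(2) by (simp add: power_int_minus inverse_eq_divide)
    moreover have "1 / sqrt R \<le> s" unfolding inverse_sqrt_R m(2) by (rule inverse_power_P_antimono[OF m(1)])
    moreover have "s \<le> 1" using m(2) scale_bounds by simp
    ultimately show "s \<in> {s. \<exists>k::int. s = P powi k \<and> 1 / sqrt R \<le> s \<and> s \<le> 1}" by blast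
  qed
  have inj: "inj_on (\<lambda>k. 1 / P ^ k) {0..N}"
    using P_ge_2 by (intro inj_onI) (simp add: power_inject_exp)
  show ?thesis
  proof (cases "\<exists>x. f x \<noteq> 0")
    \<comment> \<open>For \<open>f = 0\<close> no cap is counted and the threshold would divide by
      zero; the superlevel set is empty.\<close>
    case False
    then have empty: "{x. cmod (f x) > \<alpha>} = {}" using assms(7) by auto
    show ?thesis unfolding empty measure_empty mult_zero_right
      by (intro mult_nonneg_nonneg const_nonneg sum_nonneg rhs_nonneg[unfolded rhs_def]) auto
  next
    case True
    define n where "n k = real (numcaps av mu e f (1 / P ^ k))" for k
    \<comment> \<open>The inequality in \<open>good\<close> solved for the average, with
      \<open>ln R / ln P = 2 * N\<close>.\<close>
    define thr where "thr k = \<alpha>\<^sup>2 / (2 * (exp 1)\<^sup>2 * (real N)\<^sup>2 * (n k)\<^sup>2)" for k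
    have N0: "0 < real N" using N(1) by simp
    have card_le: "real (card {b\<in>\<Theta> k. \<exists>c\<in>cl N k b. \<exists>x. F c x \<noteq> 0}) \<le> n k" if "k \<le> N" for k
      unfolding n_def using card_active_le_numcaps[OF that] by simp
    have n_pos: "0 < n k" if k: "k \<le> N" for k
    proof -
      \<comment> \<open>As \<open>f\<close> is not zero, some small cap is active, and so is the arc
        containing it at every level.\<close>
      obtain x where "(\<Sum>c\<in>\<Theta> N. F c x) \<noteq> 0" using True sum_F_eq by auto
      then obtain c where c: "c \<in> \<Theta> N" "F c x \<noteq> 0" by (rule sum.not_neutral_contains_not_neutral)
      obtain b where b: "b \<in> \<Theta> k" "av (c - b) \<le> 1 / P ^ k" using Theta_ex[OF av_Theta[OF c(1)]] by blast
      then have "b \<in> {b\<in>\<Theta> k. \<exists>c\<in>cl N k b. \<exists>x. F c x \<noteq> 0}" 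
        using c unfolding cl_def by blast
      then have "0 < card {b\<in>\<Theta> k. \<exists>c\<in>cl N k b. \<exists>x. F c x \<noteq> 0}" by (auto simp: card_gt_0_iff)
      then show ?thesis using card_le[OF k] by linarith
    qed
    have thr_pos: "0 < thr k" if "k \<le> N" for k
      unfolding thr_def using n_pos[OF that] N0 assms(7) by (intro divide_pos_pos mult_pos_pos) auto
    have thr_le: "thr k * (n k)\<^sup>2 \<le> 5 * \<alpha>\<^sup>2 / (72 * (real N)\<^sup>2)" if "k \<le> N" for k
    proof -
      have "thr k * (n k)\<^sup>2 = \<alpha>\<^sup>2 / (2 * (exp 1)\<^sup>2 * (real N)\<^sup>2)" unfolding thr_def using n_pos[OF that] by simp
      also have "\<dots> \<le> \<alpha>\<^sup>2 / (2 * (36 / 5) * (real N)\<^sup>2)"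
        using exp_1_square_ge N0 by (intro divide_left_mono mult_right_mono mult_left_mono mult_pos_pos) auto
      finally show ?thesis by simp
    qed
    interpret pruning av \<pi> e mu N \<Theta> F thr n \<alpha>
      by unfold_locales (use N(1) assms(7) thr_pos n_pos card_le thr_le in auto)
    have S_eq: "rhs (1 / P ^ k) = S k" if k: "k \<le> N" for k
    proof -
      have "rhs (1 / P ^ k) = (\<Sum>b\<in>\<Theta> k. \<Sum>U\<in>good av \<pi> mu e f R \<alpha> (1 / P ^ k) (cap av b (1 / P ^ k)).
          measure mu U * (avgsq av mu e f R (1 / P ^ k) (cap av b (1 / P ^ k)) U)\<^sup>2)"
        unfolding rhs_def caps_eq by (simp add: sum.reindex[OF inj_on_cap])
      also have "\<dots> = S k"
        unfolding S_def
      proof (rule sum.cong[OF refl])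
        fix b assume b: "b \<in> \<Theta> k"
        have iff: "\<alpha>\<^sup>2 / (real (numcaps av mu e f (1 / P ^ k)))\<^sup>2 \<le> (exp 1)\<^sup>2 / 2 * (ln R)\<^sup>2 / (ln P)\<^sup>2 * y \<longleftrightarrow> thr k \<le> y" for y
        proof -
          have "(exp 1)\<^sup>2 / 2 * (ln R)\<^sup>2 / (ln P)\<^sup>2 = 2 * (exp 1)\<^sup>2 * (real N)\<^sup>2"
            unfolding lnR using lnP by (simp add: power_mult_distrib)
          moreover have "thr k = \<alpha>\<^sup>2 / (n k)\<^sup>2 / (2 * (exp 1)\<^sup>2 * (real N)\<^sup>2)"
            by (simp add: thr_def)
          moreover have "0 < 2 * (exp 1)\<^sup>2 * (real N)\<^sup>2" using N0 by simp
          ultimately show ?thesis unfolding n_def by (simp only: pos_divide_le_eq mult.commute)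
        qed
        have "good av \<pi> mu e f R \<alpha> (1 / P ^ k) (cap av b (1 / P ^ k))
            = {U \<in> range (\<lambda>a. transl2 a (T k b)). thr k \<le> avgsq av mu e f R (1 / P ^ k) (cap av b (1 / P ^ k)) U}"
          unfolding good_def tiles_eq iff ..
        then show "(\<Sum>U\<in>good av \<pi> mu e f R \<alpha> (1 / P ^ k) (cap av b (1 / P ^ k)).
            measure mu U * (avgsq av mu e f R (1 / P ^ k) (cap av b (1 / P ^ k)) U)\<^sup>2)
            = (\<integral>x. (if thr k \<le> W k b x then (W k b x)\<^sup>2 else 0) \<partial>mu)"
          using sum_good_tiles[OF k b thr_pos[OF k]] by simp
      qed
      finally show ?thesis .
    qed
    have rhs_eq: "(\<Sum>s\<in>{s. \<exists>k::int. s = P powi k \<and> 1 / sqrt R \<le> s \<and> s \<le> 1}. rhs s) = (\<Sum>k\<in>{0..N}. S k)"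
      unfolding scales by (simp add: sum.reindex[OF inj] S_eq)
    have level: "lconst (\<lambda>x. \<alpha> < cmod (f x))"
      by (rule lconst_comp[OF nice_lconst[OF nice_f], where \<phi> = "\<lambda>y. \<alpha> < cmod y"])
    have "measure mu {x. cmod (f x) > \<alpha>} = (\<integral>x. (if \<alpha> < cmod (f x) then 1 else 0) \<partial>mu)"
      using assms(7) by (intro nice_superlevel(3)[OF nice_f level]) auto
    then have "\<alpha> ^ 4 * measure mu {x. cmod (f x) > \<alpha>} = (\<integral>x. \<alpha> ^ 4 * (if \<alpha> < cmod (f x) then 1 else 0) \<partial>mu)"
      by simp
    also have "\<dots> = (\<integral>x. (if \<alpha> < cmod (\<Sum>c\<in>\<Theta> N. F c x) then \<alpha> ^ 4 else 0) \<partial>mu)"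
      unfolding sum_F_eq by (intro Bochner_Integration.integral_cong) auto
    also have "\<dots> \<le> (6561 * ((P\<^sup>2 + 1) * P\<^sup>2) + real N * (real N * ((21 / 10) ^ 4 * 25 * real N ^ 6 * P\<^sup>2 * (P\<^sup>2 * (9 / 4 * ((P\<^sup>2 + 2 * P) * (P * P\<^sup>2))))))) * (\<Sum>k\<in>{0..N}. S k)"
      by (rule wave_envelope_estimate)
    also have "\<dots> \<le> 13 * P ^ 12 * (2 * real N * ln P) ^ 10 * (\<Sum>k\<in>{0..N}. S k)"
      by (intro mult_right_mono constant_bound P_ge_2 N(1) sum_nonneg S_nonneg)
    finally show ?thesis unfolding rhs_eq[symmetric] lnR rhs_def .
  qed
qed

end
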